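(* Let $\nu>0$, let $\{c_n\}_{n\ge1}$ be real numbers and $\{k_n\}_{n\ge1}$ positive integers with $c_n,k_n\to+\infty$ and $c_n/k_n\to0$, let $r_n=[n/k_n]$, and let $v_n=u^{(\nu)}_{[n/c_n]}$ be levels satisfying $$nP(X_1\le v_n<X_2)-c_n\nu\to0 \qquad (n\to+\infty).$$ Suppose there exists a sequence of integers $\{l_n\}_{n\ge1}$ such that, for the levels $v_n$, $$k_n\left[\alpha_{n,l_n-2}+P\left(\widetilde N_n([0,l_n/n])>0\right)\right]\to0,$$ and suppose that $$E\left[\overline N_{r_n}^2\mathbf 1_{\{\widehat N_{r_n}>1\}}\right]=o(c_n/k_n),$$ $$E\left[(Z_j(v_n))^2\mathbf 1_{\{\widehat N_{r_n}>1\}}\right]=o(1)\quad\text{uniformly in } j=1,\ldots,r_n,$$ $$\sigma_n^2=E[(Z_1(v_n))^2]\to\sigma^2<+\infty,$$ and, for each $\epsilon>0$, $$E\left[(Z_1^*(v_n))^2\mathbf 1_{\{(Z_1^*(v_n))^2>\epsilon c_n\}}\right]\to0.$$ Let $\widehat\eta_n^*=\widehat N_n/\overline N_n$ and $\eta_n=E[\widehat N_n]/E[\overline N_n]$ (at the levels $v_n$), and suppose moreover that $$\sqrt{c_n}\,(\eta_n-\eta)\to0\quad\text{and}\quad c_n^{-1}E\left[(Z_1^*(v_n))^4\mathbf 1_{\{(Z_1^*(v_n))^2\le c_n\}}\right]\to0.$$ Then, as $n\to+\infty$, $$\sqrt{\frac{\overline N_n}{\widehat\eta_n^*\left((\widehat\eta_n^*\widehat\sigma_n)^2-1\right)}}\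 (\widehat\eta_n^*-\eta)\ \xrightarrow{d}\ \mathcal N(0,1),$$ where $$\widehat\sigma_n^2=\frac{\sum_{i=1}^{n-3}Y_i^2\,\mathbf 1_{\{\widetilde N_{i,i}=0,\ X_{i+2}\le v_n<X_{i+3}\}}}{\widehat N_n}.$$
   Context: $\mathbf X=\{X_n\}_{n\ge1}$ is a stationary sequence of real random variables; $[x]$ is the integer part and $\mathbf 1_A$ the indicator of $A$. For a level $u$, there is an upcrossing of $u$ at $i$ if $X_i\le u<X_{i+1}$. For levels $\mathbf u=\{u_n\}$, $\widetilde N_n(B)=\sum_{i=1}^{n-1}\mathbf 1_{\{X_i\le u_n<X_{i+1}\}}\delta_{i/n}(B)$, $B\subset[0,1]$, where $\delta_a$ is unit mass at $a$; $\widetilde N_{i,j}$ is the number of upcrossings of $u_n$ at indices $i,\dots,j$ (and $0$ if $j<i$); in particular $\widetilde N_{i,i}=\mathbf 1_{\{X_i\le u_n<X_{i+1}\}}$. Mixing coefficients and condition $\Delta(\mathbf u)$: $\alpha_{n,l}=\max\{|P(A\cap B)-P(A)P(B)|: A\in\mathcal B_1^k(u_n),\,B\in\mathcal B_{k+l}^n(u_n),\,1\le k\le n-l\}$, where $\mathcal B_a^b(u_n)$ is the $\sigma$-field generated by the events $\{X_i\le u_n\}$, $a\le i\le b$. Condition $\Delta(\mathbf u)$ holds if $\alpha_{n,l_n}\to0$ for some $l_n=o(n)$. Condition $\widetilde D^{(3)}(\mathbf u)$: $\Delta(\mathbf u)$ holds and $nP(X_1\le u_n<X_2,\ \widetilde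 N_{3,3}=0,\ \widetilde N_{4,r'_n}>0)\to0$ for some $r'_n=[n/k'_n]$, where $k'_n$ are positive integers with $k'_n\to\infty$, $k'_nl_n/n\to0$, $k'_n\alpha_{n,l_n}\to0$. Upcrossings index: for each $\nu>0$ there are levels $\mathbf u^{(\nu)}=\{u_n^{(\nu)}\}$ with $nP(X_1\le u_n^{(\nu)}<X_2)\to\nu$, and $P(\widetilde N_n([0,1])=0)\to e^{-\eta\nu}$ for these levels, with a constant $0\le\eta\le1$; then $\mathbf X$ has upcrossings index $\eta$. For levels $u_n$, let $Y_i=0$ if $\widetilde N_{i+2,i+2}=0$, and $Y_i=k\ge1$ if $X_{i+2}\le u_n<X_{i+3},\,X_{i+4}\le u_n<X_{i+5},\ldots,X_{i+2k}\le u_n<X_{i+2k+1}$ and $\widetilde N_{i+2k+2,i+2k+2}=0$. $Z_i(u_n)$ is the length $Y_i$ given the event $A_i=\{\widetilde N_{i,i}=0,\ X_{i+2}\le u_n<X_{i+3}\}$; that is, $P(Z_i(u_n)=k)=P(Y_i=k\mid A_i)$, $k\ge1$ (independent of $i$), and an expectation $E[g(Z_j(u_n))\mathbf 1_C]$ with $C$ an event determined by $\mathbf X$ means $E[g(Y_j)\mathbf 1_C\mid A_j]$. At the levels $v_n$ (that is, with $\widetilde N_n$, $\widetilde N_{i,j}$, $\alpha_{n,l}$, $Y_i$, $A_i$ and $Z_i(u_n)$ all taken with $u_n=v_n$): $\widehat N_n=\sum_{i=1}^{n-3}\mathbf 1_{A_i}$, $\overline N_n=\sum_{i=1}^{n-3}Y_i\mathbf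 1_{A_i}$, and $\widehat N_{r_n}$, $\overline N_{r_n}$ are the same sums restricted to $i\le r_n$. $Z_1^*(v_n)$ is a random variable with the distribution of $Z_1(v_n)$. Standing assumptions: for each $\nu>0$, $\mathbf X$ satisfies $\widetilde D^{(3)}(\mathbf u^{(\nu)})$ and $P(X_3\le u_n^{(\nu)}<X_4,\ldots,X_{2j-1}\le u_n^{(\nu)}<X_{2j})\to0$ as $j\to\infty$; $\mathbf X$ has upcrossings index $\eta>0$; and $E[Z_1(v_n)]\to1/\eta$.
   Formalization: The formal theorem additionally assumes (ησ)² ≠ 1; without it the statement fails, e.g. for i.i.d. continuous X with slowly growing c_n, where η = σ = 1 and the normalized statistic is 0/0 with probability tending to 1. *)

theory Defs
  imports "HOL-Probability.Probability" "HOL-Library.Landau_Symbols"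
begin

text \<open>
  Sequences of random variables are indexed by \<open>{1..}\<close>; the value at index \<open>0\<close> is never used.
\<close>

definition stationary :: "'a measure \<Rightarrow> (nat \<Rightarrow> 'a \<Rightarrow> real) \<Rightarrow> bool" where
  "stationary M X \<longleftrightarrow>
     (\<forall>h. distr M (\<Pi>\<^sub>M i\<in>{1..}. borel) (\<lambda>\<omega>. \<lambda>i\<in>{1..}. X (i + h) \<omega>) =
          distr M (\<Pi>\<^sub>M i\<in>{1..}. borel) (\<lambda>\<omega>. \<lambda>i\<in>{1..}. X i \<omega>))"

definition upcrossing :: "(nat \<Rightarrow> 'a \<Rightarrow> real) \<Rightarrow> real \<Rightarrow> nat \<Rightarrow> 'a \<Rightarrow> bool" where
  "upcrossing X u i \<omega> \<longleftrightarrow> X i \<omega> \<le> u \<and> u < X (i + 1) \<omega>"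

text \<open>\<open>upcrossings X u i j\<close> is the number of upcrossings at indices \<open>i, \<dots>, j\<close>; \<open>upcrossing_process X u n B\<close> is
  the point process of upcrossings among the first \<open>n\<close> variables, evaluated on \<open>B\<close>.\<close>

definition upcrossings :: "(nat \<Rightarrow> 'a \<Rightarrow> real) \<Rightarrow> real \<Rightarrow> nat \<Rightarrow> nat \<Rightarrow> 'a \<Rightarrow> nat" where
  "upcrossings X u i j \<omega> = (\<Sum>m=i..j. of_bool (upcrossing X u m \<omega>))"

definition upcrossing_process ::
    "(nat \<Rightarrow> 'a \<Rightarrow> real) \<Rightarrow> real \<Rightarrow> nat \<Rightarrow> real set \<Rightarrow> 'a \<Rightarrow> nat" where
  "upcrossing_process X u n B \<omega> =
     (\<Sum>i=1..n-1. of_bool (upcrossing X u i \<omega>) * indicator B (real i / real n))"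

definition level_events ::
    "'a measure \<Rightarrow> (nat \<Rightarrow> 'a \<Rightarrow> real) \<Rightarrow> real \<Rightarrow> nat \<Rightarrow> nat \<Rightarrow> 'a set set" where
  "level_events M X u a b =
     sigma_sets (space M) {{\<omega>\<in>space M. X i \<omega> \<le> u} | i. a \<le> i \<and> i \<le> b}"

text \<open>
  The generated \<open>\<sigma>\<close>-fields are finite, so the supremum below is a maximum. Inserting \<open>0\<close> only
  matters for \<open>l \<ge> n\<close>, where the range of \<open>k\<close> is empty and the coefficient is then \<open>0\<close>.
\<close>
definition mixing_coeff ::
    "'a measure \<Rightarrow> (nat \<Rightarrow> 'a \<Rightarrow> real) \<Rightarrow> real \<Rightarrow> nat \<Rightarrow> nat \<Rightarrow> real" where
  "mixing_coeff M X u n l =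
     Sup (insert 0 {\<bar>measure M (A \<inter> B) - measure M A * measure M B\<bar> | A B k.
       1 \<le> k \<and> k \<le> n - l \<and>
       A \<in> level_events M X u 1 k \<and> B \<in> level_events M X u (k + l) n})"

definition Delta_with ::
    "'a measure \<Rightarrow> (nat \<Rightarrow> 'a \<Rightarrow> real) \<Rightarrow> (nat \<Rightarrow> real) \<Rightarrow> (nat \<Rightarrow> nat) \<Rightarrow> bool" where
  "Delta_with M X u l \<longleftrightarrow>
     (\<lambda>n. real (l n)) \<in> o(\<lambda>n. real n) \<and>
     (\<lambda>n. mixing_coeff M X (u n) n (l n)) \<longlonglongrightarrow> 0"

definition D3_condition ::
    "'a measure \<Rightarrow> (nat \<Rightarrow> 'a \<Rightarrow> real) \<Rightarrow> (nat \<Rightarrow> real) \<Rightarrow> bool" where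
  "D3_condition M X u \<longleftrightarrow>
     (\<exists>l k. Delta_with M X u l \<and>
        (\<forall>n\<ge>1. k n > 0) \<and> filterlim k at_top sequentially \<and>
        (\<lambda>n. real (k n) * real (l n) / real n) \<longlonglongrightarrow> 0 \<and>
        (\<lambda>n. real (k n) * mixing_coeff M X (u n) n (l n)) \<longlonglongrightarrow> 0 \<and>
        (\<lambda>n. real n * \<P>(\<omega> in M. upcrossing X (u n) 1 \<omega> \<and> upcrossings X (u n) 3 3 \<omega> = 0 \<and>
                              upcrossings X (u n) 4 (n div k n) \<omega> > 0)) \<longlonglongrightarrow> 0)"

text \<open>The index is taken along a given family of levels \<open>u \<nu> = (u \<nu> n)\<^sub>n\<close>, since the same
  family enters the other hypotheses.\<close>

definition has_upcrossings_index ::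
    "'a measure \<Rightarrow> (nat \<Rightarrow> 'a \<Rightarrow> real) \<Rightarrow> (real \<Rightarrow> nat \<Rightarrow> real) \<Rightarrow> real \<Rightarrow> bool" where
  "has_upcrossings_index M X u \<eta> \<longleftrightarrow>
     0 \<le> \<eta> \<and> \<eta> \<le> 1 \<and>
     (\<forall>\<nu>>0. (\<lambda>n. real n * \<P>(\<omega> in M. upcrossing X (u \<nu> n) 1 \<omega>)) \<longlonglongrightarrow> \<nu> \<and>
        (\<lambda>n. \<P>(\<omega> in M. upcrossing_process X (u \<nu> n) n {0..1} \<omega> = 0)) \<longlonglongrightarrow> exp (- \<eta> * \<nu>))"

text \<open>
  \<open>run_is X u i k\<close> says that the run starting at \<open>i + 2\<close> has length \<open>k\<close>; at most one \<open>k\<close>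
  qualifies. A run that never ends is given length \<open>0\<close> (a null event when the run probabilities
  tend to \<open>0\<close>).
\<close>
definition run_is :: "(nat \<Rightarrow> 'a \<Rightarrow> real) \<Rightarrow> real \<Rightarrow> nat \<Rightarrow> nat \<Rightarrow> 'a \<Rightarrow> bool" where
  "run_is X u i k \<omega> \<longleftrightarrow>
     (\<forall>m\<in>{1..k}. upcrossing X u (i + 2 * m) \<omega>) \<and> \<not> upcrossing X u (i + 2 * k + 2) \<omega>"

definition run_length :: "(nat \<Rightarrow> 'a \<Rightarrow> real) \<Rightarrow> real \<Rightarrow> nat \<Rightarrow> 'a \<Rightarrow> nat" where
  "run_length X u i \<omega> = (if \<exists>k. run_is X u i k \<omega> then THE k. run_is X u i k \<omega> else 0)"

definition run_start :: "(nat \<Rightarrow> 'a \<Rightarrow> real) \<Rightarrow> real \<Rightarrow> nat \<Rightarrow> 'a \<Rightarrow> bool" where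
  "run_start X u i \<omega> \<longleftrightarrow> \<not> upcrossing X u i \<omega> \<and> upcrossing X u (i + 2) \<omega>"

text \<open>The conditional probability given that a run starts after index \<open>i\<close>, and the law of the
  run length under it (the law of \<open>Z\<close>).\<close>

definition given_run ::
    "'a measure \<Rightarrow> (nat \<Rightarrow> 'a \<Rightarrow> real) \<Rightarrow> real \<Rightarrow> nat \<Rightarrow> 'a measure" where
  "given_run M X u i = uniform_measure M {\<omega>\<in>space M. run_start X u i \<omega>}"

definition run_law :: "'a measure \<Rightarrow> (nat \<Rightarrow> 'a \<Rightarrow> real) \<Rightarrow> real \<Rightarrow> nat measure" where
  "run_law M X u = distr (given_run M X u 1) (count_space UNIV) (run_length X u 1)"

text \<open>In the counts below \<open>m\<close> is the last index \<open>i\<close> of the sum.\<close>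

definition run_count :: "(nat \<Rightarrow> 'a \<Rightarrow> real) \<Rightarrow> real \<Rightarrow> nat \<Rightarrow> 'a \<Rightarrow> real" where
  "run_count X u m \<omega> = (\<Sum>i=1..m. of_bool (run_start X u i \<omega>))"

definition run_total :: "(nat \<Rightarrow> 'a \<Rightarrow> real) \<Rightarrow> real \<Rightarrow> nat \<Rightarrow> 'a \<Rightarrow> real" where
  "run_total X u m \<omega> =
     (\<Sum>i=1..m. real (run_length X u i \<omega>) * of_bool (run_start X u i \<omega>))"

definition eta_hat :: "(nat \<Rightarrow> 'a \<Rightarrow> real) \<Rightarrow> real \<Rightarrow> nat \<Rightarrow> 'a \<Rightarrow> real" where
  "eta_hat X u n \<omega> = run_count X u (n - 3) \<omega> / run_total X u (n - 3) \<omega>"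

definition sigma_hat :: "(nat \<Rightarrow> 'a \<Rightarrow> real) \<Rightarrow> real \<Rightarrow> nat \<Rightarrow> 'a \<Rightarrow> real" where
  "sigma_hat X u n \<omega> =
     sqrt ((\<Sum>i=1..n-3. (real (run_length X u i \<omega>))\<^sup>2 * of_bool (run_start X u i \<omega>))
           / run_count X u (n - 3) \<omega>)"

end

theory Submission
  imports Defs
begin

text \<open>
  Only the random set of upcrossing indices matters. Write \<open>N\<close> and \<open>L\<close> for the number and the total
  length of the runs, \<open>Q\<close> for the sum of their squared lengths, \<open>Z\<close> for a run length given that a
  run starts, \<open>p\<close> and \<open>q\<close> for the probabilities that a run starts, respectively that there is an
  upcrossing, at a fixed index. Telescoping the probabilities of long runs gives \<open>p E[Z] = q\<close>, so
  \<open>\<eta>\<^sub>n = p / q = 1 / E[Z]\<close>, and \<open>n p\<close> grows like \<open>\<nu> \<eta> c\<^sub>n\<close>.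

  All limits come from one principle (\<open>char_total_tendsto\<close>): if \<open>T\<^sub>n\<close> adds \<open>g\<^sub>n\<close> of the length over all
  runs, where \<open>g\<^sub>n\<close> is small in the sense of \<open>additivity_bound\<close>, and
  \<open>c\<^sub>n (E[exp (i g\<^sub>n(Z))] - 1) \<rightarrow> w\<close>, then \<open>E[exp (i T\<^sub>n)] \<rightarrow> exp (\<nu> \<eta> w)\<close>; the runs behave as in a compound Poisson sum. Its proof cuts \<open>{1..n}\<close> into \<open>k\<^sub>n\<close> blocks of length
  \<open>r\<^sub>n\<close>. With high probability no upcrossing falls into the last \<open>l\<^sub>n\<close> places of any block, so no run
  leaves its block and the block sums depend on windows separated by \<open>l\<^sub>n\<close>
  (\<open>run_sum_blocks\<close>). Mixing makes the characteristic function of the sum a \<open>k\<^sub>n\<close>-th power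
  (\<open>product_of_separated_blocks\<close>, \<open>block_char_power_approx\<close>). In one block there is almost always at
  most one run, and then \<open>exp (i T) - 1\<close> is additive over the runs; blocks with several runs are
  controlled by the bound on \<open>E[L\<^sup>2; N > 1]\<close> (\<open>block_char_expansion\<close>).

  The principle is applied to \<open>g\<^sub>n(z) = t z\<^sup>j / c\<^sub>n\<close> for \<open>j = 0, 1, 2\<close>, which gives weak laws for
  \<open>N\<close>, \<open>L\<close> and \<open>Q\<close>, and to \<open>g\<^sub>n(z) = t (1 - \<eta>\<^sub>n z) / sqrt c\<^sub>n\<close>, where a Lindeberg argument shows
  that \<open>(N - \<eta>\<^sub>n L) / sqrt c\<^sub>n\<close> is asymptotically normal with variance
  \<open>\<nu> \<eta> ((\<eta> \<sigma>)\<^sup>2 - 1)\<close> (\<open>char_centred_total\<close>). The studentized estimator is this quantity times a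
  continuous function of \<open>N / c\<^sub>n\<close>, \<open>L / c\<^sub>n\<close>, \<open>Q / c\<^sub>n\<close>, up to the bias \<open>sqrt c\<^sub>n (\<eta>\<^sub>n - \<eta>) \<rightarrow> 0\<close>,
  and Slutsky's argument finishes the proof.
\<close>

section \<open>Configurations of upcrossings\<close>

text \<open>
  Run statistics are functionals of the set of upcrossing indices. Giving such sets the
  \<open>\<sigma>\<close>-algebra generated by membership lets measurability and stationarity be transferred from the
  process to all of these functionals at once.
\<close>

definition config_space :: "nat set measure" where
  "config_space = vimage_algebra UNIV (\<lambda>s i. i \<in> s) (\<Pi>\<^sub>M i\<in>UNIV. count_space UNIV)"

lemma space_config_space [simp]: "space config_space = UNIV"
  by (simp add: config_space_def)

lemma pred_member_config [measurable]: "Measurable.pred config_space (\<lambda>s. i \<in> s)"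
proof -
  have "(\<lambda>s i. i \<in> s) \<in> config_space \<rightarrow>\<^sub>M (\<Pi>\<^sub>M i\<in>UNIV. count_space UNIV)"
    unfolding config_space_def by (rule measurable_vimage_algebra1) (auto simp: space_PiM)
  from measurable_compose[OF this measurable_component_singleton[of i]]
  show ?thesis by simp
qed

lemma measurable_into_config_space:
  assumes "\<And>i. Measurable.pred N (\<lambda>x. i \<in> f x)"
  shows "f \<in> N \<rightarrow>\<^sub>M config_space"
  unfolding config_space_def
  by (rule measurable_vimage_algebra2) (auto intro!: measurable_PiM_single' assms)

text \<open>
  Index \<open>0\<close> is kept out: the process starts at index \<open>1\<close>.
\<close>

definition shift_down :: "nat \<Rightarrow> nat set \<Rightarrow> nat set" where
  "shift_down h s = {i. 1 \<le> i \<and> i + h \<in> s}"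

lemma measurable_shift [measurable]: "shift_down h \<in> config_space \<rightarrow>\<^sub>M config_space"
  by (rule measurable_into_config_space) (simp add: shift_down_def)

lemma measurable_restrict_config [measurable]: "(\<lambda>s. s \<inter> A) \<in> config_space \<rightarrow>\<^sub>M config_space"
  by (rule measurable_into_config_space) simp

text \<open>
  Runs are read off an arbitrary index set, not only off the upcrossings of the process, because the
  block decomposition needs the runs of configurations that are cut off at the end of a window.
\<close>

definition run_at_is :: "nat set \<Rightarrow> nat \<Rightarrow> nat \<Rightarrow> bool" where
  "run_at_is s i k \<longleftrightarrow> (\<forall>m\<in>{1..k}. i + 2 * m \<in> s) \<and> i + 2 * k + 2 \<notin> s"

definition run_at :: "nat set \<Rightarrow> nat \<Rightarrow> nat" where
  "run_at s i = (if \<exists>k. run_at_is s i k then THE k. run_at_is s i k else 0)"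

definition starts_at :: "nat set \<Rightarrow> nat \<Rightarrow> bool" where
  "starts_at s i \<longleftrightarrow> i \<notin> s \<and> i + 2 \<in> s"

definition run_sum :: "(nat \<Rightarrow> real) \<Rightarrow> nat set \<Rightarrow> nat \<Rightarrow> nat \<Rightarrow> real" where
  "run_sum g s a h = (\<Sum>i\<in>{a<..a+h}. g (run_at s i) * of_bool (starts_at s i))"

lemma run_at_is_unique:
  assumes "run_at_is s i k" "run_at_is s i k'"
  shows "k = k'"
proof (rule ccontr)
  have *: False if "run_at_is s i a" "run_at_is s i b" "a < b" for a b
  proof -
    have "i + 2 * (a + 1) \<in> s"
      using that unfolding run_at_is_def by force
    with that show False unfolding run_at_is_def by simp
  qed
  assume "k \<noteq> k'"
  then show False
    using *[of k k'] *[of k' k] assms by linarith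
qed

lemma run_at_eqI: "run_at_is s i k \<Longrightarrow> run_at s i = k"
  unfolding run_at_def using run_at_is_unique by (auto intro!: the_equality)

lemma run_at_cong:
  assumes "\<And>k. run_at_is s i k = run_at_is t j k"
  shows "run_at s i = run_at t j"
proof -
  have "run_at_is s i = run_at_is t j"
    using assms by auto
  then show ?thesis unfolding run_at_def by (simp only:)
qed

lemma pred_starts_at [measurable]: "Measurable.pred config_space (\<lambda>s. starts_at s i)"
  unfolding starts_at_def by measurable

lemma pred_run_at_is [measurable]: "Measurable.pred config_space (\<lambda>s. run_at_is s i k)"
  unfolding run_at_is_def by measurable

lemma run_at_Least: "run_at s i = (if \<exists>k. run_at_is s i k then LEAST k. run_at_is s i k else 0)"
  by (metis run_at_eqI run_at_def LeastI_ex)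

lemma measurable_run_at [measurable]: "(\<lambda>s. run_at s i) \<in> config_space \<rightarrow>\<^sub>M count_space UNIV"
  unfolding run_at_Least by measurable

lemma measurable_run_sum [measurable]: "(\<lambda>s. run_sum g s a h) \<in> borel_measurable config_space"
  unfolding run_sum_def by measurable

text \<open>
  A run advances in steps of two, so it cannot jump over the gap behind the window, which has at least
  two places. Hence cutting the configuration at the window changes no run that starts in the window.
\<close>

lemma run_sum_local:
  assumes gap: "s \<inter> {a+h<..a+r+2} = {}" and "h \<le> r"
  shows "run_sum g s a r = run_sum g (s \<inter> {a<..a+h}) a h"
proof -
  let ?t = "s \<inter> {a<..a+h}"
  have out: "j \<notin> s" if "a + h < j" "j \<le> a + r + 2" for j
    using gap that by auto
  have run: "run_at s i = run_at ?t i" if i: "i \<in> {a<..a+h}" for i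
  proof (rule run_at_cong)
    fix k
    have reach: "i + 2 * k \<le> a + h" if "\<forall>m\<in>{1..k}. i + 2 * m \<in> s" for k
      using that
    proof (induction k)
      case (Suc k)
      have prev: "\<forall>m\<in>{1..k}. i + 2 * m \<in> s"
        using Suc.prems by simp
      have "i + 2 * Suc k \<in> s"
        by (rule bspec[OF Suc.prems]) simp
      moreover have "i + 2 * Suc k \<le> a + r + 2"
        using Suc.IH[OF prev] \<open>h \<le> r\<close> by simp
      ultimately show ?case
        using out[of "i + 2 * Suc k"] by (meson not_le_imp_less)
    next
      case 0
      show ?case using i by simp
    qed
    have reach': "i + 2 * m \<le> a + h" if "\<forall>m\<in>{1..k}. i + 2 * m \<in> s" "m \<le> k" for m
      using reach[of k] that by linarith
    \<comment> \<open>the place that ends the run may lie in the gap, where both configurations are empty\<close>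
    have last: "i + 2 * k + 2 \<in> s \<longleftrightarrow> i + 2 * k + 2 \<in> ?t" if "i + 2 * k \<le> a + h"
    proof -
      have "i + 2 * k + 2 \<le> a + r + 2" "a < i + 2 * k + 2"
        using that i \<open>h \<le> r\<close> by auto
      then show ?thesis using out[of "i + 2 * k + 2"]
        by (meson Int_iff greaterThanAtMost_iff not_le_imp_less)
    qed
    show "run_at_is s i k = run_at_is ?t i k"
      unfolding run_at_is_def
    proof (intro iffI conjI ballI)
      assume L: "(\<forall>m\<in>{1..k}. i + 2 * m \<in> s) \<and> i + 2 * k + 2 \<notin> s"
      show "i + 2 * m \<in> ?t" if "m \<in> {1..k}" for m
        using L reach'[of m] that i by auto
      show "i + 2 * k + 2 \<notin> ?t" using L by blast
    next
      assume R: "(\<forall>m\<in>{1..k}. i + 2 * m \<in> ?t) \<and> i + 2 * k + 2 \<notin> ?t"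
      then show "i + 2 * m \<in> s" if "m \<in> {1..k}" for m
        using that by blast
      have "\<forall>m\<in>{1..k}. i + 2 * m \<in> s" using R by blast
      then show "i + 2 * k + 2 \<notin> s" using last[OF reach] R by simp
    qed
  qed
  have start: "starts_at s i = starts_at ?t i" if "i \<in> {a<..a+h}" for i
    using that out[of "i + 2"] \<open>h \<le> r\<close> unfolding starts_at_def by (auto intro!: leI)
  have "run_sum g s a r = (\<Sum>i\<in>{a<..a+h}. g (run_at s i) * of_bool (starts_at s i))"
    unfolding run_sum_def
  proof (rule sum.mono_neutral_right)
    show "\<forall>i\<in>{a<..a + r} - {a<..a + h}. g (run_at s i) * of_bool (starts_at s i) = 0"
      using out by (auto simp: starts_at_def)
  qed (use \<open>h \<le> r\<close> in auto)
  then show ?thesis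
    unfolding run_sum_def using run start by (simp only: cong: sum.cong)
qed

lemma run_sum_shift: "run_sum g s a h = run_sum g (shift_down a s) 0 h"
proof -
  have run: "run_at s (i + a) = run_at (shift_down a s) i" for i
    by (rule run_at_cong) (auto simp: run_at_is_def shift_down_def algebra_simps)
  have start: "starts_at s (i + a) = starts_at (shift_down a s) i" if "1 \<le> i" for i
    using that by (auto simp: starts_at_def shift_down_def algebra_simps)
  have "g (run_at s i) * of_bool (starts_at s i) =
      g (run_at (shift_down a s) (i - a)) * of_bool (starts_at (shift_down a s) (i - a))" if "a < i" for i
    using run[of "i - a"] start[of "i - a"] that by simp
  then show ?thesis
    unfolding run_sum_def
    by (intro sum.reindex_bij_witness[of _ "\<lambda>i. i + a" "\<lambda>i. i - a"])
      auto
qed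

lemma run_sum_split: "run_sum g s 0 (k * r) = (\<Sum>j<k. run_sum g s (j * r) r)"
proof (induction k)
  case (Suc k)
  have "{0<..Suc k * r} = {0<..k * r} \<union> {k * r<..k * r + r}"
    by auto
  then have "run_sum g s 0 (Suc k * r) = run_sum g s 0 (k * r) + run_sum g s (k * r) r"
    unfolding run_sum_def
    by (simp only: add_0) (rule sum.union_disjoint; auto)
  then show ?case using Suc by simp
qed (simp add: run_sum_def)

text \<open>
  The blocks exhaust the indices up to \<open>k * r\<close>, which may end before or after \<open>m\<close>; the last
  assumption says that no run starts in the difference.
\<close>

lemma run_sum_blocks:
  assumes blocks: "\<And>j. j < k \<Longrightarrow> s \<inter> {j*r+h<..j*r+r+2} = {}" and "h \<le> r"
    and edge: "s \<inter> {min (k*r) m + 2<..max (k*r) m + 2} = {}"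
  shows "run_sum g s 0 m = (\<Sum>j<k. run_sum g (s \<inter> {j*r<..j*r+h}) (j*r) h)"
proof -
  have 1: "run_sum g s 0 m = run_sum g s 0 (k * r)"
    unfolding run_sum_def
  proof -
    have zero: "g (run_at s i) * of_bool (starts_at s i) = 0"
      if "i \<in> {0<..0 + m} - {0<..0 + k * r} \<or> i \<in> {0<..0 + k * r} - {0<..0 + m}" for i
    proof -
      have "i + 2 \<in> {min (k*r) m + 2<..max (k*r) m + 2}" using that by auto
      then have "i + 2 \<notin> s" using edge by blast
      then show ?thesis by (simp add: starts_at_def)
    qed
    then show "(\<Sum>i\<in>{0<..0 + m}. g (run_at s i) * of_bool (starts_at s i)) =
        (\<Sum>i\<in>{0<..0 + k * r}. g (run_at s i) * of_bool (starts_at s i))"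
      by (intro sum.mono_neutral_cong) blast+
  qed
  show ?thesis
    unfolding 1 run_sum_split
    by (intro sum.cong refl run_sum_local) (use blocks \<open>h \<le> r\<close> in auto)
qed

section \<open>Stationarity\<close>

definition crossings :: "real \<Rightarrow> (nat \<Rightarrow> real) \<Rightarrow> nat set" where
  "crossings u x = {i. 1 \<le> i \<and> x i \<le> u \<and> u < x (i + 1)}"

lemma measurable_crossings: "crossings u \<in> (\<Pi>\<^sub>M i\<in>{1..}. borel) \<rightarrow>\<^sub>M config_space"
proof (rule measurable_into_config_space)
  fix i :: nat
  have [measurable]: "(\<lambda>x. x j) \<in> borel_measurable (\<Pi>\<^sub>M i\<in>{1..}. borel :: real measure)" if "1 \<le> j" for j :: nat
    by (rule measurable_component_singleton) (use that in auto)
  show "Measurable.pred (\<Pi>\<^sub>M i\<in>{1..}. borel) (\<lambda>x. i \<in> crossings u x)"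
  proof (cases "1 \<le> i")
    case True
    then have [measurable]: "(\<lambda>x. x i) \<in> borel_measurable (\<Pi>\<^sub>M i\<in>{1..}. borel :: real measure)" 
      "(\<lambda>x. x (i+1)) \<in> borel_measurable (\<Pi>\<^sub>M i\<in>{1..}. borel :: real measure)" by simp_all
    show ?thesis unfolding crossings_def by simp
  qed (simp add: crossings_def)
qed

locale stationary_sequence = prob_space M for M :: "'a measure" +
  fixes X :: "nat \<Rightarrow> 'a \<Rightarrow> real"
  assumes measurable_X: "1 \<le> i \<Longrightarrow> X i \<in> borel_measurable M"
    and stationary_X: "stationary M X"
begin

definition config :: "real \<Rightarrow> 'a \<Rightarrow> nat set" where
  "config u \<omega> = crossings u (\<lambda>i. X i \<omega>)"

lemma measurable_config [measurable]: "config u \<in> M \<rightarrow>\<^sub>M config_space"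
  and distr_shift_config:
    "distr M config_space (\<lambda>\<omega>. shift_down h (config u \<omega>)) = distr M config_space (config u)"
proof -
  let ?P = "\<Pi>\<^sub>M i\<in>{1..}. borel :: real measure"
  let ?Y = "\<lambda>h \<omega>. \<lambda>i\<in>{1..}. X (i + h) \<omega>"
  have Y: "?Y h \<in> M \<rightarrow>\<^sub>M ?P" for h
    by (rule measurable_restrict) (auto intro: measurable_X)
  have shift_eq: "crossings u (?Y h \<omega>) = shift_down h (config u \<omega>)" for h \<omega>
    by (auto simp: crossings_def shift_down_def config_def algebra_simps)
  have [simp]: "shift_down 0 (config u \<omega>) = config u \<omega>" for \<omega>
    by (auto simp: shift_down_def config_def crossings_def)
  have "(\<lambda>\<omega>. crossings u (?Y 0 \<omega>)) \<in> M \<rightarrow>\<^sub>M config_space"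
    by (rule measurable_compose[OF Y measurable_crossings])
  then show "config u \<in> M \<rightarrow>\<^sub>M config_space"
    unfolding shift_eq by simp
  have law: "distr M config_space (\<lambda>\<omega>. shift_down h (config u \<omega>)) = distr (distr M ?P (?Y h)) config_space (crossings u)" for h
    by (subst distr_distr[OF measurable_crossings Y]) (simp only: comp_def shift_eq)
  have "distr M ?P (?Y h) = distr M ?P (?Y 0)"
    using stationary_X unfolding stationary_def by simp
  with law[of h] law[of 0] show "distr M config_space (\<lambda>\<omega>. shift_down h (config u \<omega>)) = distr M config_space (config u)"
    by simp
qed

lemma integral_shift:
  fixes f :: "nat set \<Rightarrow> 'b::{banach, second_countable_topology}"
  assumes [measurable]: "f \<in> borel_measurable config_space"
  shows "(LINT \<omega>|M. f (shift_down h (config u \<omega>))) = (LINT \<omega>|M. f (config u \<omega>))"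
  using integral_distr[of "\<lambda>\<omega>. shift_down h (config u \<omega>)" M config_space f]
    integral_distr[of "config u" M config_space f] distr_shift_config[of h u] by simp

lemma integrable_shift:
  fixes f :: "nat set \<Rightarrow> 'b::{banach, second_countable_topology}"
  assumes [measurable]: "f \<in> borel_measurable config_space"
  shows "integrable M (\<lambda>\<omega>. f (shift_down h (config u \<omega>))) \<longleftrightarrow> integrable M (\<lambda>\<omega>. f (config u \<omega>))"
  using integrable_distr_eq[of "\<lambda>\<omega>. shift_down h (config u \<omega>)" M config_space f]
    integrable_distr_eq[of "config u" M config_space f] distr_shift_config[of h u] by simp

lemma prob_shift:
  assumes [measurable]: "Measurable.pred config_space P"
  shows "\<P>(\<omega> in M. P (shift_down h (config u \<omega>))) = \<P>(\<omega> in M. P (config u \<omega>))"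
proof -
  have "(LINT \<omega>|M. of_bool (P (shift_down h (config u \<omega>)))) = (LINT \<omega>|M. of_bool (P (config u \<omega>)) :: real)"
    by (rule integral_shift) measurable
  moreover have "(LINT \<omega>|M. of_bool (Q \<omega>) :: real) = \<P>(\<omega> in M. Q \<omega>)" if [measurable]: "Measurable.pred M Q" for Q
  proof -
    have "(LINT \<omega>|M. of_bool (Q \<omega>) :: real) = (LINT \<omega>|M. indicator {\<omega>\<in>space M. Q \<omega>} \<omega>)"
      by (rule Bochner_Integration.integral_cong) (auto simp: indicator_def)
    then show ?thesis by simp
  qed
  ultimately show ?thesis by simp
qed

lemma AE_shift:
  assumes [measurable]: "Measurable.pred config_space P" and "AE \<omega> in M. P (config u \<omega>)"
  shows "AE \<omega> in M. P (shift_down h (config u \<omega>))"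
proof -
  have P: "{s \<in> space config_space. P s} \<in> sets config_space"
    by measurable
  have "AE s in distr M config_space (config u). P s"
    using assms(2) by (subst AE_distr_iff[OF _ P]) measurable
  then have "AE s in distr M config_space (\<lambda>\<omega>. shift_down h (config u \<omega>)). P s"
    by (simp only: distr_shift_config)
  then show ?thesis by (subst (asm) AE_distr_iff[OF _ P]) measurable
qed

lemma in_config: "i \<in> config u \<omega> \<longleftrightarrow> 1 \<le> i \<and> upcrossing X u i \<omega>"
  by (auto simp: config_def crossings_def upcrossing_def)

lemma run_length_config: "run_length X u i \<omega> = run_at (config u \<omega>) i"
proof -
  have "(\<lambda>k. run_is X u i k \<omega>) = run_at_is (config u \<omega>) i"
    by (auto simp: run_is_def run_at_is_def in_config)
  then show ?thesis
    unfolding run_length_def run_at_def by metis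
qed

lemma run_start_config: "1 \<le> i \<Longrightarrow> run_start X u i \<omega> \<longleftrightarrow> starts_at (config u \<omega>) i"
  by (simp add: run_start_def starts_at_def in_config)

lemma sum_runs_config:
  "(\<Sum>i=1..m. g (run_length X u i \<omega>) * of_bool (run_start X u i \<omega>)) = run_sum g (config u \<omega>) 0 m"
  unfolding run_sum_def run_length_config
  by (intro sum.cong) (auto simp: run_start_config)

end

section \<open>Mixing and products over separated blocks\<close>

lemma (in prob_space) integrable_function_of_discrete:
  fixes f :: "'b \<Rightarrow> complex"
  assumes [measurable]: "D \<in> M \<rightarrow>\<^sub>M count_space UNIV" and "\<And>d. norm (f d) \<le> 1"
  shows "integrable M (\<lambda>\<omega>. f (D \<omega>))"
proof (rule integrable_const_bound[where B = 1])
  show "(\<lambda>\<omega>. f (D \<omega>)) \<in> borel_measurable M"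
    by (rule measurable_compose[OF assms(1)]) simp
qed (use assms(2) in auto)

lemma (in prob_space) integral_of_bool:
  assumes [measurable]: "Measurable.pred M P"
  shows "(LINT \<omega>|M. of_bool (P \<omega>) :: complex) = of_real \<P>(\<omega> in M. P \<omega>)"
proof -
  have "(LINT \<omega>|M. of_bool (P \<omega>) :: complex) = (LINT \<omega>|M. complex_of_real (indicator {\<omega>\<in>space M. P \<omega>} \<omega>))"
    by (rule Bochner_Integration.integral_cong) (auto simp: indicator_def)
  then show ?thesis by (simp del: of_real_indicator)
qed

text \<open>
  For \<open>D\<close> with finitely many values the integral is a linear combination of the numbers
  \<open>d s = E[Q; D = s]\<close> with coefficients in the unit disc. Summing the real parts of \<open>d s\<close> over the
  \<open>s\<close> where they are positive, and over those where they are negative, gives two events to which the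
  bound applies; the same holds for the imaginary parts, hence the factor \<open>4\<close>.
\<close>

lemma (in prob_space) norm_integral_le_of_events:
  fixes f :: "'b \<Rightarrow> complex" and Q :: "'a \<Rightarrow> complex"
  assumes [measurable]: "D \<in> M \<rightarrow>\<^sub>M count_space UNIV"
    and R: "finite R" "\<And>\<omega>. \<omega> \<in> space M \<Longrightarrow> D \<omega> \<in> R"
    and Q: "integrable M Q"
    and f: "\<And>d. norm (f d) \<le> 1"
    and bound: "\<And>V. norm (LINT \<omega>|M. of_bool (D \<omega> \<in> V) * Q \<omega>) \<le> \<delta>"
  shows "norm (LINT \<omega>|M. f (D \<omega>) * Q \<omega>) \<le> 4 * \<delta>"
proof -
  define d where "d s = (LINT \<omega>|M. of_bool (D \<omega> = s) * Q \<omega>)" for s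
  have [measurable]: "Q \<in> borel_measurable M" using Q by simp
  have int: "integrable M (\<lambda>\<omega>. of_bool (D \<omega> = s) * Q \<omega>)" for s
    by (rule Bochner_Integration.integrable_bound[OF Q]) (auto simp: norm_mult)
  have expand: "(LINT \<omega>|M. f' (D \<omega>) * Q \<omega>) = (\<Sum>s\<in>R. f' s * d s)" for f' :: "'b \<Rightarrow> complex"
  proof -
    have "(LINT \<omega>|M. f' (D \<omega>) * Q \<omega>) = (LINT \<omega>|M. (\<Sum>s\<in>R. f' s * (of_bool (D \<omega> = s) * Q \<omega>)))"
    proof (rule Bochner_Integration.integral_cong)
      fix \<omega> assume \<omega>: "\<omega> \<in> space M"
      have "(\<Sum>s\<in>R. f' s * (of_bool (D \<omega> = s) * Q \<omega>)) = (\<Sum>s\<in>R. if D \<omega> = s then f' s * Q \<omega> else 0)"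
        by (rule sum.cong) auto
      also have "\<dots> = f' (D \<omega>) * Q \<omega>"
        using R \<omega> by (simp add: sum.delta')
      finally show "f' (D \<omega>) * Q \<omega> = (\<Sum>s\<in>R. f' s * (of_bool (D \<omega> = s) * Q \<omega>))" by simp
    qed simp
    also have "\<dots> = (\<Sum>s\<in>R. f' s * d s)"
      unfolding d_def by (subst Bochner_Integration.integral_sum) (auto simp: int)
    finally show ?thesis .
  qed
  have part: "norm (\<Sum>s\<in>R\<inter>V. d s) \<le> \<delta>" for V
  proof -
    have "(\<Sum>s\<in>R. of_bool (s \<in> V) * d s) = (\<Sum>s\<in>R\<inter>V. d s)"
      using R(1) by (intro sum.mono_neutral_cong_right) auto
    then show ?thesis using bound[of V] expand[of "\<lambda>s. of_bool (s \<in> V)"] by simp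
  qed
  have half: "(\<Sum>s\<in>R. \<bar>\<rho> (d s)\<bar>) \<le> 2 * \<delta>"
    if \<rho>: "\<And>A. \<rho> (sum d A) = (\<Sum>s\<in>A. \<rho> (d s))" "\<And>z. \<bar>\<rho> z\<bar> \<le> norm z" for \<rho> :: "complex \<Rightarrow> real"
  proof -
    let ?P = "{s. 0 \<le> \<rho> (d s)}"
    have "(\<Sum>s\<in>R. \<bar>\<rho> (d s)\<bar>) = (\<Sum>s\<in>R\<inter>?P. \<bar>\<rho> (d s)\<bar>) + (\<Sum>s\<in>R\<inter>-?P. \<bar>\<rho> (d s)\<bar>)"
      using R(1) by (subst sum.union_disjoint[symmetric]) (auto intro!: sum.cong)
    also have "(\<Sum>s\<in>R\<inter>?P. \<bar>\<rho> (d s)\<bar>) = \<rho> (\<Sum>s\<in>R\<inter>?P. d s)"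
      by (subst \<rho>(1)) (auto intro!: sum.cong)
    also have "(\<Sum>s\<in>R\<inter>-?P. \<bar>\<rho> (d s)\<bar>) = - \<rho> (\<Sum>s\<in>R\<inter>-?P. d s)"
      by (subst \<rho>(1)) (auto intro!: sum.cong simp: sum_negf[symmetric])
    finally show ?thesis
      using \<rho>(2)[of "\<Sum>s\<in>R\<inter>?P. d s"] \<rho>(2)[of "\<Sum>s\<in>R\<inter>-?P. d s"] part[of ?P] part[of "-?P"]
      by linarith
  qed
  have "norm (\<Sum>s\<in>R. f s * d s) \<le> (\<Sum>s\<in>R. norm (d s))"
    by (rule sum_norm_le) (use f in \<open>auto simp: norm_mult intro!: mult_left_le_one_le\<close>)
  also have "\<dots> \<le> (\<Sum>s\<in>R. \<bar>Re (d s)\<bar> + \<bar>Im (d s)\<bar>)"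
    by (rule sum_mono) (rule cmod_le)
  also have "\<dots> \<le> 4 * \<delta>"
    using half[of Re] half[of Im] abs_Re_le_cmod abs_Im_le_cmod by (simp add: sum.distrib)
  finally show ?thesis unfolding expand .
qed

text \<open>
  The classical covariance inequality under strong mixing. The previous bound is used twice, first to
  pass from events to functions in the second variable, then in the first.
\<close>

lemma (in prob_space) norm_covariance_le:
  fixes f :: "'b \<Rightarrow> complex" and g :: "'c \<Rightarrow> complex"
  assumes D [measurable]: "D \<in> M \<rightarrow>\<^sub>M count_space UNIV"
    and R: "finite R" "\<And>\<omega>. \<omega> \<in> space M \<Longrightarrow> D \<omega> \<in> R"
    and D' [measurable]: "D' \<in> M \<rightarrow>\<^sub>M count_space UNIV"
    and R': "finite R'" "\<And>\<omega>. \<omega> \<in> space M \<Longrightarrow> D' \<omega> \<in> R'"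
    and f: "\<And>d. norm (f d) \<le> 1" and g: "\<And>d. norm (g d) \<le> 1"
    and mixing: "\<And>V V'. \<bar>\<P>(\<omega> in M. D \<omega> \<in> V \<and> D' \<omega> \<in> V') - \<P>(\<omega> in M. D \<omega> \<in> V) * \<P>(\<omega> in M. D' \<omega> \<in> V')\<bar> \<le> \<alpha>"
  shows "norm ((LINT \<omega>|M. f (D \<omega>) * g (D' \<omega>)) - (LINT \<omega>|M. f (D \<omega>)) * (LINT \<omega>|M. g (D' \<omega>))) \<le> 16 * \<alpha>"
proof -
  have [measurable]: "Measurable.pred M (\<lambda>\<omega>. D \<omega> \<in> V)" "Measurable.pred M (\<lambda>\<omega>. D' \<omega> \<in> V')" for V V'
    by (rule measurable_compose[OF D], simp, rule measurable_compose[OF D'], simp)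
  have [measurable]: "(\<lambda>\<omega>. f (D \<omega>)) \<in> borel_measurable M" "(\<lambda>\<omega>. g (D' \<omega>)) \<in> borel_measurable M"
    by (rule measurable_compose[OF D], simp, rule measurable_compose[OF D'], simp)
  define m where "m = (LINT \<omega>|M. g (D' \<omega>))"
  have int_f: "integrable M (\<lambda>\<omega>. f (D \<omega>))" and int_g: "integrable M (\<lambda>\<omega>. g (D' \<omega>))"
    by (simp_all add: integrable_function_of_discrete f g)
  have event: "norm (LINT \<omega>|M. of_bool (D \<omega> \<in> V) * (g (D' \<omega>) - m)) \<le> 4 * \<alpha>" for V
  proof -
    let ?p = "complex_of_real \<P>(\<omega> in M. D \<omega> \<in> V)"
    have int_V: "integrable M (\<lambda>\<omega>. of_bool (D \<omega> \<in> V) :: complex)"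
      by (rule integrable_const_bound[where B = 1]) auto
    have int_Vg: "integrable M (\<lambda>\<omega>. of_bool (D \<omega> \<in> V) * g (D' \<omega>))"
      by (rule Bochner_Integration.integrable_bound[OF int_g]) (auto simp: norm_mult)
    have "norm (LINT \<omega>|M. g (D' \<omega>) * (of_bool (D \<omega> \<in> V) - ?p)) \<le> 4 * \<alpha>"
    proof (rule norm_integral_le_of_events[OF D' R' _ g])
      show "norm (LINT \<omega>|M. of_bool (D' \<omega> \<in> V') * (of_bool (D \<omega> \<in> V) - ?p)) \<le> \<alpha>" for V'
      proof -
        have int_V': "integrable M (\<lambda>\<omega>. of_bool (D' \<omega> \<in> V') :: complex)"
          by (rule integrable_const_bound[where B = 1]) auto
        have int_and: "integrable M (\<lambda>\<omega>. of_bool (D \<omega> \<in> V \<and> D' \<omega> \<in> V') :: complex)"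
          by (rule integrable_const_bound[where B = 1]) auto
        have "(LINT \<omega>|M. of_bool (D' \<omega> \<in> V') * (of_bool (D \<omega> \<in> V) - ?p))
            = (LINT \<omega>|M. of_bool (D \<omega> \<in> V \<and> D' \<omega> \<in> V') - of_bool (D' \<omega> \<in> V') * ?p)"
          by (rule Bochner_Integration.integral_cong) (auto simp: algebra_simps)
        also have "\<dots> = of_real (\<P>(\<omega> in M. D \<omega> \<in> V \<and> D' \<omega> \<in> V')
            - \<P>(\<omega> in M. D \<omega> \<in> V) * \<P>(\<omega> in M. D' \<omega> \<in> V'))"
          using int_V' int_and by (simp add: integral_of_bool del: of_bool_conj)
        finally show ?thesis using mixing[of V V'] by (simp only: norm_of_real)
      qed
      show "integrable M (\<lambda>\<omega>. of_bool (D \<omega> \<in> V) - ?p)" using int_V by simp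
    qed
    moreover have "(LINT \<omega>|M. g (D' \<omega>) * (of_bool (D \<omega> \<in> V) - ?p)) = (LINT \<omega>|M. of_bool (D \<omega> \<in> V) * (g (D' \<omega>) - m))"
    proof -
      have "(LINT \<omega>|M. g (D' \<omega>) * (of_bool (D \<omega> \<in> V) - ?p)) = (LINT \<omega>|M. of_bool (D \<omega> \<in> V) * g (D' \<omega>)) - m * ?p"
        using int_g int_Vg by (simp add: right_diff_distrib mult.commute m_def)
      moreover have "(LINT \<omega>|M. of_bool (D \<omega> \<in> V) * (g (D' \<omega>) - m)) = (LINT \<omega>|M. of_bool (D \<omega> \<in> V) * g (D' \<omega>)) - m * ?p"
        using int_V int_Vg by (simp add: right_diff_distrib integral_of_bool mult.commute[of m])
      ultimately show ?thesis by simp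
    qed
    ultimately show ?thesis by simp
  qed
  have "norm (LINT \<omega>|M. f (D \<omega>) * (g (D' \<omega>) - m)) \<le> 4 * (4 * \<alpha>)"
  proof (rule norm_integral_le_of_events[OF D R _ f event])
    show "integrable M (\<lambda>\<omega>. g (D' \<omega>) - m)" using int_g by simp
  qed
  moreover have "integrable M (\<lambda>\<omega>. f (D \<omega>) * g (D' \<omega>))"
    by (rule Bochner_Integration.integrable_bound[OF int_g]) (use f in \<open>auto simp: norm_mult intro!: mult_left_le_one_le\<close>)
  then have "(LINT \<omega>|M. f (D \<omega>) * (g (D' \<omega>) - m)) = (LINT \<omega>|M. f (D \<omega>) * g (D' \<omega>)) - (LINT \<omega>|M. f (D \<omega>)) * m"
    using int_f by (simp add: right_diff_distrib)
  ultimately show ?thesis by (simp add: m_def)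
qed

context stationary_sequence
begin

lemma sigma_algebra_level_events: "sigma_algebra (space M) (level_events M X u a b)"
  unfolding level_events_def by (rule sigma_algebra_sigma_sets) auto

lemma level_events_subset: "1 \<le> a \<Longrightarrow> level_events M X u a b \<subseteq> sets M"
  unfolding level_events_def
proof (rule sets.sigma_sets_subset, safe)
  fix i assume "1 \<le> a" "a \<le> i"
  then have [measurable]: "X i \<in> borel_measurable M" by (simp add: measurable_X)
  show "{\<omega> \<in> space M. X i \<omega> \<le> u} \<in> sets M" by measurable
qed

text \<open>
  An upcrossing at \<open>i\<close> is decided by the levels at \<open>i\<close> and \<open>i + 1\<close>, whence the assumption
  \<open>i + 1 \<le> b\<close>.
\<close>

lemma window_event:
  assumes "finite W" and W: "\<And>i. i \<in> W \<Longrightarrow> a \<le> i \<and> i + 1 \<le> b" and "1 \<le> a"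
  shows "{\<omega> \<in> space M. config u \<omega> \<inter> W \<in> V} \<in> level_events M X u a b"
proof -
  interpret L: sigma_algebra "space M" "level_events M X u a b"
    by (rule sigma_algebra_level_events)
  have X: "{\<omega> \<in> space M. X i \<omega> \<le> u} \<in> level_events M X u a b" if "a \<le> i" "i \<le> b" for i
    unfolding level_events_def by (rule sigma_sets.Basic) (use that in auto)
  have up: "{\<omega> \<in> space M. i \<in> config u \<omega>} \<in> level_events M X u a b" if "i \<in> W" for i
  proof -
    have "{\<omega> \<in> space M. i \<in> config u \<omega>} = {\<omega> \<in> space M. X i \<omega> \<le> u} \<inter> (space M - {\<omega> \<in> space M. X (i + 1) \<omega> \<le> u})"
      using W[OF that] \<open>1 \<le> a\<close> by (auto simp: in_config upcrossing_def)
    then show ?thesis using X[of i] X[of "i + 1"] W[OF that] by auto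
  qed
  have "{\<omega> \<in> space M. config u \<omega> \<inter> W = s} \<in> level_events M X u a b" if "s \<in> Pow W" for s
  proof -
    have "{\<omega> \<in> space M. config u \<omega> \<inter> W = s} = space M - 
        ((\<Union>i\<in>s. space M - {\<omega> \<in> space M. i \<in> config u \<omega>}) \<union> (\<Union>i\<in>W - s. {\<omega> \<in> space M. i \<in> config u \<omega>}))"
      using that by blast
    also have "\<dots> \<in> level_events M X u a b"
    proof (intro L.compl_sets L.Un L.finite_UN)
      show "finite s" "finite (W - s)" using that \<open>finite W\<close> by (auto intro: finite_subset)
    qed (use up that in auto)
    finally show ?thesis .
  qed
  then have "(\<Union>s\<in>Pow W \<inter> V. {\<omega> \<in> space M. config u \<omega> \<inter> W = s}) \<in> level_events M X u a b"
    using \<open>finite W\<close> by (intro L.finite_UN) auto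
  also have "(\<Union>s\<in>Pow W \<inter> V. {\<omega> \<in> space M. config u \<omega> \<inter> W = s}) = {\<omega> \<in> space M. config u \<omega> \<inter> W \<in> V}"
    by auto
  finally show ?thesis .
qed

lemma measurable_window:
  assumes "finite W" and "\<And>i. i \<in> W \<Longrightarrow> 1 \<le> i"
  shows "(\<lambda>\<omega>. config u \<omega> \<inter> W) \<in> M \<rightarrow>\<^sub>M count_space UNIV"
proof (rule measurableI)
  fix V :: "nat set set"
  have "{\<omega> \<in> space M. config u \<omega> \<inter> W \<in> V} \<in> level_events M X u 1 (Max W + 1)"
    using assms by (intro window_event) auto
  then show "(\<lambda>\<omega>. config u \<omega> \<inter> W) -` V \<inter> space M \<in> sets M"
    using level_events_subset[of 1 u "Max W + 1"] by (auto simp: vimage_def Int_def conj_commute)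
qed simp

lemma abs_cov_le_1: "\<bar>measure M C - measure M A * measure M B\<bar> \<le> 1"
proof -
  have "0 \<le> measure M A * measure M B" "measure M A * measure M B \<le> 1"
    by (auto intro!: mult_le_one)
  moreover have "0 \<le> measure M C" "measure M C \<le> 1" by auto
  ultimately show ?thesis by linarith
qed

lemma
  shows mixing_coeff_nonneg: "0 \<le> mixing_coeff M X u n l"
    and mixing_coeff_bound: "\<lbrakk>1 \<le> k; k \<le> n - l; A \<in> level_events M X u 1 k; B \<in> level_events M X u (k + l) n\<rbrakk>
      \<Longrightarrow> \<bar>measure M (A \<inter> B) - measure M A * measure M B\<bar> \<le> mixing_coeff M X u n l"
proof -
  let ?S = "{\<bar>measure M (A \<inter> B) - measure M A * measure M B\<bar> | A B k.
       1 \<le> k \<and> k \<le> n - l \<and> A \<in> level_events M X u 1 k \<and> B \<in> level_events M X u (k + l) n}"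
  have bdd: "bdd_above (insert 0 ?S)"
    by (rule bdd_aboveI[of _ 1]) (auto intro: abs_cov_le_1)
  show "0 \<le> mixing_coeff M X u n l"
    unfolding mixing_coeff_def by (rule cSup_upper[OF _ bdd]) simp
  show "\<lbrakk>1 \<le> k; k \<le> n - l; A \<in> level_events M X u 1 k; B \<in> level_events M X u (k + l) n\<rbrakk>
      \<Longrightarrow> \<bar>measure M (A \<inter> B) - measure M A * measure M B\<bar> \<le> mixing_coeff M X u n l"
    unfolding mixing_coeff_def by (rule cSup_upper[OF _ bdd]) blast
qed

text \<open>
  Blocks are split off one at a time from the right. The windows in the blocks before block \<open>m\<close> involve
  the process up to time \<open>m * r - l + 1\<close>, and the window of block \<open>m\<close> starts at time \<open>m * r + 1\<close>, so
  each step costs one covariance at distance \<open>l - 2\<close> at least.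
\<close>

lemma product_of_separated_blocks:
  fixes f :: "nat set \<Rightarrow> complex"
  assumes [measurable]: "f \<in> borel_measurable config_space"
    and f: "\<And>s. norm (f s) \<le> 1" and "2 \<le> l" "k * r \<le> n" and h: "h = r - l"
  shows "norm ((LINT \<omega>|M. (\<Prod>j<k. f (shift_down (j * r) (config u \<omega>) \<inter> {0<..h})))
      - (LINT \<omega>|M. f (config u \<omega> \<inter> {0<..h})) ^ k) \<le> 16 * real k * mixing_coeff M X u n (l - 2)"
proof (cases "h = 0")
  case True
  then show ?thesis
    using mixing_coeff_nonneg[of u n "l - 2"] prob_space by simp
next
  case False
  then have l_r: "l < r" using h by simp
  let ?\<alpha> = "mixing_coeff M X u n (l - 2)"
  let ?\<xi> = "\<lambda>j \<omega>. f (shift_down (j * r) (config u \<omega>) \<inter> {0<..h})"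
  let ?\<phi> = "LINT \<omega>|M. f (config u \<omega> \<inter> {0<..h})"
  have mean: "(LINT \<omega>|M. ?\<xi> j \<omega>) = ?\<phi>" for j
    using integral_shift[of "\<lambda>s. f (s \<inter> {0<..h})" "j * r" u] by simp
  have \<phi>: "norm ?\<phi> \<le> 1"
  proof -
    have "norm ?\<phi> \<le> (LINT \<omega>|M. norm (f (config u \<omega> \<inter> {0<..h})))"
      by (rule integral_norm_bound)
    also have "\<dots> \<le> (LINT \<omega>|M. 1)"
      by (rule integral_mono) (auto intro!: integrable_const_bound[where B = 1] simp: f)
    finally show ?thesis by (simp add: prob_space)
  qed
  have "norm ((LINT \<omega>|M. (\<Prod>j<m. ?\<xi> j \<omega>)) - ?\<phi> ^ m) \<le> 16 * real m * ?\<alpha>" if "m \<le> k" for m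
    using that
  proof (induction m)
    case 0
    show ?case by (simp add: prob_space)
  next
    case (Suc m)
    define b where "b = (m - 1) * r + h"
    \<comment> \<open>for m = 0 the truncated subtraction in b is harmless: the past is then an empty product\<close>
    define D where "D \<omega> = config u \<omega> \<inter> {0<..b}" for \<omega>
    define D' where "D' \<omega> = config u \<omega> \<inter> {m*r<..m*r+h}" for \<omega>
    have past: "(\<Prod>j<m. ?\<xi> j \<omega>) = (\<Prod>j<m. f (shift_down (j * r) (D \<omega>) \<inter> {0<..h}))" for \<omega>
    proof (rule prod.cong)
      fix j assume "j \<in> {..<m}"
      then have "j * r \<le> (m - 1) * r" by (intro mult_le_mono1) auto
      then have "shift_down (j * r) (config u \<omega>) \<inter> {0<..h} = shift_down (j * r) (D \<omega>) \<inter> {0<..h}"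
        unfolding shift_down_def D_def b_def by (auto intro: order_trans[OF add_le_mono[of _ h "j * r" "(m - 1) * r"]])
      then show "?\<xi> j \<omega> = f (shift_down (j * r) (D \<omega>) \<inter> {0<..h})" by simp
    qed simp
    have future: "?\<xi> m \<omega> = f (shift_down (m * r) (D' \<omega>) \<inter> {0<..h})" for \<omega>
    proof -
      have "shift_down (m * r) (config u \<omega>) \<inter> {0<..h} = shift_down (m * r) (D' \<omega>) \<inter> {0<..h}"
        unfolding shift_down_def D'_def by auto
      then show ?thesis by simp
    qed
    have mr: "(m + 1) * r \<le> n"
      using Suc.prems \<open>k * r \<le> n\<close> by (metis Suc_eq_plus1 le_trans mult_le_mono1)
    have cov: "norm ((LINT \<omega>|M. (\<Prod>j<m. ?\<xi> j \<omega>) * ?\<xi> m \<omega>) - (LINT \<omega>|M. (\<Prod>j<m. ?\<xi> j \<omega>)) * (LINT \<omega>|M. ?\<xi> m \<omega>)) \<le> 16 * ?\<alpha>"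
    proof (cases "m = 0")
      case True
      then show ?thesis using mixing_coeff_nonneg[of u n "l - 2"] by (simp add: prob_space)
    next
      case False
      then obtain m' where m': "m = Suc m'" by (cases m) auto
      \<comment> \<open>the past is decided by time b + 1, and b + 1 + (l - 2) does not exceed the first time of block m\<close>
      have b: "b + 1 + (l - 2) = m * r - 1" "1 \<le> b" "m * r + h + 1 \<le> n" "b + 1 \<le> n - (l - 2)"
        using l_r h \<open>2 \<le> l\<close> mr unfolding b_def m' by auto
      show ?thesis
        unfolding past future
      proof (rule norm_covariance_le[where f = "\<lambda>s. \<Prod>j<m. f (shift_down (j * r) s \<inter> {0<..h})"
            and g = "\<lambda>s. f (shift_down (m * r) s \<inter> {0<..h})" and R = "Pow {0<..b}" and R' = "Pow {m*r<..m*r+h}"])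
        show "D \<in> M \<rightarrow>\<^sub>M count_space UNIV" "D' \<in> M \<rightarrow>\<^sub>M count_space UNIV"
          unfolding D_def D'_def by (auto intro!: measurable_window)
        show "norm (\<Prod>j<m. f (shift_down (j * r) s \<inter> {0<..h})) \<le> 1" for s
          unfolding prod_norm[symmetric] by (rule prod_le_1) (auto simp: f)
        fix V V'
        have "\<bar>measure M ({\<omega>\<in>space M. D \<omega> \<in> V} \<inter> {\<omega>\<in>space M. D' \<omega> \<in> V'}) - \<P>(\<omega> in M. D \<omega> \<in> V) * \<P>(\<omega> in M. D' \<omega> \<in> V')\<bar> \<le> ?\<alpha>"
        proof (rule mixing_coeff_bound)
          show "{\<omega>\<in>space M. D \<omega> \<in> V} \<in> level_events M X u 1 (b + 1)"
            unfolding D_def by (rule window_event) auto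
          show "{\<omega>\<in>space M. D' \<omega> \<in> V'} \<in> level_events M X u (b + 1 + (l - 2)) n"
            unfolding D'_def by (rule window_event) (use b in auto)
        qed (use b in auto)
        then show "\<bar>\<P>(\<omega> in M. D \<omega> \<in> V \<and> D' \<omega> \<in> V') - \<P>(\<omega> in M. D \<omega> \<in> V) * \<P>(\<omega> in M. D' \<omega> \<in> V')\<bar> \<le> ?\<alpha>"
          by (simp add: Collect_conj_eq[symmetric] Int_def conj_ac cong: conj_cong)
      qed (auto simp: f D_def D'_def)
    qed
    have "norm ((LINT \<omega>|M. (\<Prod>j<Suc m. ?\<xi> j \<omega>)) - ?\<phi> ^ Suc m)
      \<le> norm ((LINT \<omega>|M. (\<Prod>j<m. ?\<xi> j \<omega>) * ?\<xi> m \<omega>) - (LINT \<omega>|M. (\<Prod>j<m. ?\<xi> j \<omega>)) * ?\<phi>)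
        + norm ((LINT \<omega>|M. (\<Prod>j<m. ?\<xi> j \<omega>)) - ?\<phi> ^ m) * norm ?\<phi>"
      unfolding norm_mult[symmetric]
      by (rule order_trans[OF _ norm_triangle_ineq]) (simp add: algebra_simps)
    also have "\<dots> \<le> 16 * ?\<alpha> + (16 * real m * ?\<alpha>) * 1"
      using cov[unfolded mean] Suc \<phi> mixing_coeff_nonneg[of u n "l - 2"] by (intro add_mono mult_mono) auto
    finally show ?case by (simp add: algebra_simps)
  qed
  then show ?thesis by blast
qed

end

section \<open>Reduction to independent blocks\<close>

lemma (in prob_space) norm_integral_diff_le_prob:
  fixes F G :: "'a \<Rightarrow> complex"
  assumes [measurable]: "F \<in> borel_measurable M" "G \<in> borel_measurable M" "Measurable.pred M P"
    and "\<And>\<omega>. norm (F \<omega>) \<le> 1" "\<And>\<omega>. norm (G \<omega>) \<le> 1"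
    and eq: "\<And>\<omega>. \<omega> \<in> space M \<Longrightarrow> \<not> P \<omega> \<Longrightarrow> F \<omega> = G \<omega>"
  shows "norm ((LINT \<omega>|M. F \<omega>) - (LINT \<omega>|M. G \<omega>)) \<le> 2 * \<P>(\<omega> in M. P \<omega>)"
proof -
  have int: "integrable M F" "integrable M G"
    by (auto intro!: integrable_const_bound[where B = 1] assms)
  have "norm ((LINT \<omega>|M. F \<omega>) - (LINT \<omega>|M. G \<omega>)) = norm (LINT \<omega>|M. F \<omega> - G \<omega>)"
    using int by simp
  also have "\<dots> \<le> (LINT \<omega>|M. norm (F \<omega> - G \<omega>))"
    by (rule integral_norm_bound)
  also have "\<dots> \<le> (LINT \<omega>|M. 2 * indicator {\<omega>\<in>space M. P \<omega>} \<omega>)"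
  proof (rule integral_mono)
    fix \<omega> assume \<omega>: "\<omega> \<in> space M"
    have "norm (F \<omega> - G \<omega>) \<le> 1 + 1"
      by (rule order_trans[OF norm_triangle_ineq4]) (intro add_mono assms)
    then show "norm (F \<omega> - G \<omega>) \<le> 2 * indicator {\<omega>\<in>space M. P \<omega>} \<omega>"
      using eq[OF \<omega>] \<omega> by (cases "P \<omega>") auto
  next
    have "{\<omega>\<in>space M. P \<omega>} \<in> sets M" by measurable
    then show "integrable M (\<lambda>\<omega>. 2 * indicator {\<omega>\<in>space M. P \<omega>} \<omega> :: real)"
      by (auto intro!: integrable_real_indicator simp: less_top[symmetric])
  qed (use int in auto)
  finally show ?thesis by simp
qed

context stationary_sequence
begin

lemma pred_config [measurable]: "Measurable.pred M (\<lambda>\<omega>. i \<in> config u \<omega>)"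
  by (rule measurable_compose[OF measurable_config pred_member_config])

lemma pred_config_meets: "finite W \<Longrightarrow> Measurable.pred M (\<lambda>\<omega>. config u \<omega> \<inter> W \<noteq> {})"
proof -
  assume "finite W"
  then have "Measurable.pred M (\<lambda>\<omega>. \<exists>i\<in>W. i \<in> config u \<omega>)"
    by measurable
  then show ?thesis by (simp add: Int_def Bex_def conj_commute)
qed

definition crossing_prob :: "real \<Rightarrow> real" where
  "crossing_prob u = \<P>(\<omega> in M. 1 \<in> config u \<omega>)"

lemma crossing_prob_nonneg: "0 \<le> crossing_prob u"
  by (simp add: crossing_prob_def)

lemma prob_crossing: "1 \<le> i \<Longrightarrow> \<P>(\<omega> in M. i \<in> config u \<omega>) = crossing_prob u"
  using prob_shift[OF pred_member_config[of 1], of "i - 1" u] by (simp add: shift_down_def crossing_prob_def)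

lemma prob_meets_le:
  assumes "finite W" "\<And>i. i \<in> W \<Longrightarrow> 1 \<le> i"
  shows "\<P>(\<omega> in M. config u \<omega> \<inter> W \<noteq> {}) \<le> card W * crossing_prob u"
proof -
  have "{\<omega>\<in>space M. config u \<omega> \<inter> W \<noteq> {}} = (\<Union>i\<in>W. {\<omega>\<in>space M. i \<in> config u \<omega>})" by auto
  then have "\<P>(\<omega> in M. config u \<omega> \<inter> W \<noteq> {}) \<le> (\<Sum>i\<in>W. \<P>(\<omega> in M. i \<in> config u \<omega>))"
    by (simp add: finite_measure_subadditive_finite[OF \<open>finite W\<close>] image_subset_iff)
  also have "\<dots> = (\<Sum>i\<in>W. crossing_prob u)"
    using assms by (intro sum.cong) (auto simp: prob_crossing)
  finally show ?thesis by simp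
qed

lemma prob_meets_shift:
  "\<P>(\<omega> in M. config u \<omega> \<inter> {a<..a+d} \<noteq> {}) = \<P>(\<omega> in M. config u \<omega> \<inter> {0<..d} \<noteq> {})"
proof -
  have [measurable]: "Measurable.pred config_space (\<lambda>s. s \<inter> {0<..d} \<noteq> {})"
  proof -
    have "Measurable.pred config_space (\<lambda>s. \<exists>i\<in>{0<..d}. i \<in> s)" by measurable
    then show ?thesis by (simp add: Int_def Bex_def conj_commute)
  qed
  have "shift_down a s \<inter> {0<..d} \<noteq> {} \<longleftrightarrow> s \<inter> {a<..a+d} \<noteq> {}" for s
  proof -
    have "s \<inter> {a<..a+d} = (\<lambda>i. i + a) ` (shift_down a s \<inter> {0<..d})"
    proof (intro equalityI subsetI)
      fix i assume "i \<in> s \<inter> {a<..a+d}"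
      then have "i = (i - a) + a" "i - a \<in> shift_down a s \<inter> {0<..d}"
        by (auto simp: shift_down_def)
      then show "i \<in> (\<lambda>i. i + a) ` (shift_down a s \<inter> {0<..d})" by (rule image_eqI)
    qed (auto simp: shift_down_def)
    then show ?thesis by simp
  qed
  then show ?thesis
    using prob_shift[of "\<lambda>s. s \<inter> {0<..d} \<noteq> {}" a u] by simp
qed

lemma upcrossing_process_pos_iff:
  "upcrossing_process X u n {0..real l / real n} \<omega> > 0 \<longleftrightarrow> config u \<omega> \<inter> {i\<in>{1..n-1}. i \<le> l} \<noteq> {}"
proof -
  have "upcrossing_process X u n {0..real l / real n} \<omega> > 0 \<longleftrightarrow>
      (\<exists>i\<in>{1..n-1}. 0 < (of_bool (upcrossing X u i \<omega>) * indicator {0..real l / real n} (real i / real n) :: nat))"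
    unfolding upcrossing_process_def
    by (metis (no_types, lifting) finite_atLeastAtMost neq0_conv sum_eq_0_iff)
  also have "\<dots> \<longleftrightarrow> (\<exists>i\<in>{1..n-1}. upcrossing X u i \<omega> \<and> i \<le> l)"
    by (intro bex_cong refl) (auto simp: indicator_def divide_le_cancel)
  finally show ?thesis by (auto simp: in_config)
qed

text \<open>
  The tail of a block consists of at most \<open>l\<close> places, which stationarity moves to the beginning of the
  sample, and of the two places after the block that the gap in \<open>run_sum_local\<close> asks for.
\<close>

lemma prob_block_end_le:
  assumes "r < n"
  shows "\<P>(\<omega> in M. config u \<omega> \<inter> {r - l<..r + 2} \<noteq> {})
    \<le> \<P>(\<omega> in M. upcrossing_process X u n {0..real l / real n} \<omega> > 0) + 2 * crossing_prob u"
proof -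
  define d where "d = r - (r - l)"
  have d: "r = (r - l) + d" "d \<le> l" "d < n" using assms by (auto simp: d_def)
  have [measurable]: "Measurable.pred M (\<lambda>\<omega>. config u \<omega> \<inter> W \<noteq> {})" if "finite W" for W
    by (rule pred_config_meets[OF that])
  have "\<P>(\<omega> in M. config u \<omega> \<inter> {r - l<..r + 2} \<noteq> {})
      \<le> \<P>(\<omega> in M. config u \<omega> \<inter> {r - l<..(r - l) + d} \<noteq> {} \<or> config u \<omega> \<inter> {r<..r + 2} \<noteq> {})"
  proof (rule finite_measure_mono)
    have "{r - l<..r + 2} = {r - l<..(r - l) + d} \<union> {r<..r + 2}"
      using d(1) by auto
    then show "{\<omega> \<in> space M. config u \<omega> \<inter> {r - l<..r + 2} \<noteq> {}} \<subseteq>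
        {\<omega> \<in> space M. config u \<omega> \<inter> {r - l<..(r - l) + d} \<noteq> {} \<or> config u \<omega> \<inter> {r<..r + 2} \<noteq> {}}"
      by blast
  qed measurable
  also have "\<dots> \<le> \<P>(\<omega> in M. config u \<omega> \<inter> {r - l<..(r - l) + d} \<noteq> {}) + \<P>(\<omega> in M. config u \<omega> \<inter> {r<..r + 2} \<noteq> {})"
    unfolding conj_disj_distribL
    by (subst Collect_disj_eq) (rule measure_Un_le; measurable)
  also have "\<P>(\<omega> in M. config u \<omega> \<inter> {r<..r + 2} \<noteq> {}) \<le> 2 * crossing_prob u"
    using prob_meets_le[of "{r<..r+2}" u] by simp
  also have "\<P>(\<omega> in M. config u \<omega> \<inter> {r - l<..(r - l) + d} \<noteq> {}) = \<P>(\<omega> in M. config u \<omega> \<inter> {0<..d} \<noteq> {})"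
    by (rule prob_meets_shift)
  also have "\<dots> \<le> \<P>(\<omega> in M. upcrossing_process X u n {0..real l / real n} \<omega> > 0)"
    unfolding upcrossing_process_pos_iff
  proof (rule finite_measure_mono)
    show "{\<omega> \<in> space M. config u \<omega> \<inter> {0<..d} \<noteq> {}} \<subseteq> {\<omega> \<in> space M. config u \<omega> \<inter> {i\<in>{1..n-1}. i \<le> l} \<noteq> {}}"
      using d by fastforce
  qed measurable
  finally show ?thesis by simp
qed

lemma measurable_iexp_run_sum [measurable]: "(\<lambda>\<omega>. iexp (run_sum g (config u \<omega>) a m)) \<in> borel_measurable M"
proof -
  have "(\<lambda>\<omega>. run_sum g (config u \<omega>) a m) \<in> borel_measurable M"
    by (rule measurable_compose[OF measurable_config measurable_run_sum])
  then show ?thesis by measurable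
qed

text \<open>
  The frequency is absorbed into \<open>g\<close>.
\<close>

definition block_char :: "(nat \<Rightarrow> real) \<Rightarrow> real \<Rightarrow> nat \<Rightarrow> complex" where
  "block_char g u r = (LINT \<omega>|M. iexp (run_sum g (config u \<omega>) 0 r))"

lemma norm_block_char_le: "norm (block_char g u r) \<le> 1"
proof -
  have "norm (block_char g u r) \<le> (LINT \<omega>|M. norm (iexp (run_sum g (config u \<omega>) 0 r)))"
    unfolding block_char_def by (rule integral_norm_bound)
  then show ?thesis by (simp add: prob_space)
qed

text \<open>
  Off a small event no block has an upcrossing in its tail, and the sum over the sample splits into
  functions of separated windows. Their expectations are products up to the mixing error, and each
  factor is close to the characteristic function of a full block.
\<close>

lemma block_char_power_approx:
  fixes u :: real
  assumes k: "2 \<le> k" and r: "r = n div k" and l: "2 \<le> l" and n: "1 \<le> n"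
  defines "\<beta> \<equiv> \<P>(\<omega> in M. upcrossing_process X u n {0..real l / real n} \<omega> > 0)"
  shows "norm (block_char g u (n - 3) - block_char g u r ^ k)
    \<le> 16 * real k * mixing_coeff M X u n (l - 2) + 4 * real k * (\<beta> + 2 * crossing_prob u) + 2 * (real k + 3) * crossing_prob u"
proof -
  let ?q = "crossing_prob u"
  define h where "h = r - l"
  define W where "W = {min (k*r) (n-3) + 2<..max (k*r) (n-3) + 2}"
  have "r < n" unfolding r using k n by (intro div_less_dividend) auto
  have "k * r \<le> n" unfolding r by simp
  let ?e = "\<lambda>j \<omega>. config u \<omega> \<inter> {j*r+h<..j*r+r+2} \<noteq> {}"
  let ?bad = "\<lambda>\<omega>. (\<exists>j<k. ?e j \<omega>) \<or> config u \<omega> \<inter> W \<noteq> {}"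
  have [measurable]: "Measurable.pred M (\<lambda>\<omega>. config u \<omega> \<inter> W \<noteq> {})" if "finite W" for W
    by (rule pred_config_meets[OF that])
  have fin: "finite W" by (simp add: W_def)
  define f where "f s = iexp (run_sum g s 0 h)" for s
  let ?\<xi> = "\<lambda>j \<omega>. f (shift_down (j * r) (config u \<omega>) \<inter> {0<..h})"
  have f: "norm (f s) \<le> 1" for s by (simp add: f_def)
  have e: "\<P>(\<omega> in M. ?e j \<omega>) \<le> \<beta> + 2 * ?q" for j
  proof -
    have "\<P>(\<omega> in M. ?e j \<omega>) = \<P>(\<omega> in M. config u \<omega> \<inter> {h<..r+2} \<noteq> {})"
      using prob_meets_shift[of u "j*r+h" "r+2-h"] prob_meets_shift[of u h "r+2-h"]
      by (simp add: h_def add.assoc)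
    then show ?thesis
      using prob_block_end_le[OF \<open>r < n\<close>, of u l] by (simp add: h_def \<beta>_def)
  qed
  have W: "\<P>(\<omega> in M. config u \<omega> \<inter> W \<noteq> {}) \<le> (real k + 3) * ?q"
  proof -
    have "n < k * r + k"
      unfolding r using k by (metis add.commute div_mult_mod_eq mod_less_divisor mult.commute nat_add_left_cancel_less neq0_conv not_numeral_le_zero)
    then have "card W \<le> k + 3" using \<open>k * r \<le> n\<close> by (auto simp: W_def)
    \<comment> \<open>k * r misses n by less than k, and n - 3 by at most 3 on the other side\<close>
    then have "card W * ?q \<le> (real k + 3) * ?q"
      by (intro mult_right_mono crossing_prob_nonneg) simp
    then show ?thesis using prob_meets_le[OF fin, of u] by (force simp: W_def)
  qed
  have bad: "\<P>(\<omega> in M. ?bad \<omega>) \<le> k * (\<beta> + 2 * ?q) + (real k + 3) * ?q"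
  proof -
    have "{\<omega>\<in>space M. ?bad \<omega>} = (\<Union>j\<in>{..<k}. {\<omega>\<in>space M. ?e j \<omega>}) \<union> {\<omega>\<in>space M. config u \<omega> \<inter> W \<noteq> {}}"
      by blast
    also have "measure M \<dots> \<le> measure M (\<Union>j\<in>{..<k}. {\<omega>\<in>space M. ?e j \<omega>}) + \<P>(\<omega> in M. config u \<omega> \<inter> W \<noteq> {})"
      using fin by (intro measure_Un_le sets.finite_UN) auto
    also have "measure M (\<Union>j\<in>{..<k}. {\<omega>\<in>space M. ?e j \<omega>}) \<le> (\<Sum>j<k. \<P>(\<omega> in M. ?e j \<omega>))"
      by (rule finite_measure_subadditive_finite) auto
    also have "\<dots> \<le> (\<Sum>j<k. \<beta> + 2 * ?q)"
      by (intro sum_mono e)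
    finally show ?thesis using W by simp
  qed
  have window: "shift_down (j*r) s \<inter> {0<..h} = shift_down (j*r) (s \<inter> {j*r<..j*r+h})" for j s
    by (auto simp: shift_down_def)
  have mf [measurable]: "(\<lambda>\<omega>. f (shift_down (j*r) (config u \<omega>) \<inter> {0<..h})) \<in> borel_measurable M" for j
  proof -
    have "(\<lambda>s. f (shift_down (j*r) s \<inter> {0<..h})) \<in> borel_measurable config_space"
      unfolding f_def by measurable
    then show ?thesis by (rule measurable_compose[OF measurable_config])
  qed
  have mf0 [measurable]: "(\<lambda>\<omega>. f (config u \<omega> \<inter> {0<..h})) \<in> borel_measurable M"
  proof -
    have "(\<lambda>s. f (s \<inter> {0<..h})) \<in> borel_measurable config_space"
      unfolding f_def by measurable
    then show ?thesis by (rule measurable_compose[OF measurable_config])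
  qed
  let ?\<phi> = "LINT \<omega>|M. f (config u \<omega> \<inter> {0<..h})"
  have 1: "norm (block_char g u (n - 3) - (LINT \<omega>|M. (\<Prod>j<k. ?\<xi> j \<omega>)))
      \<le> 2 * \<P>(\<omega> in M. ?bad \<omega>)"
    unfolding block_char_def
  proof (rule norm_integral_diff_le_prob)
    fix \<omega> assume good: "\<not> ?bad \<omega>"
    have "run_sum g (config u \<omega>) 0 (n-3) = (\<Sum>j<k. run_sum g (config u \<omega> \<inter> {j*r<..j*r+h}) (j*r) h)"
      by (rule run_sum_blocks) (use good in \<open>auto simp: W_def h_def\<close>)
    also have "\<dots> = (\<Sum>j<k. run_sum g (shift_down (j * r) (config u \<omega>) \<inter> {0<..h}) 0 h)"
      unfolding window by (intro sum.cong refl run_sum_shift)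
    finally show "iexp (run_sum g (config u \<omega>) 0 (n-3)) = (\<Prod>j<k. ?\<xi> j \<omega>)"
      by (simp add: f_def exp_sum[symmetric] sum_distrib_left)
  next
    show "norm (\<Prod>j<k. ?\<xi> j \<omega>) \<le> 1" for \<omega>
      unfolding prod_norm[symmetric] by (rule prod_le_1) (auto simp: f)
  qed (use fin in auto)
  have 2: "norm (block_char g u r - ?\<phi>) \<le> 2 * (\<beta> + 2 * ?q)"
  proof -
    have "norm (block_char g u r - ?\<phi>) \<le> 2 * \<P>(\<omega> in M. ?e 0 \<omega>)"
      unfolding block_char_def
    proof (rule norm_integral_diff_le_prob)
      fix \<omega> assume "\<not> ?e 0 \<omega>"
      then show "iexp (run_sum g (config u \<omega>) 0 r) = f (config u \<omega> \<inter> {0<..h})"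
        using run_sum_local[of "config u \<omega>" 0 h r g] by (simp add: f_def h_def)
    qed (auto simp: f)
    then show ?thesis using e[of 0] by simp
  qed
  have \<phi>: "norm ?\<phi> \<le> 1"
  proof -
    have "norm ?\<phi> \<le> (LINT \<omega>|M. norm (f (config u \<omega> \<inter> {0<..h})))"
      by (rule integral_norm_bound)
    then show ?thesis by (simp add: f_def prob_space)
  qed
  have 3: "norm (block_char g u r ^ k - ?\<phi> ^ k) \<le> k * (2 * (\<beta> + 2 * ?q))"
    using norm_power_diff[OF norm_block_char_le \<phi>, of g u r k] mult_left_mono[OF 2, of "real k"] by simp
  have 4: "norm ((LINT \<omega>|M. (\<Prod>j<k. ?\<xi> j \<omega>)) - ?\<phi> ^ k)
      \<le> 16 * real k * mixing_coeff M X u n (l - 2)"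
    by (rule product_of_separated_blocks[OF _ f l \<open>k * r \<le> n\<close> h_def]) (simp add: f_def)
  have "norm (a - d) \<le> norm (a - b) + norm (b - c) + norm (d - c)" for a b c d :: complex
    using norm_triangle_ineq4[of "a - c" "d - c"] norm_triangle_ineq[of "a - b" "b - c"] by simp
  from order_trans[OF this add_mono[OF add_mono[OF 1 4] 3]] bad
  show ?thesis by (simp add: algebra_simps)
qed

end

section \<open>The law of a run length\<close>

context stationary_sequence
begin

definition start_prob :: "real \<Rightarrow> real" where
  "start_prob u = \<P>(\<omega> in M. starts_at (config u \<omega>) 1)"

definition finite_runs :: "real \<Rightarrow> bool" where
  "finite_runs u \<longleftrightarrow> (AE \<omega> in M. \<exists>k. run_at_is (config u \<omega>) 1 k)"

lemma measurable_run_at_config [measurable]: "(\<lambda>\<omega>. run_at (config u \<omega>) i) \<in> M \<rightarrow>\<^sub>M count_space UNIV"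
  by (rule measurable_compose[OF measurable_config measurable_run_at])

lemma pred_starts_at_config [measurable]: "Measurable.pred M (\<lambda>\<omega>. starts_at (config u \<omega>) i)"
  by (rule measurable_compose[OF measurable_config pred_starts_at])

lemma pred_run_at_is_config [measurable]: "Measurable.pred M (\<lambda>\<omega>. run_at_is (config u \<omega>) i k)"
  by (rule measurable_compose[OF measurable_config pred_run_at_is])

lemma run_at_shift_down: "run_at (shift_down h s) i = run_at s (i + h)"
  by (rule run_at_cong) (auto simp: run_at_is_def shift_down_def algebra_simps)

lemma starts_at_shift_down: "1 \<le> i \<Longrightarrow> starts_at (shift_down h s) i = starts_at s (i + h)"
  by (auto simp: starts_at_def shift_down_def algebra_simps)

lemma given_run_config: "given_run M X u 1 = uniform_measure M {\<omega>\<in>space M. starts_at (config u \<omega>) 1}"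
  by (simp add: given_run_def run_start_config)

context
  fixes u :: real
  assumes start_prob_pos: "0 < start_prob u"
begin

lemma given_run_density:
  "given_run M X u 1 = density M (\<lambda>\<omega>. ennreal (of_bool (starts_at (config u \<omega>) 1) / start_prob u))"
  unfolding given_run_config uniform_measure_def
proof (rule density_cong)
  have "emeasure M {\<omega>\<in>space M. starts_at (config u \<omega>) 1} = ennreal (start_prob u)"
    by (simp add: start_prob_def emeasure_eq_measure)
  then show "AE \<omega> in M. indicator {\<omega>\<in>space M. starts_at (config u \<omega>) 1} \<omega> / emeasure M {\<omega>\<in>space M. starts_at (config u \<omega>) 1}
      = ennreal (of_bool (starts_at (config u \<omega>) 1) / start_prob u)"
    using start_prob_pos by (intro AE_I2) (auto simp: indicator_def divide_ennreal[of 1, simplified])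
qed measurable

lemma prob_space_run_law: "prob_space (run_law M X u)"
  unfolding run_law_def
proof (rule prob_space.prob_space_distr)
  show "prob_space (given_run M X u 1)"
    unfolding given_run_config
    by (rule prob_space_uniform_measure)
      (use start_prob_pos in \<open>auto simp: emeasure_eq_measure start_prob_def\<close>)
  show "run_length X u 1 \<in> given_run M X u 1 \<rightarrow>\<^sub>M count_space UNIV"
    unfolding given_run_config by (simp add: run_length_config[abs_def])
qed

lemma
  fixes f :: "nat \<Rightarrow> 'b::{banach, second_countable_topology}"
  shows integral_run_law: "(LINT z|run_law M X u. f z)
      = (LINT \<omega>|M. of_bool (starts_at (config u \<omega>) 1) *\<^sub>R f (run_at (config u \<omega>) 1)) /\<^sub>R start_prob u"
    and integrable_run_law: "integrable (run_law M X u) f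
      \<longleftrightarrow> integrable M (\<lambda>\<omega>. of_bool (starts_at (config u \<omega>) 1) *\<^sub>R f (run_at (config u \<omega>) 1))"
proof -
  have R: "run_length X u 1 \<in> given_run M X u 1 \<rightarrow>\<^sub>M count_space UNIV"
    unfolding given_run_config by (simp add: run_length_config[abs_def])
  have meas: "(\<lambda>\<omega>. f (run_length X u 1 \<omega>)) \<in> borel_measurable M"
    unfolding run_length_config by (rule measurable_compose[OF measurable_run_at_config]) simp
  have scale: "(of_bool (starts_at (config u \<omega>) 1) / start_prob u) *\<^sub>R f (run_length X u 1 \<omega>)
      = (of_bool (starts_at (config u \<omega>) 1) *\<^sub>R f (run_at (config u \<omega>) 1)) /\<^sub>R start_prob u" for \<omega>
    by (simp add: run_length_config divide_inverse)
  have "(LINT z|run_law M X u. f z) = (LINT \<omega>|given_run M X u 1. f (run_length X u 1 \<omega>))"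
    unfolding run_law_def by (rule integral_distr[OF R]) simp
  also have "\<dots> = (LINT \<omega>|M. (of_bool (starts_at (config u \<omega>) 1) / start_prob u) *\<^sub>R f (run_length X u 1 \<omega>))"
    unfolding given_run_density by (rule integral_density[OF meas]) (use start_prob_pos in auto)
  finally show "(LINT z|run_law M X u. f z)
      = (LINT \<omega>|M. of_bool (starts_at (config u \<omega>) 1) *\<^sub>R f (run_at (config u \<omega>) 1)) /\<^sub>R start_prob u"
    unfolding scale integral_scaleR_right .
  have "integrable (run_law M X u) f \<longleftrightarrow> integrable (given_run M X u 1) (\<lambda>\<omega>. f (run_length X u 1 \<omega>))"
    unfolding run_law_def by (rule integrable_distr_eq[OF R]) simp
  also have "\<dots> \<longleftrightarrow> integrable M (\<lambda>\<omega>. (of_bool (starts_at (config u \<omega>) 1) / start_prob u) *\<^sub>R f (run_length X u 1 \<omega>))"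
    unfolding given_run_density by (rule integrable_density[OF meas]) (use start_prob_pos in auto)
  finally show "integrable (run_law M X u) f
      \<longleftrightarrow> integrable M (\<lambda>\<omega>. of_bool (starts_at (config u \<omega>) 1) *\<^sub>R f (run_at (config u \<omega>) 1))"
    unfolding scale
    using start_prob_pos
      integrable_scaleR_right[of "start_prob u" M "\<lambda>\<omega>. (of_bool (starts_at (config u \<omega>) 1) *\<^sub>R f (run_at (config u \<omega>) 1)) /\<^sub>R start_prob u"]
      integrable_scaleR_right[of "inverse (start_prob u)" M "\<lambda>\<omega>. of_bool (starts_at (config u \<omega>) 1) *\<^sub>R f (run_at (config u \<omega>) 1)"]
    by (auto simp del: scaleR_scaleR simp: scaleR_scaleR[of "start_prob u" "inverse (start_prob u)"])
qed

lemma AE_run_law_pos: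
  assumes "finite_runs u"
  shows "AE z in run_law M X u. 1 \<le> z"
proof -
  have R: "run_length X u 1 \<in> given_run M X u 1 \<rightarrow>\<^sub>M count_space UNIV"
    unfolding given_run_config by (simp add: run_length_config[abs_def])
  have "AE \<omega> in M. starts_at (config u \<omega>) 1 \<longrightarrow> 1 \<le> run_at (config u \<omega>) 1"
    using assms unfolding finite_runs_def
  proof (rule AE_mp, intro AE_I2 impI)
    fix \<omega> assume "\<exists>k. run_at_is (config u \<omega>) 1 k" "starts_at (config u \<omega>) 1"
    then obtain k where k: "run_at_is (config u \<omega>) 1 k" "1 + 2 \<in> config u \<omega>" by (auto simp: starts_at_def)
    then have "k \<noteq> 0" by (intro notI) (simp add: run_at_is_def)
    then show "1 \<le> run_at (config u \<omega>) 1" using run_at_eqI[OF k(1)] by simp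
  qed
  then have "AE \<omega> in given_run M X u 1. 1 \<le> run_length X u 1 \<omega>"
    unfolding given_run_config run_length_config
    by (intro AE_uniform_measureI) auto
  then show ?thesis
    unfolding run_law_def by (subst AE_distr_iff[OF R]) auto
qed

end

lemma finite_runsI:
  assumes "(\<lambda>j. \<P>(\<omega> in M. \<forall>m\<in>{2..j}. upcrossing X u (2 * m - 1) \<omega>)) \<longlonglongrightarrow> 0"
  shows "finite_runs u"
proof -
  let ?inf = "\<lambda>\<omega>. \<forall>m\<in>{1..}. 1 + 2 * m \<in> config u \<omega>"
  have [measurable]: "Measurable.pred M ?inf" by measurable
  have [measurable]: "Measurable.pred M (\<lambda>\<omega>. upcrossing X u i \<omega>)" if "1 \<le> i" for i
    using pred_config[of i u] that by (simp add: in_config)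
  have "\<P>(\<omega> in M. ?inf \<omega>) \<le> 0"
  proof (rule LIMSEQ_le_const[OF assms], intro exI allI impI)
    fix j :: nat
    have eq: "(\<forall>m\<in>{2..j}. upcrossing X u (2 * m - 1) \<omega>) \<longleftrightarrow> (\<forall>m\<in>{2..j}. 2 * m - 1 \<in> config u \<omega>)" for \<omega>
      by (auto simp: in_config)
    show "\<P>(\<omega> in M. ?inf \<omega>) \<le> \<P>(\<omega> in M. \<forall>m\<in>{2..j}. upcrossing X u (2 * m - 1) \<omega>)"
      unfolding eq
    proof (rule finite_measure_mono)
      show "{\<omega> \<in> space M. ?inf \<omega>} \<subseteq> {\<omega> \<in> space M. \<forall>m\<in>{2..j}. 2 * m - 1 \<in> config u \<omega>}"
      proof (intro subsetI CollectI conjI ballI)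
        fix \<omega> m assume "\<omega> \<in> {\<omega> \<in> space M. ?inf \<omega>}" "m \<in> {2..j}"
        then have "1 + 2 * (m - 1) \<in> config u \<omega>" "1 + 2 * (m - 1) = 2 * m - 1" by auto
        then show "2 * m - 1 \<in> config u \<omega>" by simp
      qed auto
    qed measurable
  qed
  then have "\<P>(\<omega> in M. ?inf \<omega>) = 0"
    using measure_nonneg[of M "{\<omega> \<in> space M. ?inf \<omega>}"] by linarith
  then have "AE \<omega> in M. \<not> ?inf \<omega>"
    by (subst (asm) prob_Collect_eq_0) auto
  then show ?thesis
    unfolding finite_runs_def
  proof (rule AE_mp, intro AE_I2 impI)
    fix \<omega> assume "\<not> ?inf \<omega>"
    then have ex: "\<exists>k. 1 + 2 * k + 2 \<notin> config u \<omega>"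
    proof -
      obtain m where m: "1 \<le> m" "1 + 2 * m \<notin> config u \<omega>" using \<open>\<not> ?inf \<omega>\<close> by auto
      moreover have "1 + 2 * (m - 1) + 2 = 1 + 2 * m" using m by simp
      ultimately show ?thesis by metis
    qed
    define k where "k = (LEAST k. 1 + 2 * k + 2 \<notin> config u \<omega>)"
    have k: "1 + 2 * k + 2 \<notin> config u \<omega>" unfolding k_def by (rule LeastI_ex[OF ex])
    have "1 + 2 * m \<in> config u \<omega>" if "m \<in> {1..k}" for m
    proof -
      have "m - 1 < k" "1 + 2 * (m - 1) + 2 = 1 + 2 * m" using that by auto
      then show ?thesis using not_less_Least[of "m - 1" "\<lambda>k. 1 + 2 * k + 2 \<notin> config u \<omega>"] by (simp add: k_def)
    qed
    with k show "\<exists>k. run_at_is (config u \<omega>) 1 k"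
      unfolding run_at_is_def by blast
  qed
qed

text \<open>
  A run that never ends has length \<open>0\<close> by convention, so positivity of the length holds only almost
  surely.
\<close>

lemma AE_run_at_pos:
  assumes "finite_runs u"
  shows "AE \<omega> in M. \<forall>i\<ge>1. starts_at (config u \<omega>) i \<longrightarrow> 1 \<le> run_at (config u \<omega>) i"
proof -
  have "AE \<omega> in M. starts_at (config u \<omega>) (1 + h) \<longrightarrow> 1 \<le> run_at (config u \<omega>) (1 + h)" for h
  proof -
    have "AE \<omega> in M. \<exists>k. run_at_is (shift_down h (config u \<omega>)) 1 k"
      using assms unfolding finite_runs_def by (intro AE_shift) measurable
    then show ?thesis
    proof (rule AE_mp, intro AE_I2 impI)
      fix \<omega> assume "\<exists>k. run_at_is (shift_down h (config u \<omega>)) 1 k" "starts_at (config u \<omega>) (1 + h)"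
      then obtain k where k: "run_at_is (shift_down h (config u \<omega>)) 1 k" "starts_at (shift_down h (config u \<omega>)) 1"
        by (auto simp: starts_at_shift_down)
      then have "k \<noteq> 0" by (intro notI) (simp add: run_at_is_def starts_at_def)
      then show "1 \<le> run_at (config u \<omega>) (1 + h)"
        using run_at_eqI[OF k(1)] by (simp add: run_at_shift_down)
    qed
  qed
  then have "AE \<omega> in M. \<forall>h. starts_at (config u \<omega>) (1 + h) \<longrightarrow> 1 \<le> run_at (config u \<omega>) (1 + h)"
    by (subst AE_all_countable) blast
  then show ?thesis
    by (rule AE_mp, intro AE_I2 impI allI) (metis le_add_diff_inverse)
qed

text \<open>
  The expectation is the sum over \<open>t\<close> of the probabilities that a run starts and is longer than
  \<open>t\<close>. By stationarity such a probability is \<open>G t - G (t + 1)\<close>, where \<open>G t\<close> is the probability of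
  \<open>t + 1\<close> upcrossings in a row at every second place, and the sum telescopes to \<open>G 0\<close>.
\<close>

lemma expected_total_of_run:
  assumes lim: "(\<lambda>j. \<P>(\<omega> in M. \<forall>m\<in>{2..j}. upcrossing X u (2 * m - 1) \<omega>)) \<longlonglongrightarrow> 0"
  shows "(LINT \<omega>|M. of_bool (starts_at (config u \<omega>) 1) * real (run_at (config u \<omega>) 1)) = crossing_prob u"
proof -
  have fin: "finite_runs u" by (rule finite_runsI[OF lim])
  define Y where "Y \<omega> = of_bool (starts_at (config u \<omega>) 1) * run_at (config u \<omega>) 1" for \<omega>
  define G where "G t = \<P>(\<omega> in M. \<forall>m\<in>{1..t+1}. 1 + 2 * m \<in> config u \<omega>)" for t
  have [measurable]: "Y \<in> M \<rightarrow>\<^sub>M count_space UNIV" unfolding Y_def by measurable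
  have G0: "G 0 = crossing_prob u"
    using prob_crossing[of 3 u] by (simp add: G_def numeral_3_eq_3)
  have G_lim: "G \<longlonglongrightarrow> 0"
  proof -
    have "G t = \<P>(\<omega> in M. \<forall>m\<in>{2..t+2}. upcrossing X u (2 * m - 1) \<omega>)" for t
    proof -
      have "(\<forall>m\<in>{1..t+1}. 1 + 2 * m \<in> config u \<omega>) \<longleftrightarrow> (\<forall>m\<in>{2..t+2}. upcrossing X u (2 * m - 1) \<omega>)" for \<omega>
      proof -
        have "{2..t+2} = Suc ` {1..t+1}" by (simp add: image_Suc_atLeastAtMost)
        then have "(\<forall>m\<in>{2..t+2}. upcrossing X u (2 * m - 1) \<omega>) \<longleftrightarrow> (\<forall>m\<in>{1..t+1}. upcrossing X u (2 * Suc m - 1) \<omega>)"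
          unfolding \<open>{2..t+2} = _\<close> by blast
        then show ?thesis by (simp add: in_config)
      qed
      then show ?thesis by (simp add: G_def)
    qed
    then have "G = (\<lambda>t. \<P>(\<omega> in M. \<forall>m\<in>{2..t+2}. upcrossing X u (2 * m - 1) \<omega>))" by blast
    then show ?thesis using LIMSEQ_ignore_initial_segment[OF lim, of 2] by (simp only:)
  qed
  have tail: "\<P>(\<omega> in M. t < Y \<omega>) = G t - G (Suc t)" for t
  proof -
    have [measurable]: "Measurable.pred config_space (\<lambda>s. \<forall>m\<in>{1..t+2}. 1 + 2 * m \<in> s)" by measurable

    have down: "(\<forall>m\<in>{0..t+1}. 1 + 2 * m \<in> shift_down 2 s) \<longleftrightarrow> (\<forall>m\<in>{1..t+2}. 1 + 2 * m \<in> s)" for s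
    proof -
      have "{1..t+2} = Suc ` {0..t+1}" by (simp add: image_Suc_atLeastAtMost)
      then have "(\<forall>m\<in>{1..t+2}. 1 + 2 * m \<in> s) \<longleftrightarrow> (\<forall>m\<in>{0..t+1}. 1 + 2 * Suc m \<in> s)"
        unfolding \<open>{1..t+2} = _\<close> by blast
      then show ?thesis by (simp add: shift_down_def)
    qed
    have "\<P>(\<omega> in M. t < Y \<omega>) = \<P>(\<omega> in M. 1 \<notin> config u \<omega> \<and> (\<forall>m\<in>{1..t+1}. 1 + 2 * m \<in> config u \<omega>))"
    proof (rule prob_eq_AE)
      show "AE \<omega> in M. t < Y \<omega> \<longleftrightarrow> 1 \<notin> config u \<omega> \<and> (\<forall>m\<in>{1..t+1}. 1 + 2 * m \<in> config u \<omega>)"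
        using fin unfolding finite_runs_def
      proof (rule AE_mp, intro AE_I2 impI)
        fix \<omega> assume "\<exists>k. run_at_is (config u \<omega>) 1 k"
        then obtain k where k: "run_at_is (config u \<omega>) 1 k" by blast
        have in_run: "(\<forall>m\<in>{1..t+1}. 1 + 2 * m \<in> config u \<omega>) \<longleftrightarrow> t < k"
        proof
          show "\<forall>m\<in>{1..t+1}. 1 + 2 * m \<in> config u \<omega>" if "t < k"
            using k that by (auto simp: run_at_is_def)
          show "t < k" if "\<forall>m\<in>{1..t+1}. 1 + 2 * m \<in> config u \<omega>"
          proof (rule ccontr)
            assume "\<not> t < k"
            then have "k + 1 \<in> {1..t+1}" by simp
            with that have "1 + 2 * (k + 1) \<in> config u \<omega>" by blast
            then show False using k by (simp add: run_at_is_def)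
          qed
        qed
        have "3 \<in> config u \<omega>" if "t < k"
          using in_run that by (metis One_nat_def Suc_eq_plus1 atLeastAtMost_iff le_add2 mult_2 numeral_3_eq_3 order_refl plus_1_eq_Suc one_add_one)
        then show "t < Y \<omega> \<longleftrightarrow> 1 \<notin> config u \<omega> \<and> (\<forall>m\<in>{1..t+1}. 1 + 2 * m \<in> config u \<omega>)"
          unfolding in_run Y_def run_at_eqI[OF k] starts_at_def by (auto simp: numeral_3_eq_3)
      qed
    qed measurable
    also have "\<dots> = G t - \<P>(\<omega> in M. \<forall>m\<in>{0..t+1}. 1 + 2 * m \<in> config u \<omega>)"
    proof -
      have "\<P>(\<omega> in M. 1 \<notin> config u \<omega> \<and> (\<forall>m\<in>{1..t+1}. 1 + 2 * m \<in> config u \<omega>))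
          = measure M ({\<omega>\<in>space M. \<forall>m\<in>{1..t+1}. 1 + 2 * m \<in> config u \<omega>} - {\<omega>\<in>space M. \<forall>m\<in>{0..t+1}. 1 + 2 * m \<in> config u \<omega>})"
      proof (rule arg_cong[where f = "measure M"], intro set_eqI)
        fix \<omega>
        have "(\<forall>m\<in>{0..t+1}. 1 + 2 * m \<in> config u \<omega>) \<longleftrightarrow> 1 \<in> config u \<omega> \<and> (\<forall>m\<in>{1..t+1}. 1 + 2 * m \<in> config u \<omega>)"
        proof -
          have "{0..t+1} = insert 0 {1..t+1}" by auto
          then show ?thesis by simp
        qed
        then show "\<omega> \<in> {\<omega> \<in> space M. 1 \<notin> config u \<omega> \<and> (\<forall>m\<in>{1..t+1}. 1 + 2 * m \<in> config u \<omega>)} \<longleftrightarrow>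
          \<omega> \<in> {\<omega>\<in>space M. \<forall>m\<in>{1..t+1}. 1 + 2 * m \<in> config u \<omega>} - {\<omega>\<in>space M. \<forall>m\<in>{0..t+1}. 1 + 2 * m \<in> config u \<omega>}"
          by blast
      qed
      also have "\<dots> = G t - \<P>(\<omega> in M. \<forall>m\<in>{0..t+1}. 1 + 2 * m \<in> config u \<omega>)"
        unfolding G_def by (rule finite_measure_Diff) auto
      finally show ?thesis .
    qed
    also have "\<P>(\<omega> in M. \<forall>m\<in>{0..t+1}. 1 + 2 * m \<in> config u \<omega>) = G (Suc t)"
    proof -
      have "\<P>(\<omega> in M. \<forall>m\<in>{0..t+1}. 1 + 2 * m \<in> shift_down 2 (config u \<omega>)) = \<P>(\<omega> in M. \<forall>m\<in>{0..t+1}. 1 + 2 * m \<in> config u \<omega>)"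
        by (rule prob_shift) measurable
      then show ?thesis unfolding down G_def by simp
    qed
    finally show ?thesis .
  qed
  have "(\<integral>\<^sup>+\<omega>. of_nat (Y \<omega>) \<partial>M) = (\<Sum>t. ennreal (G t - G (Suc t)))"
    by (subst nn_integral_nat_function) (auto simp: emeasure_eq_measure tail)
  also have "\<dots> = ennreal (G 0 - 0)"
  proof -
    have "(\<lambda>t. G t - G (Suc t)) sums (G 0 - 0)"
      by (rule telescope_sums'[OF G_lim])
    then have summ: "summable (\<lambda>t. G t - G (Suc t))" and total: "(\<Sum>t. G t - G (Suc t)) = G 0 - 0"
      by (simp_all only: sums_iff)
    have "0 \<le> G t - G (Suc t)" for t
      using tail[of t] measure_nonneg[of M "{\<omega> \<in> space M. t < Y \<omega>}"] by linarith
    then have "(\<Sum>t. ennreal (G t - G (Suc t))) = ennreal (\<Sum>t. G t - G (Suc t))"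
      by (rule suminf_ennreal2[OF _ summ])
    then show ?thesis unfolding total .
  qed
  finally have "(\<integral>\<^sup>+\<omega>. ennreal (real (Y \<omega>)) \<partial>M) = ennreal (crossing_prob u)"
    by (simp add: G0 ennreal_of_nat_eq_real_of_nat)
  then have "(LINT \<omega>|M. real (Y \<omega>)) = crossing_prob u"
    by (subst integral_eq_nn_integral) (auto simp: crossing_prob_nonneg)
  then show ?thesis by (simp add: Y_def)
qed

end

section \<open>The characteristic function of one block\<close>

lemma norm_iexp_minus_1_le: "norm (iexp x - 1) \<le> \<bar>x\<bar>"
  using iexp_approx1[of x 0] by simp

lemma norm_iexp_minus_linear_le: "norm (iexp x - 1 - \<i> * x) \<le> x\<^sup>2 / 2"
  using iexp_approx1[of x 1] by (simp add: power2_eq_square diff_diff_eq)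

lemma sum_squares_le_square_sum:
  fixes a :: "'i \<Rightarrow> real"
  assumes "finite S" "\<And>i. i \<in> S \<Longrightarrow> 0 \<le> a i"
  shows "(\<Sum>i\<in>S. (a i)\<^sup>2) \<le> (\<Sum>i\<in>S. a i)\<^sup>2"
  using assms
proof (induction S)
  case (insert x S)
  have "0 \<le> a x * sum a S" using insert by (auto intro!: mult_nonneg_nonneg sum_nonneg)
  then show ?case using insert by (simp add: power2_sum)
qed simp

text \<open>
  Both the function \<open>exp (i x) - 1\<close> of the sum and the sum of its values agree with \<open>i\<close> times the sum
  to first order; the linear bound serves weak laws, the quadratic one the central limit theorem.
\<close>

lemma iexp_sum_additivity_error:
  fixes x :: "'i \<Rightarrow> real"
  assumes "finite S"
  defines "err \<equiv> norm (iexp (\<Sum>i\<in>S. x i) - 1 - (\<Sum>i\<in>S. iexp (x i) - 1))"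
  shows "err \<le> 2 * (\<Sum>i\<in>S. \<bar>x i\<bar>)" and "err \<le> (\<Sum>i\<in>S. \<bar>x i\<bar>)\<^sup>2"
proof -
  have "norm (\<Sum>i\<in>S. iexp (x i) - 1) \<le> (\<Sum>i\<in>S. \<bar>x i\<bar>)"
    by (rule sum_norm_le) (rule norm_iexp_minus_1_le)
  moreover have "norm (iexp (\<Sum>i\<in>S. x i) - 1) \<le> (\<Sum>i\<in>S. \<bar>x i\<bar>)"
    by (rule order_trans[OF norm_iexp_minus_1_le sum_abs])
  ultimately show "err \<le> 2 * (\<Sum>i\<in>S. \<bar>x i\<bar>)"
    unfolding err_def using norm_triangle_ineq4[of "iexp (\<Sum>i\<in>S. x i) - 1" "\<Sum>i\<in>S. iexp (x i) - 1"] by linarith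
  have "norm (\<Sum>i\<in>S. iexp (x i) - 1 - \<i> * x i) \<le> (\<Sum>i\<in>S. (x i)\<^sup>2 / 2)"
    by (rule sum_norm_le) (rule norm_iexp_minus_linear_le)
  also have "\<dots> \<le> (\<Sum>i\<in>S. \<bar>x i\<bar>)\<^sup>2 / 2"
    using sum_squares_le_square_sum[OF assms(1), of "\<lambda>i. \<bar>x i\<bar>"] by (simp add: sum_divide_distrib[symmetric])
  finally have 1: "norm (\<Sum>i\<in>S. iexp (x i) - 1 - \<i> * x i) \<le> (\<Sum>i\<in>S. \<bar>x i\<bar>)\<^sup>2 / 2" .
  have "norm (iexp (\<Sum>i\<in>S. x i) - 1 - \<i> * (\<Sum>i\<in>S. x i)) \<le> (\<Sum>i\<in>S. x i)\<^sup>2 / 2"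
    by (rule norm_iexp_minus_linear_le)
  also have "\<dots> \<le> (\<Sum>i\<in>S. \<bar>x i\<bar>)\<^sup>2 / 2"
    by (simp add: abs_le_square_iff[symmetric] sum_nonneg)
  finally have 2: "norm (iexp (\<Sum>i\<in>S. x i) - 1 - \<i> * (\<Sum>i\<in>S. x i)) \<le> (\<Sum>i\<in>S. \<bar>x i\<bar>)\<^sup>2 / 2" .
  have "iexp (\<Sum>i\<in>S. x i) - 1 - (\<Sum>i\<in>S. iexp (x i) - 1)
      = (iexp (\<Sum>i\<in>S. x i) - 1 - \<i> * (\<Sum>i\<in>S. x i)) - (\<Sum>i\<in>S. iexp (x i) - 1 - \<i> * x i)"
    by (simp add: sum_subtractf sum_distrib_left)
  then show "err \<le> (\<Sum>i\<in>S. \<bar>x i\<bar>)\<^sup>2"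
    using norm_triangle_ineq4[of "iexp (\<Sum>i\<in>S. x i) - 1 - \<i> * (\<Sum>i\<in>S. x i)" "\<Sum>i\<in>S. iexp (x i) - 1 - \<i> * x i"] 1 2
    unfolding err_def by (simp only:)
qed

text \<open>
  The error is measured by the squared total run length because that is the quantity whose
  expectation over the blocks with several runs is assumed to be small.
\<close>

definition additivity_bound :: "(nat \<Rightarrow> real) \<Rightarrow> real \<Rightarrow> bool" where
  "additivity_bound g B \<longleftrightarrow> (\<forall>S y. finite (S::nat set) \<longrightarrow> (\<forall>i\<in>S. 1 \<le> y i) \<longrightarrow>
     norm (iexp (\<Sum>i\<in>S. g (y i)) - 1 - (\<Sum>i\<in>S. iexp (g (y i)) - 1)) \<le> B * (\<Sum>i\<in>S. real (y i))\<^sup>2)"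

lemma additivity_bound_linear:
  assumes "\<And>y. 1 \<le> y \<Longrightarrow> \<bar>g y\<bar> \<le> \<kappa> * real y"
  shows "additivity_bound g (\<kappa>\<^sup>2)"
  unfolding additivity_bound_def
proof (intro allI impI)
  fix S :: "nat set" and y :: "nat \<Rightarrow> nat"
  assume S: "finite S" "\<forall>i\<in>S. 1 \<le> y i"
  have "(\<Sum>i\<in>S. \<bar>g (y i)\<bar>) \<le> (\<Sum>i\<in>S. \<kappa> * real (y i))"
    by (rule sum_mono) (use assms S in auto)
  then have "(\<Sum>i\<in>S. \<bar>g (y i)\<bar>)\<^sup>2 \<le> (\<kappa> * (\<Sum>i\<in>S. real (y i)))\<^sup>2"
    by (intro power_mono) (auto simp: sum_distrib_left sum_nonneg)
  with iexp_sum_additivity_error(2)[OF S(1), of "\<lambda>i. g (y i)"]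
  show "norm (iexp (\<Sum>i\<in>S. g (y i)) - 1 - (\<Sum>i\<in>S. iexp (g (y i)) - 1)) \<le> \<kappa>\<^sup>2 * (\<Sum>i\<in>S. real (y i))\<^sup>2"
    by (simp add: power_mult_distrib)
qed

lemma additivity_bound_quadratic:
  assumes g: "\<And>y. 1 \<le> y \<Longrightarrow> \<bar>g y\<bar> \<le> \<kappa> * (real y)\<^sup>2" and "0 \<le> \<kappa>"
  shows "additivity_bound g (2 * \<kappa>)"
  unfolding additivity_bound_def
proof (intro allI impI)
  fix S :: "nat set" and y :: "nat \<Rightarrow> nat"
  assume S: "finite S" "\<forall>i\<in>S. 1 \<le> y i"
  have "(\<Sum>i\<in>S. \<bar>g (y i)\<bar>) \<le> (\<Sum>i\<in>S. \<kappa> * (real (y i))\<^sup>2)"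
    by (rule sum_mono) (use g S in auto)
  also have "\<dots> \<le> \<kappa> * (\<Sum>i\<in>S. real (y i))\<^sup>2"
    using sum_squares_le_square_sum[OF S(1), of "\<lambda>i. real (y i)"] \<open>0 \<le> \<kappa>\<close>
    by (simp add: sum_distrib_left[symmetric] mult_left_mono)
  finally show "norm (iexp (\<Sum>i\<in>S. g (y i)) - 1 - (\<Sum>i\<in>S. iexp (g (y i)) - 1)) \<le> 2 * \<kappa> * (\<Sum>i\<in>S. real (y i))\<^sup>2"
    using iexp_sum_additivity_error(1)[OF S(1), of "\<lambda>i. g (y i)"] by simp
qed

lemma run_sum_starts: "run_sum g s a h = (\<Sum>i\<in>{i\<in>{a<..a+h}. starts_at s i}. g (run_at s i))"
  unfolding run_sum_def by (rule sum.mono_neutral_cong_right) auto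

context stationary_sequence
begin

lemma
  fixes f :: "nat \<Rightarrow> 'b::{banach, second_countable_topology}"
  assumes p: "0 < start_prob u" and "1 \<le> i"
  shows expectation_at_start: "(LINT \<omega>|M. of_bool (starts_at (config u \<omega>) i) *\<^sub>R f (run_at (config u \<omega>) i))
      = start_prob u *\<^sub>R (LINT z|run_law M X u. f z)"
    and integrable_at_start: "integrable (run_law M X u) f \<Longrightarrow>
      integrable M (\<lambda>\<omega>. of_bool (starts_at (config u \<omega>) i) *\<^sub>R f (run_at (config u \<omega>) i))"
proof -
  have [measurable]: "(\<lambda>s. f (run_at s 1)) \<in> borel_measurable config_space"
    by (rule measurable_compose[OF measurable_run_at]) simp
  define F where "F s = of_bool (starts_at s 1) *\<^sub>R f (run_at s 1)" for s
  have F [measurable]: "F \<in> borel_measurable config_space" unfolding F_def by measurable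
  have down: "F (shift_down (i - 1) s) = of_bool (starts_at s i) *\<^sub>R f (run_at s i)" for s
    using \<open>1 \<le> i\<close> by (simp add: F_def run_at_shift_down starts_at_shift_down)
  show "(LINT \<omega>|M. of_bool (starts_at (config u \<omega>) i) *\<^sub>R f (run_at (config u \<omega>) i))
      = start_prob u *\<^sub>R (LINT z|run_law M X u. f z)"
    using integral_shift[OF F, of "i - 1" u] p unfolding down by (simp add: integral_run_law F_def)
  show "integrable M (\<lambda>\<omega>. of_bool (starts_at (config u \<omega>) i) *\<^sub>R f (run_at (config u \<omega>) i))"
    if "integrable (run_law M X u) f"
    using integrable_shift[OF F, of "i - 1" u] that p unfolding down by (simp add: integrable_run_law F_def)
qed

lemma expectation_run_sum:
  assumes p: "0 < start_prob u" and "integrable (run_law M X u) g"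
  shows "(LINT \<omega>|M. run_sum g (config u \<omega>) 0 m) = m * start_prob u * (LINT z|run_law M X u. g z)"
proof -
  have "(LINT \<omega>|M. run_sum g (config u \<omega>) 0 m)
      = (\<Sum>i\<in>{0<..m}. LINT \<omega>|M. of_bool (starts_at (config u \<omega>) i) *\<^sub>R g (run_at (config u \<omega>) i))"
    unfolding run_sum_def
  proof (subst Bochner_Integration.integral_sum[symmetric])
    show "integrable M (\<lambda>\<omega>. of_bool (starts_at (config u \<omega>) i) *\<^sub>R g (run_at (config u \<omega>) i))" if "i \<in> {0<..m}" for i
      using that by (intro integrable_at_start p assms(2)) auto
  qed (simp add: mult.commute)
  also have "\<dots> = (\<Sum>i\<in>{0<..m}. start_prob u *\<^sub>R (LINT z|run_law M X u. g z))"
    by (intro sum.cong refl expectation_at_start p) auto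
  finally show ?thesis by simp
qed

lemma measurable_run_sum_config [measurable]: "(\<lambda>\<omega>. run_sum g (config u \<omega>) a m) \<in> borel_measurable M"
  by (rule measurable_compose[OF measurable_config measurable_run_sum])

lemma integrable_run_sum_square:
  assumes p: "0 < start_prob u" and Z2: "integrable (run_law M X u) (\<lambda>z. (real z)\<^sup>2)"
  shows "integrable M (\<lambda>\<omega>. (run_sum real (config u \<omega>) 0 m)\<^sup>2)"
proof (rule Bochner_Integration.integrable_bound)
  have "integrable M (\<lambda>\<omega>. of_bool (starts_at (config u \<omega>) i) *\<^sub>R (real (run_at (config u \<omega>) i))\<^sup>2)" if "1 \<le> i" for i
    by (rule integrable_at_start[OF p that Z2])
  then show "integrable M (\<lambda>\<omega>. real m * run_sum (\<lambda>z. (real z)\<^sup>2) (config u \<omega>) 0 m)"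
    unfolding run_sum_def by (intro integrable_mult_right Bochner_Integration.integrable_sum) (auto simp: mult.commute)
  show "AE \<omega> in M. norm ((run_sum real (config u \<omega>) 0 m)\<^sup>2) \<le> norm (real m * run_sum (\<lambda>z. (real z)\<^sup>2) (config u \<omega>) 0 m)"
  proof (rule AE_I2)
    fix \<omega>
    have "(run_sum real (config u \<omega>) 0 m)\<^sup>2 \<le> real m * (\<Sum>i\<in>{0<..0+m}. (real (run_at (config u \<omega>) i) * of_bool (starts_at (config u \<omega>) i))\<^sup>2)"
      unfolding run_sum_def
      using sum_squared_le_sum_of_squares[of "\<lambda>i. real (run_at (config u \<omega>) i) * of_bool (starts_at (config u \<omega>) i)" "{0<..0+m}"]
      by (simp add: mult.commute)
    also have "(\<Sum>i\<in>{0<..0+m}. (real (run_at (config u \<omega>) i) * of_bool (starts_at (config u \<omega>) i))\<^sup>2)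
        = run_sum (\<lambda>z. (real z)\<^sup>2) (config u \<omega>) 0 m"
      unfolding run_sum_def by (intro sum.cong) auto
    finally show "norm ((run_sum real (config u \<omega>) 0 m)\<^sup>2) \<le> norm (real m * run_sum (\<lambda>z. (real z)\<^sup>2) (config u \<omega>) 0 m)"
      by simp
  qed
qed measurable

text \<open>
  With at most one run in the block, \<open>exp (i T) - 1\<close> equals the sum of \<open>exp (i g(y)) - 1\<close> over the
  runs. The expectation of that sum is computed by stationarity, and the remaining configurations are
  covered by \<open>additivity_bound\<close>.
\<close>

lemma block_char_expansion:
  assumes p: "0 < start_prob u" and fin: "finite_runs u"
    and Z2: "integrable (run_law M X u) (\<lambda>z. (real z)\<^sup>2)"
    and g: "additivity_bound g B"
  shows "norm (block_char g u r - 1 - (r * start_prob u) *\<^sub>R ((LINT z|run_law M X u. iexp (g z)) - 1))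
    \<le> B * (LINT \<omega>|M. (run_sum real (config u \<omega>) 0 r)\<^sup>2 * of_bool (run_sum (\<lambda>_. 1) (config u \<omega>) 0 r > 1))"
proof -
  interpret Z: prob_space "run_law M X u" by (rule prob_space_run_law[OF p])
  let ?S = "\<lambda>\<omega>. {i\<in>{0<..0+r}. starts_at (config u \<omega>) i}"
  let ?tot = "\<lambda>\<omega>. run_sum real (config u \<omega>) 0 r"
  define e where "e z = iexp (g z) - 1" for z
  let ?E = "\<lambda>\<omega>. \<Sum>i\<in>{0<..r}. of_bool (starts_at (config u \<omega>) i) *\<^sub>R e (run_at (config u \<omega>) i)"
  have int_e: "integrable (run_law M X u) e"
    unfolding e_def by (intro Z.integrable_const_bound[where B = 2] AE_I2)
      (auto intro: order_trans[OF norm_triangle_ineq4] simp: run_law_def)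
  have mean_e: "(LINT z|run_law M X u. e z) = (LINT z|run_law M X u. iexp (g z)) - 1"
  proof -
    have "integrable (run_law M X u) (\<lambda>z. iexp (g z))"
      by (intro Z.integrable_const_bound[where B = 1] AE_I2) (auto simp: run_law_def)
    then show ?thesis unfolding e_def by (simp add: Z.prob_space)
  qed
  have int_E: "integrable M ?E"
    by (intro Bochner_Integration.integrable_sum integrable_at_start p int_e) auto
  have "(LINT \<omega>|M. ?E \<omega>) = (\<Sum>i\<in>{0<..r}. LINT \<omega>|M. of_bool (starts_at (config u \<omega>) i) *\<^sub>R e (run_at (config u \<omega>) i))"
    by (rule Bochner_Integration.integral_sum) (auto intro!: integrable_at_start p int_e)
  also have "\<dots> = (r * start_prob u) *\<^sub>R ((LINT z|run_law M X u. iexp (g z)) - 1)"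
  proof -
    have "(\<Sum>i\<in>{0<..r}. LINT \<omega>|M. of_bool (starts_at (config u \<omega>) i) *\<^sub>R e (run_at (config u \<omega>) i))
        = (\<Sum>i\<in>{0<..r}. start_prob u *\<^sub>R (LINT z|run_law M X u. e z))"
      by (intro sum.cong refl expectation_at_start p) auto
    then show ?thesis unfolding mean_e by (simp add: scaleR_conv_of_real)
  qed
  finally have mean_E: "(LINT \<omega>|M. ?E \<omega>) = (r * start_prob u) *\<^sub>R ((LINT z|run_law M X u. iexp (g z)) - 1)" .
  have int_B: "integrable M (\<lambda>\<omega>. iexp (run_sum g (config u \<omega>) 0 r))"
    by (rule integrable_const_bound[where B = 1]) auto
  have E_eq: "?E \<omega> = (\<Sum>i\<in>?S \<omega>. iexp (g (run_at (config u \<omega>) i)) - 1)" for \<omega>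
    unfolding e_def by (rule sum.mono_neutral_cong_right) auto
  have count: "run_sum (\<lambda>_. 1) (config u \<omega>) 0 r = card (?S \<omega>)" for \<omega>
    unfolding run_sum_starts by simp
  let ?bd = "\<lambda>\<omega>. B * ((?tot \<omega>)\<^sup>2 * of_bool (run_sum (\<lambda>_. 1) (config u \<omega>) 0 r > 1))"
  have diff: "block_char g u r - 1 - (r * start_prob u) *\<^sub>R ((LINT z|run_law M X u. iexp (g z)) - 1)
      = (LINT \<omega>|M. iexp (run_sum g (config u \<omega>) 0 r) - 1 - ?E \<omega>)"
    unfolding mean_E[symmetric] block_char_def using int_B int_E by (simp add: prob_space)
  have "norm (LINT \<omega>|M. iexp (run_sum g (config u \<omega>) 0 r) - 1 - ?E \<omega>)
      \<le> (LINT \<omega>|M. norm (iexp (run_sum g (config u \<omega>) 0 r) - 1 - ?E \<omega>))"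
    by (rule integral_norm_bound)
  also have "\<dots> \<le> (LINT \<omega>|M. ?bd \<omega>)"
  proof (rule integral_mono_AE)
    show "integrable M (\<lambda>\<omega>. norm (iexp (run_sum g (config u \<omega>) 0 r) - 1 - ?E \<omega>))"
      by (intro integrable_norm Bochner_Integration.integrable_diff int_B int_E integrable_const)
    show "integrable M ?bd"
    proof (rule integrable_mult_right, rule Bochner_Integration.integrable_bound[OF integrable_run_sum_square[OF p Z2, of r]])
      show "AE \<omega> in M. norm ((?tot \<omega>)\<^sup>2 * of_bool (run_sum (\<lambda>_. 1) (config u \<omega>) 0 r > 1)) \<le> norm ((?tot \<omega>)\<^sup>2)"
        by (rule AE_I2) simp
    qed measurable
    show "AE \<omega> in M. norm (iexp (run_sum g (config u \<omega>) 0 r) - 1 - ?E \<omega>) \<le> ?bd \<omega>"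
      using AE_run_at_pos[OF fin]
    proof (rule AE_mp, intro AE_I2 impI)
      fix \<omega> assume pos: "\<forall>i\<ge>1. starts_at (config u \<omega>) i \<longrightarrow> 1 \<le> run_at (config u \<omega>) i"
      show "norm (iexp (run_sum g (config u \<omega>) 0 r) - 1 - ?E \<omega>) \<le> ?bd \<omega>"
      proof (cases "card (?S \<omega>) > 1")
        case True
        have "norm (iexp (\<Sum>i\<in>?S \<omega>. g (run_at (config u \<omega>) i)) - 1 - (\<Sum>i\<in>?S \<omega>. iexp (g (run_at (config u \<omega>) i)) - 1))
            \<le> B * (\<Sum>i\<in>?S \<omega>. real (run_at (config u \<omega>) i))\<^sup>2"
          using g pos unfolding additivity_bound_def by auto
        then show ?thesis
          using True unfolding E_eq count run_sum_starts by simp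
      next
        case False
        then consider "?S \<omega> = {}" | i where "?S \<omega> = {i}"
          by (metis (no_types, lifting) card_1_singletonE card_eq_0_iff finite_greaterThanAtMost finite_Collect_conjI finite_subset linorder_neqE_nat less_one mem_Collect_eq subsetI)
        then have "iexp (run_sum g (config u \<omega>) 0 r) - 1 - ?E \<omega> = 0"
        proof cases
          case 1
          show ?thesis unfolding E_eq run_sum_starts 1 by simp
        next
          case 2
          show ?thesis unfolding E_eq run_sum_starts 2 by simp
        qed
        then show ?thesis using False unfolding count by simp
      qed
    qed
  qed
  also have "\<dots> = B * (LINT \<omega>|M. (?tot \<omega>)\<^sup>2 * of_bool (run_sum (\<lambda>_. 1) (config u \<omega>) 0 r > 1))"
    by (rule integral_mult_right_zero)
  finally show ?thesis unfolding diff .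
qed

end

section \<open>A compound Poisson type limit theorem\<close>

text \<open>
  Compare \<open>z\<close> with \<open>exp (z - 1)\<close>: both lie in the unit disc and differ by a second order term, so
  their \<open>k\<close>-th powers differ by at most \<open>k\<close> times that term.
\<close>

lemma tendsto_power_exp:
  fixes z :: "nat \<Rightarrow> complex" and k :: "nat \<Rightarrow> nat"
  assumes z: "\<And>n. norm (z n) \<le> 1" and k: "filterlim k at_top sequentially"
    and lim: "(\<lambda>n. of_nat (k n) * (z n - 1)) \<longlonglongrightarrow> w"
  shows "(\<lambda>n. z n ^ k n) \<longlonglongrightarrow> exp w"
proof -
  have k': "filterlim (\<lambda>n. real (k n)) at_top sequentially"
    by (rule filterlim_compose[OF filterlim_real_sequentially k])
  have small: "(\<lambda>n. z n - 1) \<longlonglongrightarrow> 0"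
  proof -
    have "(\<lambda>n. of_nat (k n) * (z n - 1) * of_real (inverse (real (k n)))) \<longlonglongrightarrow> w * of_real 0"
      by (intro tendsto_mult lim tendsto_of_real tendsto_inverse_0_at_top k')
    moreover have "\<forall>\<^sub>F n in sequentially. of_nat (k n) * (z n - 1) * of_real (inverse (real (k n))) = z n - 1"
      using filterlim_at_top_dense[THEN iffD1, OF k', rule_format, of 0] by eventually_elim auto
    ultimately show ?thesis
      by (subst tendsto_cong[where g = "\<lambda>n. of_nat (k n) * (z n - 1) * of_real (inverse (real (k n)))"])
        (auto elim: eventually_mono)
  qed
  have "(\<lambda>n. z n ^ k n - exp (z n - 1) ^ k n) \<longlonglongrightarrow> 0"
  proof (rule Lim_null_comparison)
    show "\<forall>\<^sub>F n in sequentially. norm (z n ^ k n - exp (z n - 1) ^ k n)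
        \<le> exp (norm (z n - 1)) * (norm (of_nat (k n) * (z n - 1)) * norm (z n - 1))"
    proof (intro always_eventually allI)
      fix n
      have "Re (z n) \<le> 1" using complex_Re_le_cmod[of "z n"] z[of n] by linarith
      then have "norm (exp (z n - 1)) \<le> 1" by simp
      then have "norm (z n ^ k n - exp (z n - 1) ^ k n) \<le> k n * norm (z n - exp (z n - 1))"
        by (intro norm_power_diff z)
      also have "norm (z n - exp (z n - 1)) = norm (exp (z n - 1) - (\<Sum>i\<le>1. (z n - 1) ^ i / fact i))"
        by (simp add: norm_minus_commute)
      also have "\<dots> \<le> exp \<bar>Re (z n - 1)\<bar> * norm (z n - 1) ^ Suc 1 / fact 1"
        by (rule Taylor_exp)
      also have "\<dots> \<le> exp (norm (z n - 1)) * norm (z n - 1) ^ Suc 1"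
        using abs_Re_le_cmod[of "z n - 1"] by (simp add: mult_right_mono)
      finally have "norm (z n ^ k n - exp (z n - 1) ^ k n)
          \<le> real (k n) * (exp (norm (z n - 1)) * norm (z n - 1) ^ Suc 1)"
        by (simp only: mult_left_mono[OF _ of_nat_0_le_iff])
      then show "norm (z n ^ k n - exp (z n - 1) ^ k n)
        \<le> exp (norm (z n - 1)) * (norm (of_nat (k n) * (z n - 1)) * norm (z n - 1))"
        by (simp add: norm_mult ac_simps power2_eq_square)
    qed
    have "(\<lambda>n. exp (norm (z n - 1)) * (norm (of_nat (k n) * (z n - 1)) * norm (z n - 1))) \<longlonglongrightarrow> exp (norm (0::complex)) * (norm w * norm (0::complex))"
      by (intro tendsto_intros lim small)
    then show "(\<lambda>n. exp (norm (z n - 1)) * (norm (of_nat (k n) * (z n - 1)) * norm (z n - 1))) \<longlonglongrightarrow> 0"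
      by simp
  qed
  moreover have "(\<lambda>n. exp (z n - 1) ^ k n) \<longlonglongrightarrow> exp w"
    unfolding exp_of_nat_mult[symmetric] by (intro tendsto_exp lim)
  ultimately show ?thesis
    using tendsto_add by fastforce
qed

text \<open>
  This part concerns only the upcrossings; it yields \<open>c\<^sub>n / n \<rightarrow> 0\<close>, which is used to verify the
  assumption \<open>runs_end\<close> of the next locale.
\<close>

locale crossing_asymptotics = stationary_sequence M X for M :: "'a measure" and X +
  fixes v c :: "nat \<Rightarrow> real" and k r l :: "nat \<Rightarrow> nat" and \<nu> :: real
  assumes nu_pos: "0 < \<nu>"
    and c_top: "filterlim c at_top sequentially" and k_top: "filterlim k at_top sequentially"
    and r_def: "\<And>n. r n = n div k n"
    and levels: "(\<lambda>n. real n * crossing_prob (v n) - c n * \<nu>) \<longlonglongrightarrow> 0"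
    and l_ge_2: "\<And>n. 1 \<le> n \<Longrightarrow> 2 \<le> l n"
    and separation: "(\<lambda>n. real (k n) * (mixing_coeff M X (v n) n (l n - 2)
          + \<P>(\<omega> in M. upcrossing_process X (v n) n {0..real (l n) / real n} \<omega> > 0))) \<longlonglongrightarrow> 0"
begin

lemma c_pos: "\<forall>\<^sub>F n in sequentially. 0 < c n"
  using filterlim_at_top_dense[THEN iffD1, OF c_top] by blast

lemma inverse_c: "(\<lambda>n. inverse (c n)) \<longlonglongrightarrow> 0"
  by (rule tendsto_inverse_0_at_top[OF c_top])

lemma k_large: "\<forall>\<^sub>F n in sequentially. 2 \<le> k n"
  using k_top by (simp add: filterlim_at_top)

lemma crossing_rate: "(\<lambda>n. real n * crossing_prob (v n) / c n) \<longlonglongrightarrow> \<nu>"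
proof -
  have "(\<lambda>n. (real n * crossing_prob (v n) - c n * \<nu>) * inverse (c n) + \<nu>) \<longlonglongrightarrow> 0 * 0 + \<nu>"
    by (intro tendsto_intros levels inverse_c)
  moreover have "\<forall>\<^sub>F n in sequentially. (real n * crossing_prob (v n) - c n * \<nu>) * inverse (c n) + \<nu> = real n * crossing_prob (v n) / c n"
    using c_pos by eventually_elim (simp add: field_simps)
  ultimately show ?thesis
    by (simp add: tendsto_cong)
qed

lemma crossings_top: "filterlim (\<lambda>n. real n * crossing_prob (v n)) at_top sequentially"
proof -
  have "filterlim (\<lambda>n. (real n * crossing_prob (v n) / c n) * c n) at_top sequentially"
    by (rule filterlim_tendsto_pos_mult_at_top[OF crossing_rate nu_pos c_top])
  moreover have "\<forall>\<^sub>F n in sequentially. (real n * crossing_prob (v n) / c n) * c n = real n * crossing_prob (v n)"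
    using c_pos by eventually_elim simp
  ultimately show ?thesis
    by (simp add: filterlim_cong[OF refl refl])
qed

lemma crossing_prob_pos: "\<forall>\<^sub>F n in sequentially. 0 < crossing_prob (v n)"
proof -
  have "\<forall>\<^sub>F n in sequentially. 0 < real n * crossing_prob (v n)"
    using filterlim_at_top_dense[THEN iffD1, OF crossings_top] by blast
  then show ?thesis
    by eventually_elim (auto simp: zero_less_mult_iff)
qed

lemma mixing_small: "(\<lambda>n. real (k n) * mixing_coeff M X (v n) n (l n - 2)) \<longlonglongrightarrow> 0"
  and gap_crossing_small: "(\<lambda>n. real (k n) * \<P>(\<omega> in M. upcrossing_process X (v n) n {0..real (l n) / real n} \<omega> > 0)) \<longlonglongrightarrow> 0"
  by (rule tendsto_sandwich[OF _ _ tendsto_const separation];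
      auto intro!: always_eventually mult_left_mono mult_nonneg_nonneg simp: mixing_coeff_nonneg)+

text \<open>
  The first index lies in the interval \<open>[0, l\<^sub>n / n]\<close>, so the assumption on that interval bounds \<open>q\<close>.
\<close>

lemma block_crossing_small: "(\<lambda>n. real (k n) * crossing_prob (v n)) \<longlonglongrightarrow> 0"
proof (rule tendsto_sandwich[OF _ _ tendsto_const gap_crossing_small])
  show "\<forall>\<^sub>F n in sequentially. 0 \<le> real (k n) * crossing_prob (v n)"
    by (simp add: crossing_prob_nonneg)
  show "\<forall>\<^sub>F n in sequentially. real (k n) * crossing_prob (v n)
      \<le> real (k n) * \<P>(\<omega> in M. upcrossing_process X (v n) n {0..real (l n) / real n} \<omega> > 0)"
    using eventually_ge_at_top[of 2]
  proof eventually_elim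
    case (elim n)
    have "1 \<in> {i\<in>{1..n-1}. i \<le> l n}" using elim l_ge_2[of n] by simp
    then have "{\<omega>\<in>space M. 1 \<in> config (v n) \<omega>} \<subseteq> {\<omega>\<in>space M. config (v n) \<omega> \<inter> {i\<in>{1..n-1}. i \<le> l n} \<noteq> {}}"
      by blast
    then have "crossing_prob (v n) \<le> \<P>(\<omega> in M. config (v n) \<omega> \<inter> {i\<in>{1..n-1}. i \<le> l n} \<noteq> {})"
      unfolding crossing_prob_def
      by (rule finite_measure_mono) (use pred_config_meets[of "{i\<in>{1..n-1}. i \<le> l n}" "v n"] in simp)
    then show ?case unfolding upcrossing_process_pos_iff by (intro mult_left_mono) auto
  qed
qed

lemma k_over_n: "(\<lambda>n. real (k n) / real n) \<longlonglongrightarrow> 0"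
proof -
  have "(\<lambda>n. (real (k n) * crossing_prob (v n)) * inverse (real n * crossing_prob (v n))) \<longlonglongrightarrow> 0 * 0"
    by (intro tendsto_mult block_crossing_small tendsto_inverse_0_at_top crossings_top)
  moreover have "\<forall>\<^sub>F n in sequentially. (real (k n) * crossing_prob (v n)) * inverse (real n * crossing_prob (v n)) = real (k n) / real n"
    using crossing_prob_pos by eventually_elim (simp add: field_simps)
  ultimately show ?thesis
    by (simp add: tendsto_cong)
qed

lemma block_fraction: "(\<lambda>n. real (k n * r n) / real n) \<longlonglongrightarrow> 1"
proof (rule tendsto_sandwich[OF _ _ _ tendsto_const])
  show "\<forall>\<^sub>F n in sequentially. 1 - real (k n) / real n \<le> real (k n * r n) / real n"
    using k_large eventually_gt_at_top[of 0]
  proof eventually_elim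
    case (elim n)
    have "n = k n * r n + n mod k n" unfolding r_def by simp
    moreover have "n mod k n \<le> k n" using elim by (intro less_imp_le mod_less_divisor) auto
    ultimately have "n \<le> k n * r n + k n" by linarith
    then have "real n \<le> real (k n * r n) + real (k n)" by (metis of_nat_add of_nat_le_iff)
    then have "real n / real n \<le> (real (k n * r n) + real (k n)) / real n"
      by (intro divide_right_mono) auto
    then show ?case using elim by (simp add: add_divide_distrib)
  qed
  show "\<forall>\<^sub>F n in sequentially. real (k n * r n) / real n \<le> 1"
  proof (intro always_eventually allI)
    fix n
    have "k n * r n \<le> n" unfolding r_def by simp
    then have "real (k n * r n) \<le> real n" using of_nat_le_iff by blast
    then show "real (k n * r n) / real n \<le> 1" by (cases "n = 0") (simp_all add: divide_le_eq_1)
  qed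
  have "(\<lambda>n. 1 - real (k n) / real n) \<longlonglongrightarrow> 1 - 0"
    by (intro tendsto_intros k_over_n)
  then show "(\<lambda>n. 1 - real (k n) / real n) \<longlonglongrightarrow> 1" by simp
qed

lemma c_over_n: "(\<lambda>n. c n / real n) \<longlonglongrightarrow> 0"
proof -
  have "(\<lambda>n. crossing_prob (v n)) \<longlonglongrightarrow> 0"
  proof (rule tendsto_sandwich[OF _ _ tendsto_const block_crossing_small])
    show "\<forall>\<^sub>F n in sequentially. crossing_prob (v n) \<le> real (k n) * crossing_prob (v n)"
      using k_large
    proof eventually_elim
      case (elim n)
      then have "1 * crossing_prob (v n) \<le> real (k n) * crossing_prob (v n)"
        by (intro mult_right_mono crossing_prob_nonneg) simp
      then show ?case by simp
    qed
  qed (simp add: crossing_prob_nonneg)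
  then have "(\<lambda>n. crossing_prob (v n) / (real n * crossing_prob (v n) / c n)) \<longlonglongrightarrow> 0 / \<nu>"
    using nu_pos by (intro tendsto_divide crossing_rate) simp_all
  moreover have "\<forall>\<^sub>F n in sequentially. crossing_prob (v n) / (real n * crossing_prob (v n) / c n) = c n / real n"
    using crossing_prob_pos by eventually_elim simp
  ultimately have "(\<lambda>n. c n / real n) \<longlonglongrightarrow> 0 / \<nu>"
    by (rule Lim_transform_eventually)
  then show ?thesis by simp
qed

end

locale run_asymptotics = crossing_asymptotics M X v c k r l \<nu>
  for M :: "'a measure" and X v c k r l \<nu> +
  fixes \<eta> :: real
  assumes eta_pos: "0 < \<eta>"
    and runs_end: "\<forall>\<^sub>F n in sequentially.
          (\<lambda>j. \<P>(\<omega> in M. \<forall>m\<in>{2..j}. upcrossing X (v n) (2 * m - 1) \<omega>)) \<longlonglongrightarrow> 0"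
    and run_mean: "(\<lambda>n. LINT z|run_law M X (v n). real z) \<longlonglongrightarrow> 1 / \<eta>"
    and run_square_integrable: "\<forall>\<^sub>F n in sequentially. integrable (run_law M X (v n)) (\<lambda>z. (real z)\<^sup>2)"
    and few_multiple_runs: "(\<lambda>n. real (k n) / c n * (LINT \<omega>|M. (run_sum real (config (v n) \<omega>) 0 (r n))\<^sup>2
          * of_bool (run_sum (\<lambda>_. 1) (config (v n) \<omega>) 0 (r n) > 1))) \<longlonglongrightarrow> 0"
begin

lemma eventually_finite_runs: "\<forall>\<^sub>F n in sequentially. finite_runs (v n)"
  using runs_end by eventually_elim (rule finite_runsI)

lemma start_prob_pos: "\<forall>\<^sub>F n in sequentially. 0 < start_prob (v n)"
  and start_prob_mean: "\<forall>\<^sub>F n in sequentially. start_prob (v n) * (LINT z|run_law M X (v n). real z) = crossing_prob (v n)"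
proof -
  have "\<forall>\<^sub>F n in sequentially. 0 < start_prob (v n) \<and>
      start_prob (v n) * (LINT z|run_law M X (v n). real z) = crossing_prob (v n)"
    using runs_end crossing_prob_pos
  proof eventually_elim
    case (elim n)
    have mean: "(LINT \<omega>|M. of_bool (starts_at (config (v n) \<omega>) 1) * real (run_at (config (v n) \<omega>) 1)) = crossing_prob (v n)"
      by (rule expected_total_of_run) (use elim in auto)
    have pos: "0 < start_prob (v n)"
    proof (rule ccontr)
      assume "\<not> 0 < start_prob (v n)"
      then have "start_prob (v n) = 0" unfolding start_prob_def by (simp add: less_le)
      then have "AE \<omega> in M. \<not> starts_at (config (v n) \<omega>) 1"
        unfolding start_prob_def by (subst (asm) prob_Collect_eq_0) auto
      then have "(LINT \<omega>|M. of_bool (starts_at (config (v n) \<omega>) 1) * real (run_at (config (v n) \<omega>) 1)) = 0"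
        by (intro integral_eq_zero_AE) (auto elim: AE_mp)
      then show False using mean elim by simp
    qed
    then show ?case using mean by (simp add: integral_run_law)
  qed
  then show "\<forall>\<^sub>F n in sequentially. 0 < start_prob (v n)"
    "\<forall>\<^sub>F n in sequentially. start_prob (v n) * (LINT z|run_law M X (v n). real z) = crossing_prob (v n)"
    by (auto elim: eventually_mono)
qed

lemma start_rate: "(\<lambda>n. real n * start_prob (v n) / c n) \<longlonglongrightarrow> \<nu> * \<eta>"
proof -
  have "(\<lambda>n. (real n * crossing_prob (v n) / c n) / (LINT z|run_law M X (v n). real z)) \<longlonglongrightarrow> \<nu> / (1 / \<eta>)"
    by (intro tendsto_divide crossing_rate run_mean) (use eta_pos in simp)
  moreover have "\<forall>\<^sub>F n in sequentially. (real n * crossing_prob (v n) / c n) / (LINT z|run_law M X (v n). real z) = real n * start_prob (v n) / c n"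
    using start_prob_mean crossing_prob_pos
  proof eventually_elim
    case (elim n)
    then have "(LINT z|run_law M X (v n). real z) \<noteq> 0" by auto
    then show ?case by (simp add: elim(1)[symmetric])
  qed
  ultimately show ?thesis
    by (simp add: tendsto_cong)
qed

lemma block_start_rate: "(\<lambda>n. real (k n) * (real (r n) * start_prob (v n)) / c n) \<longlonglongrightarrow> \<nu> * \<eta>"
proof -
  have "(\<lambda>n. real (k n * r n) / real n * (real n * start_prob (v n) / c n)) \<longlonglongrightarrow> 1 * (\<nu> * \<eta>)"
    by (intro tendsto_mult block_fraction start_rate)
  moreover have "\<forall>\<^sub>F n in sequentially. real (k n * r n) / real n * (real n * start_prob (v n) / c n) = real (k n) * (real (r n) * start_prob (v n)) / c n"
    using eventually_gt_at_top[of 0] by eventually_elim simp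
  ultimately have "(\<lambda>n. real (k n) * (real (r n) * start_prob (v n)) / c n) \<longlonglongrightarrow> 1 * (\<nu> * \<eta>)"
    by (rule Lim_transform_eventually)
  then show ?thesis by simp
qed

text \<open>
  The factor \<open>\<nu> \<eta>\<close> is the limit of \<open>k\<^sub>n r\<^sub>n p / c\<^sub>n\<close>, the expected number of runs in all blocks relative
  to \<open>c\<^sub>n\<close>. The additivity error must be of order \<open>1 / c\<^sub>n\<close>, to be matched by the assumption on blocks
  with several runs.
\<close>

proposition char_total_tendsto:
  assumes g: "\<forall>\<^sub>F n in sequentially. additivity_bound (g n) (K / c n)"
    and w: "(\<lambda>n. c n *\<^sub>R ((LINT z|run_law M X (v n). iexp (g n z)) - 1)) \<longlonglongrightarrow> w"
  shows "(\<lambda>n. block_char (g n) (v n) (n - 3)) \<longlonglongrightarrow> exp ((\<nu> * \<eta>) *\<^sub>R w)"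
proof -
  let ?\<beta> = "\<lambda>n. \<P>(\<omega> in M. upcrossing_process X (v n) n {0..real (l n) / real n} \<omega> > 0)"
  let ?q = "\<lambda>n. crossing_prob (v n)"
  let ?\<alpha> = "\<lambda>n. mixing_coeff M X (v n) n (l n - 2)"
  let ?z = "\<lambda>n. block_char (g n) (v n) (r n)"
  let ?J = "\<lambda>n. LINT \<omega>|M. (run_sum real (config (v n) \<omega>) 0 (r n))\<^sup>2
          * of_bool (run_sum (\<lambda>_. 1) (config (v n) \<omega>) 0 (r n) > 1)"
  let ?e = "\<lambda>n. (LINT z|run_law M X (v n). iexp (g n z)) - 1"
  have "(\<lambda>n. of_nat (k n) * (?z n - 1) - (real (k n) * (real (r n) * start_prob (v n)) / c n) *\<^sub>R (c n *\<^sub>R ?e n)) \<longlonglongrightarrow> 0"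
  proof (rule Lim_null_comparison)
    show "\<forall>\<^sub>F n in sequentially. norm (of_nat (k n) * (?z n - 1) - (real (k n) * (real (r n) * start_prob (v n)) / c n) *\<^sub>R (c n *\<^sub>R ?e n))
        \<le> K * (real (k n) / c n * ?J n)"
      using g start_prob_pos eventually_finite_runs run_square_integrable c_pos
    proof eventually_elim
      case (elim n)
      have "of_nat (k n) * (?z n - 1) - (real (k n) * (real (r n) * start_prob (v n)) / c n) *\<^sub>R (c n *\<^sub>R ?e n)
          = of_nat (k n) * (?z n - 1 - (r n * start_prob (v n)) *\<^sub>R ?e n)"
        using elim by (simp add: scaleR_conv_of_real algebra_simps)
      also have "norm \<dots> \<le> real (k n) * (K / c n * ?J n)"
        unfolding norm_mult norm_of_nat
        by (intro mult_left_mono block_char_expansion) (use elim in auto)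
      finally show ?case by (simp add: mult.commute mult.left_commute)
    qed
    show "(\<lambda>n. K * (real (k n) / c n * ?J n)) \<longlonglongrightarrow> 0"
      using tendsto_mult_left[OF few_multiple_runs, of K] by simp
  qed
  moreover have "(\<lambda>n. (real (k n) * (real (r n) * start_prob (v n)) / c n) *\<^sub>R (c n *\<^sub>R ?e n)) \<longlonglongrightarrow> (\<nu> * \<eta>) *\<^sub>R w"
    by (intro tendsto_scaleR block_start_rate w)
  ultimately have "(\<lambda>n. of_nat (k n) * (?z n - 1)) \<longlonglongrightarrow> (\<nu> * \<eta>) *\<^sub>R w"
    using tendsto_add by fastforce
  then have power: "(\<lambda>n. ?z n ^ k n) \<longlonglongrightarrow> exp ((\<nu> * \<eta>) *\<^sub>R w)"
    by (intro tendsto_power_exp norm_block_char_le k_top)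
  have "(\<lambda>n. block_char (g n) (v n) (n - 3) - ?z n ^ k n) \<longlonglongrightarrow> 0"
  proof (rule Lim_null_comparison)
    show "\<forall>\<^sub>F n in sequentially. norm (block_char (g n) (v n) (n - 3) - ?z n ^ k n)
        \<le> 16 * (real (k n) * ?\<alpha> n) + 4 * (real (k n) * ?\<beta> n) + 16 * (real (k n) * ?q n)"
      using k_large eventually_ge_at_top[of 1]
    proof eventually_elim
      case (elim n)
      have "norm (block_char (g n) (v n) (n - 3) - ?z n ^ k n)
          \<le> 16 * real (k n) * ?\<alpha> n + 4 * real (k n) * (?\<beta> n + 2 * ?q n) + 2 * (real (k n) + 3) * ?q n"
        by (rule block_char_power_approx) (use elim r_def l_ge_2 in auto)
      also have "2 * (real (k n) + 3) * ?q n \<le> 8 * real (k n) * ?q n"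
        by (rule mult_right_mono) (use elim crossing_prob_nonneg in auto)
      finally show ?case by (simp add: algebra_simps)
    qed
    have "(\<lambda>n. 16 * (real (k n) * ?\<alpha> n) + 4 * (real (k n) * ?\<beta> n) + 16 * (real (k n) * ?q n)) \<longlonglongrightarrow> 16 * 0 + 4 * 0 + 16 * 0"
      by (intro tendsto_intros mixing_small gap_crossing_small block_crossing_small)
    then show "(\<lambda>n. 16 * (real (k n) * ?\<alpha> n) + 4 * (real (k n) * ?\<beta> n) + 16 * (real (k n) * ?q n)) \<longlonglongrightarrow> 0"
      by simp
  qed
  with power show ?thesis
    using tendsto_add by fastforce
qed

end

section \<open>Convergence in probability\<close>

context prob_space
begin

definition tends_in_prob :: "(nat \<Rightarrow> 'a \<Rightarrow> real) \<Rightarrow> real \<Rightarrow> bool" where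
  "tends_in_prob F a \<longleftrightarrow> (\<forall>e>0. (\<lambda>n. \<P>(\<omega> in M. e \<le> \<bar>F n \<omega> - a\<bar>)) \<longlonglongrightarrow> 0)"

lemma prob_tendsto_0_of_le:
  assumes "g \<longlonglongrightarrow> 0" "\<And>n. measure M (A n) \<le> g n"
  shows "(\<lambda>n. measure M (A n)) \<longlonglongrightarrow> 0"
  by (rule tendsto_sandwich[OF _ _ tendsto_const assms(1)]) (auto simp: assms(2))

lemma char_distr:
  assumes [measurable]: "F \<in> borel_measurable M"
  shows "char (distr M borel F) t = (LINT \<omega>|M. iexp (t * F \<omega>))"
  unfolding char_def by (rule integral_distr) measurable

lemma cdf_distr:
  assumes [measurable]: "F \<in> borel_measurable M"
  shows "cdf (distr M borel F) x = \<P>(\<omega> in M. F \<omega> \<le> x)"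
  unfolding cdf_def by (subst measure_distr) (auto simp: vimage_def Int_def conj_commute)

lemma prob_outside_le:
  assumes [measurable]: "F \<in> borel_measurable M" and "x < y"
  shows "\<P>(\<omega> in M. F \<omega> \<le> x \<or> y < F \<omega>) = cdf (distr M borel F) x + (1 - cdf (distr M borel F) y)"
proof -
  have "{\<omega>\<in>space M. F \<omega> \<le> x \<or> y < F \<omega>} = {\<omega>\<in>space M. F \<omega> \<le> x} \<union> (space M - {\<omega>\<in>space M. F \<omega> \<le> y})"
    using \<open>x < y\<close> by auto
  also have "measure M \<dots> = \<P>(\<omega> in M. F \<omega> \<le> x) + measure M (space M - {\<omega>\<in>space M. F \<omega> \<le> y})"
    using \<open>x < y\<close> by (intro finite_measure_Union) auto
  also have "measure M (space M - {\<omega>\<in>space M. F \<omega> \<le> y}) = 1 - \<P>(\<omega> in M. F \<omega> \<le> y)"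
    by (rule prob_compl) measurable
  finally show ?thesis by (simp add: cdf_distr)
qed

text \<open>
  Convergence of the characteristic functions gives weak convergence to a point mass, whose
  distribution function is continuous away from that point.
\<close>

lemma tends_in_prob_of_char:
  assumes F [measurable]: "\<And>n. F n \<in> borel_measurable M"
    and char: "\<And>t. (\<lambda>n. LINT \<omega>|M. iexp (t * F n \<omega>)) \<longlonglongrightarrow> iexp (t * a)"
  shows "tends_in_prob F a"
  unfolding tends_in_prob_def
proof (intro allI impI)
  fix e :: real assume "0 < e"
  let ?D = "\<lambda>n. distr M borel (F n)"
  have ret: "real_distribution (return borel a)"
    by (auto intro!: real_distribution.intro prob_space_return simp: real_distribution_axioms_def)
  interpret R: real_distribution "return borel a" by (rule ret)
  have "weak_conv_m ?D (return borel a)"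
  proof (rule levy_continuity)
    show "(\<lambda>n. char (?D n) t) \<longlonglongrightarrow> char (return borel a) t" for t
      using char[of t] by (simp add: char_distr) (simp add: char_def integral_return)
  qed (auto intro: real_distribution_distr ret)
  moreover have "isCont (cdf (return borel a)) x" if "x \<noteq> a" for x
    unfolding R.isCont_cdf using that by (simp add: measure_return)
  ultimately have conv: "(\<lambda>n. cdf (?D n) x) \<longlonglongrightarrow> cdf (return borel a) x" if "x \<noteq> a" for x
    using that unfolding weak_conv_m_def weak_conv_def by blast
  have lim: "(\<lambda>n. cdf (?D n) x) \<longlonglongrightarrow> of_bool (a \<le> x)" if "x \<noteq> a" for x
  proof -
    have "(\<lambda>n. cdf (?D n) x) \<longlonglongrightarrow> cdf (return borel a) x"
      by (rule conv[OF that])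
    then show ?thesis by (simp add: cdf_def measure_return indicator_def)
  qed
  have "(\<lambda>n. cdf (?D n) (a - e/2) + (1 - cdf (?D n) (a + e/2))) \<longlonglongrightarrow> 0 + (1 - 1)"
    using lim[of "a - e/2"] lim[of "a + e/2"] \<open>0 < e\<close> by (intro tendsto_intros) auto
  then have "(\<lambda>n. cdf (?D n) (a - e/2) + (1 - cdf (?D n) (a + e/2))) \<longlonglongrightarrow> 0" by simp
  then show "(\<lambda>n. \<P>(\<omega> in M. e \<le> \<bar>F n \<omega> - a\<bar>)) \<longlonglongrightarrow> 0"
  proof (rule prob_tendsto_0_of_le)
    fix n
    have "\<P>(\<omega> in M. e \<le> \<bar>F n \<omega> - a\<bar>) \<le> \<P>(\<omega> in M. F n \<omega> \<le> a - e/2 \<or> a + e/2 < F n \<omega>)"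
      using \<open>0 < e\<close> by (intro finite_measure_mono) (auto simp: abs_if split: if_splits)
    also have "\<dots> = cdf (?D n) (a - e/2) + (1 - cdf (?D n) (a + e/2))"
      using \<open>0 < e\<close> by (intro prob_outside_le) auto
    finally show "\<P>(\<omega> in M. e \<le> \<bar>F n \<omega> - a\<bar>) \<le> cdf (?D n) (a - e/2) + (1 - cdf (?D n) (a + e/2))" .
  qed
qed

lemma isCont_cdf_std_normal: "isCont (cdf std_normal_distribution) x"
proof -
  interpret N: real_distribution std_normal_distribution by (rule real_dist_normal_dist)
  have "emeasure std_normal_distribution {x} = 0"
    by (subst emeasure_density) (auto intro!: nn_integral_zero' AE_mp[OF AE_lborel_singleton[of x]] AE_I2)
  then show ?thesis by (simp add: N.isCont_cdf measure_def)
qed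

text \<open>
  The normal distribution function has no jumps, so the tail probabilities at any \<open>K\<close> converge to
  those of the normal law.
\<close>

lemma tight_of_normal_limit:
  assumes F [measurable]: "\<And>n. F n \<in> borel_measurable M"
    and lim: "weak_conv_m (\<lambda>n. distr M borel (F n)) std_normal_distribution" and "0 < \<delta>"
  obtains K where "0 < K" "\<forall>\<^sub>F n in sequentially. \<P>(\<omega> in M. K < \<bar>F n \<omega>\<bar>) < \<delta>"
proof -
  interpret N: real_distribution std_normal_distribution by (rule real_dist_normal_dist)
  let ?D = "\<lambda>n. distr M borel (F n)" and ?N = "cdf std_normal_distribution"
  have "\<forall>\<^sub>F x in at_top. 1 - \<delta> / 2 < ?N x"
    by (rule order_tendstoD[OF N.cdf_lim_at_top_prob]) (use \<open>0 < \<delta>\<close> in simp)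
  moreover have "\<forall>\<^sub>F x in at_top. ?N (- x) < \<delta> / 2"
    using order_tendstoD(2)[OF N.cdf_lim_at_bot, of "\<delta> / 2"] \<open>0 < \<delta>\<close>
    unfolding at_bot_mirror eventually_filtermap by simp
  ultimately have "\<forall>\<^sub>F x in at_top. 0 < x \<and> ?N (- x) + (1 - ?N x) < \<delta>"
    using eventually_gt_at_top[of 0] by eventually_elim auto
  then obtain K where K: "0 < K" "?N (- K) + (1 - ?N K) < \<delta>"
    using eventually_happens'[OF trivial_limit_at_top_linorder] by blast
  have "(\<lambda>n. cdf (?D n) (- K) + (1 - cdf (?D n) K)) \<longlonglongrightarrow> ?N (- K) + (1 - ?N K)"
    using lim isCont_cdf_std_normal unfolding weak_conv_m_def weak_conv_def by (intro tendsto_intros) auto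
  from order_tendstoD(2)[OF this K(2)]
  have "\<forall>\<^sub>F n in sequentially. \<P>(\<omega> in M. K < \<bar>F n \<omega>\<bar>) < \<delta>"
  proof eventually_elim
    case (elim n)
    have "\<P>(\<omega> in M. K < \<bar>F n \<omega>\<bar>) \<le> \<P>(\<omega> in M. F n \<omega> \<le> - K \<or> K < F n \<omega>)"
      by (intro finite_measure_mono) (auto simp: abs_if split: if_splits)
    also have "\<dots> = cdf (?D n) (- K) + (1 - cdf (?D n) K)"
      using K by (intro prob_outside_le) auto
    finally show ?case using elim by simp
  qed
  with K show ?thesis using that by blast
qed

lemma char_tendsto_of_tends_in_prob:
  assumes F [measurable]: "\<And>n. F n \<in> borel_measurable M" and G [measurable]: "\<And>n. G n \<in> borel_measurable M"
    and diff: "tends_in_prob (\<lambda>n \<omega>. F n \<omega> - G n \<omega>) 0"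
    and lim: "(\<lambda>n. LINT \<omega>|M. iexp (t * G n \<omega>)) \<longlonglongrightarrow> z"
  shows "(\<lambda>n. LINT \<omega>|M. iexp (t * F n \<omega>)) \<longlonglongrightarrow> z"
proof -
  let ?E = "\<lambda>F n. LINT \<omega>|M. iexp (t * F n \<omega>)"
  let ?d = "\<lambda>n \<omega>. iexp (t * F n \<omega>) - iexp (t * G n \<omega>)"
  have "(\<lambda>n. ?E F n - ?E G n) \<longlonglongrightarrow> 0"
  proof (rule LIMSEQ_I)
    fix \<delta> :: real assume "0 < \<delta>"
    define e where "e = \<delta> / (2 * (\<bar>t\<bar> + 1))"
    have e: "0 < e" "\<bar>t\<bar> * e \<le> \<delta> / 2"
      using \<open>0 < \<delta>\<close> by (auto simp: e_def field_simps)
    have "(\<lambda>n. \<P>(\<omega> in M. e \<le> \<bar>F n \<omega> - G n \<omega>\<bar>)) \<longlonglongrightarrow> 0"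
      using diff e unfolding tends_in_prob_def by simp
    then have "\<forall>\<^sub>F n in sequentially. \<P>(\<omega> in M. e \<le> \<bar>F n \<omega> - G n \<omega>\<bar>) < \<delta> / 4"
      by (rule order_tendstoD) (use \<open>0 < \<delta>\<close> in simp)
    then have "\<forall>\<^sub>F n in sequentially. norm (?E F n - ?E G n - 0) < \<delta>"
    proof eventually_elim
      case (elim n)
      have int: "integrable M (\<lambda>\<omega>. iexp (t * F n \<omega>))" "integrable M (\<lambda>\<omega>. iexp (t * G n \<omega>))"
        by (auto intro!: integrable_const_bound[where B = 1])
      let ?A = "{\<omega>\<in>space M. e \<le> \<bar>F n \<omega> - G n \<omega>\<bar>}"
      have A: "?A \<in> sets M" by measurable
      have "norm (LINT \<omega>|M. ?d n \<omega>)
          \<le> (LINT \<omega>|M. norm (?d n \<omega>))"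
        by (rule integral_norm_bound)
      also have "\<dots> \<le> (LINT \<omega>|M. \<bar>t\<bar> * e + 2 * indicator ?A \<omega>)"
      proof (rule integral_mono)
        show "integrable M (\<lambda>\<omega>. norm (?d n \<omega>))"
          by (intro integrable_norm Bochner_Integration.integrable_diff int)
        show "integrable M (\<lambda>\<omega>. \<bar>t\<bar> * e + 2 * indicator ?A \<omega>)"
          using A by (auto intro!: integrable_real_indicator simp: less_top[symmetric])
        fix \<omega> assume \<omega>: "\<omega> \<in> space M"
        show "norm (?d n \<omega>) \<le> \<bar>t\<bar> * e + 2 * indicator ?A \<omega>"
        proof (cases "\<omega> \<in> ?A")
          case True
          have "norm (?d n \<omega>) \<le> 1 + 1"
            by (rule order_trans[OF norm_triangle_ineq4]) simp
          also have "\<dots> \<le> \<bar>t\<bar> * e + 2 * indicator ?A \<omega>" using True e by simp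
          finally show ?thesis .
        next
          case False
          have "?d n \<omega> = iexp (t * G n \<omega>) * (iexp (t * (F n \<omega> - G n \<omega>)) - 1)"
            by (simp add: algebra_simps exp_add[symmetric])
          then have "norm (?d n \<omega>) = norm (iexp (t * (F n \<omega> - G n \<omega>)) - 1)"
            by (simp only: norm_mult norm_exp_i_times mult_1)
          also have "\<dots> \<le> \<bar>t * (F n \<omega> - G n \<omega>)\<bar>"
            using iexp_approx1[of "t * (F n \<omega> - G n \<omega>)" 0] by simp
          also have "\<dots> \<le> \<bar>t\<bar> * e"
            unfolding abs_mult using False \<omega> by (intro mult_left_mono) auto
          finally show ?thesis using False by simp
        qed
      qed
      also have "\<dots> = \<bar>t\<bar> * e + 2 * measure M ?A"
        using A by (simp add: prob_space integrable_real_indicator less_top[symmetric])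
      also have "\<dots> < \<delta>" using elim e by simp
      finally show ?case using int by simp
    qed
    then show "\<exists>no. \<forall>n\<ge>no. norm (?E F n - ?E G n - 0) < \<delta>"
      by (simp add: eventually_sequentially)
  qed
  with lim show ?thesis
    using tendsto_add by fastforce
qed

lemma tends_in_prob_continuous2:
  fixes h :: "real \<Rightarrow> real \<Rightarrow> real"
  assumes X [measurable]: "\<And>n. X n \<in> borel_measurable M" and Y [measurable]: "\<And>n. Y n \<in> borel_measurable M"
    and h [measurable]: "case_prod h \<in> borel_measurable (borel \<Otimes>\<^sub>M borel)"
    and cont: "isCont (case_prod h) (a, b)"
    and X_lim: "tends_in_prob X a" and Y_lim: "tends_in_prob Y b"
  shows "tends_in_prob (\<lambda>n \<omega>. h (X n \<omega>) (Y n \<omega>)) (h a b)"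
  unfolding tends_in_prob_def
proof (intro allI impI)
  fix e :: real assume "0 < e"
  then obtain d where d: "0 < d" "\<And>p. dist p (a, b) < d \<Longrightarrow> dist (case_prod h p) (h a b) < e"
    using cont unfolding continuous_at_eps_delta by (metis case_prod_conv)
  let ?A = "\<lambda>n. {\<omega>\<in>space M. d/2 \<le> \<bar>X n \<omega> - a\<bar>}"
  let ?B = "\<lambda>n. {\<omega>\<in>space M. d/2 \<le> \<bar>Y n \<omega> - b\<bar>}"
  have "(\<lambda>n. measure M (?A n) + measure M (?B n)) \<longlonglongrightarrow> 0 + 0"
    using X_lim Y_lim half_gt_zero[OF d(1)] unfolding tends_in_prob_def
    by (intro tendsto_add) blast+
  then have "(\<lambda>n. measure M (?A n) + measure M (?B n)) \<longlonglongrightarrow> 0" by simp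
  then show "(\<lambda>n. \<P>(\<omega> in M. e \<le> \<bar>h (X n \<omega>) (Y n \<omega>) - h a b\<bar>)) \<longlonglongrightarrow> 0"
  proof (rule prob_tendsto_0_of_le)
    fix n
    have "\<P>(\<omega> in M. e \<le> \<bar>h (X n \<omega>) (Y n \<omega>) - h a b\<bar>)
        \<le> measure M (?A n \<union> ?B n)"
    proof (rule finite_measure_mono)
      show "{\<omega>\<in>space M. e \<le> \<bar>h (X n \<omega>) (Y n \<omega>) - h a b\<bar>}
          \<subseteq> ?A n \<union> ?B n"
      proof (intro subsetI, rule ccontr)
        fix \<omega> assume \<omega>: "\<omega> \<in> {\<omega>\<in>space M. e \<le> \<bar>h (X n \<omega>) (Y n \<omega>) - h a b\<bar>}"
          "\<omega> \<notin> ?A n \<union> ?B n"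
        then have "dist (X n \<omega>) a < d/2" "dist (Y n \<omega>) b < d/2" by (auto simp: dist_real_def)
        then have "dist (X n \<omega>, Y n \<omega>) (a, b) < d"
          unfolding dist_Pair_Pair
          by (intro le_less_trans[OF sqrt_sum_squares_le_sum]) auto
        from d(2)[OF this] \<omega>(1) show False by (simp add: dist_real_def)
      qed
    qed measurable
    also have "\<dots> \<le> measure M (?A n) + measure M (?B n)"
      by (rule measure_Un_le) measurable
    finally show "\<P>(\<omega> in M. e \<le> \<bar>h (X n \<omega>) (Y n \<omega>) - h a b\<bar>)
        \<le> measure M (?A n) + measure M (?B n)" .
  qed
qed

lemma tends_in_prob_add:
  assumes "\<And>n. X n \<in> borel_measurable M" "\<And>n. Y n \<in> borel_measurable M" "tends_in_prob X a" "tends_in_prob Y b"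
  shows "tends_in_prob (\<lambda>n \<omega>. X n \<omega> + Y n \<omega>) (a + b)"
  by (rule tends_in_prob_continuous2[where h = "\<lambda>x y. x + y"])
    (use assms in \<open>auto simp: case_prod_unfold intro!: continuous_intros\<close>)

lemma tends_in_prob_mult:
  assumes "\<And>n. X n \<in> borel_measurable M" "\<And>n. Y n \<in> borel_measurable M" "tends_in_prob X a" "tends_in_prob Y b"
  shows "tends_in_prob (\<lambda>n \<omega>. X n \<omega> * Y n \<omega>) (a * b)"
  by (rule tends_in_prob_continuous2[where h = "\<lambda>x y. x * y"])
    (use assms in \<open>auto simp: case_prod_unfold intro!: continuous_intros\<close>)

lemma tends_in_prob_const:
  assumes "e \<longlonglongrightarrow> a"
  shows "tends_in_prob (\<lambda>n \<omega>. e n) a"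
  unfolding tends_in_prob_def
proof (intro allI impI)
  fix d :: real assume "0 < d"
  with assms have "\<forall>\<^sub>F n in sequentially. \<bar>e n - a\<bar> < d"
    unfolding tendsto_iff by (simp add: dist_real_def)
  then have "\<forall>\<^sub>F n in sequentially. \<P>(\<omega> in M. d \<le> \<bar>e n - a\<bar>) = 0"
    by eventually_elim simp
  then show "(\<lambda>n. \<P>(\<omega> in M. d \<le> \<bar>e n - a\<bar>)) \<longlonglongrightarrow> 0"
    by (rule tendsto_eventually)
qed

lemma tends_in_prob_mult_tight:
  assumes F [measurable]: "\<And>n. F n \<in> borel_measurable M" and D [measurable]: "\<And>n. D n \<in> borel_measurable M"
    and lim: "weak_conv_m (\<lambda>n. distr M borel (F n)) std_normal_distribution"
    and D_lim: "tends_in_prob D 0"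
  shows "tends_in_prob (\<lambda>n \<omega>. D n \<omega> * F n \<omega>) 0"
  unfolding tends_in_prob_def
proof (intro allI impI LIMSEQ_I)
  fix e \<delta> :: real assume "0 < e" "0 < \<delta>"
  obtain K where K: "0 < K" "\<forall>\<^sub>F n in sequentially. \<P>(\<omega> in M. K < \<bar>F n \<omega>\<bar>) < \<delta> / 2"
    using tight_of_normal_limit[OF F lim, of "\<delta> / 2"] \<open>0 < \<delta>\<close> by auto
  have "(\<lambda>n. \<P>(\<omega> in M. e / K \<le> \<bar>D n \<omega> - 0\<bar>)) \<longlonglongrightarrow> 0"
    using D_lim K \<open>0 < e\<close> unfolding tends_in_prob_def by simp
  then have "\<forall>\<^sub>F n in sequentially. \<P>(\<omega> in M. e / K \<le> \<bar>D n \<omega> - 0\<bar>) < \<delta> / 2"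
    by (rule order_tendstoD) (use \<open>0 < \<delta>\<close> in simp)
  with K(2) have "\<forall>\<^sub>F n in sequentially. norm (\<P>(\<omega> in M. e \<le> \<bar>D n \<omega> * F n \<omega> - 0\<bar>) - 0) < \<delta>"
  proof eventually_elim
    case (elim n)
    have "\<P>(\<omega> in M. e \<le> \<bar>D n \<omega> * F n \<omega>\<bar>) \<le> measure M ({\<omega>\<in>space M. e / K \<le> \<bar>D n \<omega>\<bar>} \<union> {\<omega>\<in>space M. K < \<bar>F n \<omega>\<bar>})"
    proof (rule finite_measure_mono)
      show "{\<omega>\<in>space M. e \<le> \<bar>D n \<omega> * F n \<omega>\<bar>} \<subseteq> {\<omega>\<in>space M. e / K \<le> \<bar>D n \<omega>\<bar>} \<union> {\<omega>\<in>space M. K < \<bar>F n \<omega>\<bar>}"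
      proof (intro subsetI, rule ccontr)
        fix \<omega> assume \<omega>: "\<omega> \<in> {\<omega>\<in>space M. e \<le> \<bar>D n \<omega> * F n \<omega>\<bar>}"
          "\<omega> \<notin> {\<omega>\<in>space M. e / K \<le> \<bar>D n \<omega>\<bar>} \<union> {\<omega>\<in>space M. K < \<bar>F n \<omega>\<bar>}"
        then have "\<bar>D n \<omega>\<bar> * \<bar>F n \<omega>\<bar> \<le> \<bar>D n \<omega>\<bar> * K" by (intro mult_left_mono) auto
        also have "\<dots> < e" using \<omega> K(1) by (simp add: not_le pos_less_divide_eq)
        finally show False using \<omega>(1) by (simp add: abs_mult)
      qed
    qed measurable
    also have "\<dots> \<le> \<P>(\<omega> in M. e / K \<le> \<bar>D n \<omega>\<bar>) + \<P>(\<omega> in M. K < \<bar>F n \<omega>\<bar>)"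
      by (rule measure_Un_le) measurable
    finally show ?case using elim by simp
  qed
  then show "\<exists>no. \<forall>n\<ge>no. norm (\<P>(\<omega> in M. e \<le> \<bar>D n \<omega> * F n \<omega> - 0\<bar>) - 0) < \<delta>"
    by (simp add: eventually_sequentially)
qed

text \<open>
  Slutsky's theorem in the form that is needed for a studentized statistic: \<open>H\<close> is the random
  normalization and \<open>R\<close> an asymptotically negligible bias.
\<close>

proposition studentized_normal_limit:
  assumes G [measurable]: "\<And>n. G n \<in> borel_measurable M"
    and H [measurable]: "\<And>n. H n \<in> borel_measurable M"
    and R [measurable]: "\<And>n. R n \<in> borel_measurable M"
    and char: "\<And>t. (\<lambda>n. LINT \<omega>|M. iexp (t * G n \<omega>)) \<longlonglongrightarrow> of_real (exp (- (s * t)\<^sup>2 / 2))" and "0 < s"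
    and H_lim: "tends_in_prob H (1 / s)" and R_lim: "tends_in_prob R 0"
  shows "weak_conv_m (\<lambda>n. distr M borel (\<lambda>\<omega>. H n \<omega> * (G n \<omega> + R n \<omega>))) std_normal_distribution"
proof -
  let ?F = "\<lambda>n \<omega>. G n \<omega> / s"
  have char_F: "(\<lambda>n. LINT \<omega>|M. iexp (t * ?F n \<omega>)) \<longlonglongrightarrow> char std_normal_distribution t" for t
    using char[of "t / s"] \<open>0 < s\<close> by (simp add: char_std_normal_distribution)
  have F: "weak_conv_m (\<lambda>n. distr M borel (?F n)) std_normal_distribution"
  proof (rule levy_continuity)
    show "(\<lambda>n. char (distr M borel (?F n)) t) \<longlonglongrightarrow> char std_normal_distribution t" for t
      using char_F[of t] by (simp add: char_distr)
  qed (auto intro: real_distribution_distr real_dist_normal_dist)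
  let ?D = "\<lambda>n \<omega>. s * (H n \<omega> + - (1 / s))"
  have "tends_in_prob ?D (s * (1 / s + - (1 / s)))"
    by (intro tends_in_prob_mult tends_in_prob_add H_lim tends_in_prob_const[of "\<lambda>_. s"] tends_in_prob_const[of "\<lambda>_. - (1 / s)"] tendsto_const; measurable)
  then have "tends_in_prob (\<lambda>n \<omega>. ?D n \<omega> * ?F n \<omega>) 0"
    by (intro tends_in_prob_mult_tight[where F = ?F and D = ?D] F) (simp_all, measurable)
  moreover have "tends_in_prob (\<lambda>n \<omega>. H n \<omega> * R n \<omega>) (1 / s * 0)"
    by (intro tends_in_prob_mult H_lim R_lim; measurable)
  ultimately have "tends_in_prob (\<lambda>n \<omega>. ?D n \<omega> * ?F n \<omega> + H n \<omega> * R n \<omega>) (0 + 1 / s * 0)"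
    by (intro tends_in_prob_add; measurable)
  moreover have "?D n \<omega> * ?F n \<omega> + H n \<omega> * R n \<omega> = H n \<omega> * (G n \<omega> + R n \<omega>) - ?F n \<omega>" for n \<omega>
    using \<open>0 < s\<close> by (simp add: field_simps)
  ultimately have diff: "tends_in_prob (\<lambda>n \<omega>. H n \<omega> * (G n \<omega> + R n \<omega>) - ?F n \<omega>) 0"
    by simp
  show ?thesis
  proof (rule levy_continuity)
    show "(\<lambda>n. char (distr M borel (\<lambda>\<omega>. H n \<omega> * (G n \<omega> + R n \<omega>))) t) \<longlonglongrightarrow> char std_normal_distribution t" for t
      using char_tendsto_of_tends_in_prob[OF _ _ diff char_F[of t]] by (simp add: char_distr)
  qed (auto intro: real_distribution_distr real_dist_normal_dist)
qed

end

section \<open>Weak laws for run totals\<close>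

lemma run_sum_scale: "run_sum (\<lambda>y. a * g y) s b m = a * run_sum g s b m"
  unfolding run_sum_def sum_distrib_left by (simp only: mult.assoc)

lemma run_sum_diff: "run_sum (\<lambda>y. f y - g y) s b m = run_sum f s b m - run_sum g s b m"
  unfolding run_sum_def by (simp add: sum_subtractf left_diff_distrib)

context run_asymptotics
begin

abbreviation law :: "nat \<Rightarrow> nat measure" where
  "law n \<equiv> run_law M X (v n)"

abbreviation total :: "(nat \<Rightarrow> real) \<Rightarrow> nat \<Rightarrow> 'a \<Rightarrow> real" where
  "total f n \<omega> \<equiv> run_sum f (config (v n) \<omega>) 0 (n - 3)"

lemma sets_law: "sets (law n) = UNIV"
  by (simp add: run_law_def)

lemma measurable_law [measurable, simp]: "f \<in> law n \<rightarrow>\<^sub>M N \<longleftrightarrow> (\<forall>z. f z \<in> space N)"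
  by (subst measurable_cong_sets[OF _ refl, of _ "count_space UNIV"]) (auto simp: sets_law Pi_iff)

lemma regular_law:
  "\<forall>\<^sub>F n in sequentially. prob_space (law n) \<and> (AE z in law n. 1 \<le> z) \<and> integrable (law n) (\<lambda>z. (real z)\<^sup>2)"
  using start_prob_pos eventually_finite_runs run_square_integrable
  by eventually_elim (intro conjI prob_space_run_law AE_run_law_pos)

lemma integrable_law:
  fixes f :: "nat \<Rightarrow> 'b::{banach, second_countable_topology}"
  assumes "integrable (law n) (\<lambda>z. (real z)\<^sup>2)" "AE z in law n. 1 \<le> z" "\<And>z. 1 \<le> z \<Longrightarrow> norm (f z) \<le> C * (real z)\<^sup>2"
  shows "integrable (law n) f"
proof (rule Bochner_Integration.integrable_bound)
  show "integrable (law n) (\<lambda>z. C * (real z)\<^sup>2)" using assms(1) by simp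
  show "AE z in law n. norm (f z) \<le> norm (C * (real z)\<^sup>2)"
    using assms(2)
  proof (rule AE_mp, intro AE_I2 impI)
    fix z :: nat assume "1 \<le> z"
    from assms(3)[OF this] show "norm (f z) \<le> norm (C * (real z)\<^sup>2)" by simp
  qed
qed simp

lemma real_le_square: "1 \<le> z \<Longrightarrow> real z \<le> (real z)\<^sup>2"
  by (rule self_le_power) auto

text \<open>
  Once \<open>c\<^sub>n (exp (i t f(Z) / c\<^sub>n) - 1)\<close> is replaced by \<open>i t f(Z)\<close>, the limit is the characteristic
  function of a constant. The replacement costs at most a multiple of \<open>min |f(Z)| (f(Z)\<^sup>2 / c\<^sub>n)\<close>.
\<close>

proposition weak_law:
  assumes f: "\<And>z. 1 \<le> z \<Longrightarrow> \<bar>f z\<bar> \<le> (real z)\<^sup>2"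
    and mean: "(\<lambda>n. LINT z|law n. f z) \<longlonglongrightarrow> m"
    and trunc: "(\<lambda>n. LINT z|law n. min \<bar>f z\<bar> ((f z)\<^sup>2 / c n)) \<longlonglongrightarrow> 0"
  shows "tends_in_prob (\<lambda>n \<omega>. total f n \<omega> / c n) (\<nu> * \<eta> * m)"
proof (rule tends_in_prob_of_char)
  show "(\<lambda>\<omega>. total f n \<omega> / c n) \<in> borel_measurable M" for n by measurable
  fix t :: real
  let ?g = "\<lambda>n y. (t / c n) * f y"
  let ?e = "\<lambda>n. c n *\<^sub>R ((LINT z|law n. iexp (?g n z)) - 1)"
  let ?m = "\<lambda>n. \<i> * of_real (t * (LINT z|law n. f z))"
  let ?b = "\<lambda>n z. min \<bar>f z\<bar> ((f z)\<^sup>2 / c n)"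
  have "(\<lambda>n. block_char (?g n) (v n) (n - 3)) \<longlonglongrightarrow> exp ((\<nu> * \<eta>) *\<^sub>R (\<i> * of_real (t * m)))"
  proof (rule char_total_tendsto)
    show "\<forall>\<^sub>F n in sequentially. additivity_bound (?g n) (2 * \<bar>t\<bar> / c n)"
      using c_pos
    proof eventually_elim
      case (elim n)
      have "additivity_bound (?g n) (2 * (\<bar>t\<bar> / c n))"
        by (rule additivity_bound_quadratic) (use elim f in \<open>auto simp: abs_mult intro!: mult_left_mono divide_right_mono\<close>)
      then show ?case by simp
    qed
    have "(\<lambda>n. ?e n - ?m n) \<longlonglongrightarrow> 0"
    proof (rule Lim_null_comparison)
      show "\<forall>\<^sub>F n in sequentially. norm (?e n - ?m n)
          \<le> (2 * \<bar>t\<bar> + t\<^sup>2) * (LINT z|law n. ?b n z)"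
        using regular_law c_pos
      proof eventually_elim
        case (elim n)
        then interpret Z: prob_space "law n" by blast
        have int_f: "integrable (law n) f"
          by (rule integrable_law[where C = 1]) (use elim f in auto)
        have int_e: "integrable (law n) (\<lambda>z. iexp (?g n z))"
          by (rule Z.integrable_const_bound[where B = 1]) auto
        let ?R = "\<lambda>z. iexp (?g n z) - 1 - \<i> * (?g n z)"
        have "?e n - ?m n
            = c n *\<^sub>R (LINT z|law n. ?R z)"
        proof -
          have "(LINT z|law n. ?R z) = (LINT z|law n. iexp (?g n z)) - 1 - \<i> * of_real (t / c n * (LINT z|law n. f z))"
            using int_f int_e by (simp add: Z.prob_space)
          then show ?thesis
            using elim by (simp only: scaleR_diff_right[of "c n" _ "\<i> * _"]) (simp add: scaleR_conv_of_real)
        qed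
        then have "norm (?e n - ?m n)
            = c n * norm (LINT z|law n. ?R z)" using elim by simp
        also have "\<dots> \<le> c n * (LINT z|law n. norm (?R z))"
          using elim by (intro mult_left_mono integral_norm_bound) auto
        also have "\<dots> = (LINT z|law n. c n * norm (?R z))"
          by simp
        also have "\<dots> \<le> (LINT z|law n. (2 * \<bar>t\<bar> + t\<^sup>2) * ?b n z)"
        proof (rule integral_mono)
          show "integrable (law n) (\<lambda>z. c n * norm (?R z))"
            using int_f int_e by (intro integrable_mult_right integrable_norm Bochner_Integration.integrable_diff) auto
          show "integrable (law n) (\<lambda>z. (2 * \<bar>t\<bar> + t\<^sup>2) * ?b n z)"
            by (rule integrable_mult_right, rule Bochner_Integration.integrable_bound[OF int_f])
              (use elim in \<open>auto intro!: AE_I2\<close>)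
          fix z
          have x: "\<bar>?g n z\<bar> = \<bar>t\<bar> / c n * \<bar>f z\<bar>" using elim by (simp add: abs_mult)
          have "norm (?R z) \<le> 2 * \<bar>?g n z\<bar>"
          proof -
            have "norm (?R z) \<le> norm (iexp (?g n z) - 1) + norm (\<i> * (?g n z))"
              by (rule norm_triangle_ineq4)
            also have "\<dots> \<le> \<bar>?g n z\<bar> + \<bar>?g n z\<bar>"
              by (rule add_mono[OF norm_iexp_minus_1_le]) (simp only: norm_mult norm_of_real norm_ii mult_1 order_refl)
            finally show ?thesis by simp
          qed
          then have "c n * norm (?R z) \<le> c n * (2 * \<bar>?g n z\<bar>)"
            using elim by (intro mult_left_mono) auto
          also have "\<dots> = 2 * \<bar>t\<bar> * \<bar>f z\<bar>" using elim unfolding x by simp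
          also have "\<dots> \<le> (2 * \<bar>t\<bar> + t\<^sup>2) * \<bar>f z\<bar>" by (intro mult_right_mono) auto
          finally have 1: "c n * norm (?R z) \<le> (2 * \<bar>t\<bar> + t\<^sup>2) * \<bar>f z\<bar>" .
          have "c n * norm (?R z) \<le> c n * ((?g n z)\<^sup>2 / 2)"
            using elim by (intro mult_left_mono norm_iexp_minus_linear_le) auto
          also have "\<dots> = t\<^sup>2 / 2 * ((f z)\<^sup>2 / c n)"
            using elim by (simp add: power2_eq_square field_simps)
          also have "\<dots> \<le> (2 * \<bar>t\<bar> + t\<^sup>2) * ((f z)\<^sup>2 / c n)"
            using elim by (intro mult_right_mono) (auto intro: order_trans[of _ "t\<^sup>2"])
          finally have 2: "c n * norm (?R z) \<le> (2 * \<bar>t\<bar> + t\<^sup>2) * ((f z)\<^sup>2 / c n)" .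
          show "c n * norm (?R z) \<le> (2 * \<bar>t\<bar> + t\<^sup>2) * ?b n z"
            using 1 2 by (cases "\<bar>f z\<bar> \<le> (f z)\<^sup>2 / c n") (simp_all only: min_def if_True if_False)
        qed
        also have "\<dots> = (2 * \<bar>t\<bar> + t\<^sup>2) * (LINT z|law n. ?b n z)"
          by simp
        finally show ?case .
      qed
      show "(\<lambda>n. (2 * \<bar>t\<bar> + t\<^sup>2) * (LINT z|law n. ?b n z)) \<longlonglongrightarrow> 0"
        using tendsto_mult_left[OF trunc, of "2 * \<bar>t\<bar> + t\<^sup>2"] by simp
    qed
    moreover have "(\<lambda>n. ?m n) \<longlonglongrightarrow> \<i> * of_real (t * m)"
      by (intro tendsto_intros mean)
    ultimately show "(\<lambda>n. ?e n) \<longlonglongrightarrow> \<i> * of_real (t * m)"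
      using tendsto_add by fastforce
  qed
  moreover have "block_char (?g n) (v n) (n - 3) = (LINT \<omega>|M. iexp (t * (total f n \<omega> / c n)))" for n
    unfolding block_char_def run_sum_scale by simp
  ultimately show "(\<lambda>n. LINT \<omega>|M. iexp (t * (total f n \<omega> / c n))) \<longlonglongrightarrow> iexp (t * (\<nu> * \<eta> * m))"
    by (simp add: scaleR_conv_of_real ac_simps)
qed

definition eta_n :: "nat \<Rightarrow> real" where
  "eta_n n = 1 / (LINT z|law n. real z)"

lemma eta_n_tendsto: "eta_n \<longlonglongrightarrow> \<eta>"
proof -
  have "(\<lambda>n. 1 / (LINT z|law n. real z)) \<longlonglongrightarrow> 1 / (1 / \<eta>)"
    by (intro tendsto_divide run_mean tendsto_const) (use eta_pos in simp)
  then show ?thesis by (simp add: eta_n_def[abs_def])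
qed

lemma run_mean_pos: "\<forall>\<^sub>F n in sequentially. 0 < (LINT z|law n. real z)"
  by (rule order_tendstoD(1)[OF run_mean]) (use eta_pos in simp)

lemma eta_n_bounds: "\<forall>\<^sub>F n in sequentially. 0 < eta_n n \<and> eta_n n < \<eta> + 1"
  using run_mean_pos order_tendstoD(2)[OF eta_n_tendsto, of "\<eta> + 1"]
  by (auto simp: eta_n_def elim: eventually_elim2)

lemma expectation_total:
  assumes "\<And>z. 1 \<le> z \<Longrightarrow> \<bar>f z\<bar> \<le> (real z)\<^sup>2"
  shows "\<forall>\<^sub>F n in sequentially. (LINT \<omega>|M. total f n \<omega>) = real (n - 3) * start_prob (v n) * (LINT z|law n. f z)"
  using regular_law start_prob_pos
proof eventually_elim
  case (elim n)
  show ?case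
    by (rule expectation_run_sum) (use elim in \<open>auto intro!: integrable_law[where C = 1] simp: assms\<close>)
qed

lemma eta_n_ratio: "\<forall>\<^sub>F n in sequentially.
    (LINT \<omega>|M. total (\<lambda>_. 1) n \<omega>) / (LINT \<omega>|M. total real n \<omega>) = eta_n n"
proof -
  have "\<forall>\<^sub>F n in sequentially. (LINT \<omega>|M. total (\<lambda>_. 1) n \<omega>) = real (n - 3) * start_prob (v n) * (LINT z|law n. 1)"
    by (rule expectation_total) simp
  moreover have "\<forall>\<^sub>F n in sequentially. (LINT \<omega>|M. total real n \<omega>) = real (n - 3) * start_prob (v n) * (LINT z|law n. real z)"
    by (rule expectation_total) (use real_le_square in simp)
  ultimately show ?thesis
    using regular_law start_prob_pos eventually_gt_at_top[of 3]
  proof eventually_elim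
    case (elim n)
    then interpret Z: prob_space "law n" by blast
    have "real (n - 3) * start_prob (v n) \<noteq> 0" using elim by simp
    then show ?case unfolding elim(1,2) eta_n_def by (simp add: Z.prob_space del: of_nat_diff)
  qed
qed

end

locale run_clt = run_asymptotics +
  fixes \<sigma> :: real
  assumes run_second_moment: "(\<lambda>n. LINT z|run_law M X (v n). (real z)\<^sup>2) \<longlonglongrightarrow> \<sigma>\<^sup>2"
    and lindeberg: "\<And>\<epsilon>. 0 < \<epsilon> \<Longrightarrow>
      (\<lambda>n. LINT z|run_law M X (v n). (real z)\<^sup>2 * of_bool (\<epsilon> * c n < (real z)\<^sup>2)) \<longlonglongrightarrow> 0"
begin

lemma second_moment_over_c: "(\<lambda>n. (LINT z|law n. (real z)\<^sup>2) / c n) \<longlonglongrightarrow> 0"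
  using tendsto_mult[OF run_second_moment inverse_c] by (simp add: divide_inverse)

lemma weak_law_small:
  assumes f: "\<And>z. 1 \<le> z \<Longrightarrow> \<bar>f z\<bar> \<le> real z"
    and mean: "(\<lambda>n. LINT z|law n. f z) \<longlonglongrightarrow> m"
  shows "tends_in_prob (\<lambda>n \<omega>. total f n \<omega> / c n) (\<nu> * \<eta> * m)"
proof (rule weak_law[OF _ mean])
  show f2: "\<bar>f z\<bar> \<le> (real z)\<^sup>2" if "1 \<le> z" for z
    using f[OF that] real_le_square[OF that] by linarith
  show "(\<lambda>n. LINT z|law n. min \<bar>f z\<bar> ((f z)\<^sup>2 / c n)) \<longlonglongrightarrow> 0"
  proof (rule tendsto_sandwich[OF _ _ tendsto_const second_moment_over_c])
    show "\<forall>\<^sub>F n in sequentially. 0 \<le> (LINT z|law n. min \<bar>f z\<bar> ((f z)\<^sup>2 / c n))"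
      using c_pos by eventually_elim (auto intro!: integral_nonneg_AE AE_I2)
    show "\<forall>\<^sub>F n in sequentially. (LINT z|law n. min \<bar>f z\<bar> ((f z)\<^sup>2 / c n)) \<le> (LINT z|law n. (real z)\<^sup>2) / c n"
      using regular_law c_pos
    proof eventually_elim
      case (elim n)
      have "(LINT z|law n. min \<bar>f z\<bar> ((f z)\<^sup>2 / c n)) \<le> (LINT z|law n. (real z)\<^sup>2 / c n)"
      proof (rule integral_mono_AE)
        show "integrable (law n) (\<lambda>z. min \<bar>f z\<bar> ((f z)\<^sup>2 / c n))"
          by (rule integrable_law[where C = 1]) (use elim f2 in \<open>auto intro: min.coboundedI1\<close>)
        show "AE z in law n. min \<bar>f z\<bar> ((f z)\<^sup>2 / c n) \<le> (real z)\<^sup>2 / c n"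
          using elim(1)[THEN conjunct2, THEN conjunct1]
        proof (rule AE_mp, intro AE_I2 impI)
          fix z :: nat assume "1 \<le> z"
          then have "(f z)\<^sup>2 \<le> (real z)\<^sup>2" using f[of z] by (simp add: abs_le_square_iff[symmetric])
          then have "(f z)\<^sup>2 / c n \<le> (real z)\<^sup>2 / c n" using elim by (intro divide_right_mono) auto
          then show "min \<bar>f z\<bar> ((f z)\<^sup>2 / c n) \<le> (real z)\<^sup>2 / c n" by linarith
        qed
      qed (use elim in auto)
      then show ?case by simp
    qed
  qed
qed

lemma count_weak_law: "tends_in_prob (\<lambda>n \<omega>. total (\<lambda>_. 1) n \<omega> / c n) (\<nu> * \<eta>)"
proof -
  have "(\<lambda>n. LINT z|law n. 1 :: real) \<longlonglongrightarrow> 1"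
  proof (rule tendsto_eventually)
    show "\<forall>\<^sub>F n in sequentially. (LINT z|law n. 1 :: real) = 1"
      using regular_law by eventually_elim (simp add: prob_space.prob_space)
  qed
  then show ?thesis using weak_law_small[of "\<lambda>_. 1" 1] by simp
qed

lemma total_weak_law: "tends_in_prob (\<lambda>n \<omega>. total real n \<omega> / c n) \<nu>"
  using weak_law_small[OF _ run_mean] eta_pos by simp

text \<open>
  The fourth moment is truncated exactly where the Lindeberg condition takes over.
\<close>

lemma square_weak_law:
  assumes fourth: "(\<lambda>n. (LINT z|law n. (real z) ^ 4 * of_bool ((real z)\<^sup>2 \<le> c n)) / c n) \<longlonglongrightarrow> 0"
  shows "tends_in_prob (\<lambda>n \<omega>. total (\<lambda>z. (real z)\<^sup>2) n \<omega> / c n) (\<nu> * \<eta> * \<sigma>\<^sup>2)"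
proof (rule weak_law[OF _ run_second_moment])
  let ?b = "\<lambda>n. (LINT z|law n. (real z) ^ 4 * of_bool ((real z)\<^sup>2 \<le> c n)) / c n + (LINT z|law n. (real z)\<^sup>2 * of_bool (1 * c n < (real z)\<^sup>2))"
  have b: "?b \<longlonglongrightarrow> 0" using tendsto_add[OF fourth lindeberg[of 1]] by simp
  show "(\<lambda>n. LINT z|law n. min \<bar>(real z)\<^sup>2\<bar> (((real z)\<^sup>2)\<^sup>2 / c n)) \<longlonglongrightarrow> 0"
  proof (rule tendsto_sandwich[OF _ _ tendsto_const b])
    show "\<forall>\<^sub>F n in sequentially. 0 \<le> (LINT z|law n. min \<bar>(real z)\<^sup>2\<bar> (((real z)\<^sup>2)\<^sup>2 / c n))"
      using c_pos by eventually_elim (auto intro!: integral_nonneg_AE AE_I2)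
    show "\<forall>\<^sub>F n in sequentially. (LINT z|law n. min \<bar>(real z)\<^sup>2\<bar> (((real z)\<^sup>2)\<^sup>2 / c n)) \<le> ?b n"
      using regular_law c_pos
    proof eventually_elim
      case (elim n)
      have i1: "integrable (law n) (\<lambda>z. (real z) ^ 4 * of_bool ((real z)\<^sup>2 \<le> c n))"
      proof (rule integrable_law[where C = "c n"])
        fix z :: nat
        have "(real z) ^ 4 = (real z)\<^sup>2 * (real z)\<^sup>2" by (simp add: power_add[symmetric])
        show "norm ((real z) ^ 4 * of_bool ((real z)\<^sup>2 \<le> c n)) \<le> c n * (real z)\<^sup>2"
        proof (cases "(real z)\<^sup>2 \<le> c n")
          case True
          then have "(real z)\<^sup>2 * (real z)\<^sup>2 \<le> c n * (real z)\<^sup>2" by (intro mult_right_mono) auto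
          with True \<open>(real z) ^ 4 = _\<close> show ?thesis by simp
        qed (use elim in simp)
      qed (use elim in auto)
      have i2: "integrable (law n) (\<lambda>z. (real z)\<^sup>2 * of_bool (1 * c n < (real z)\<^sup>2))"
        by (rule integrable_law[where C = 1]) (use elim in auto)
      have "(LINT z|law n. min \<bar>(real z)\<^sup>2\<bar> (((real z)\<^sup>2)\<^sup>2 / c n))
          \<le> (LINT z|law n. (real z) ^ 4 * of_bool ((real z)\<^sup>2 \<le> c n) / c n + (real z)\<^sup>2 * of_bool (1 * c n < (real z)\<^sup>2))"
      proof (rule integral_mono)
        show "integrable (law n) (\<lambda>z. min \<bar>(real z)\<^sup>2\<bar> (((real z)\<^sup>2)\<^sup>2 / c n))"
          by (rule integrable_law[where C = 1]) (use elim in \<open>auto intro: min.coboundedI1\<close>)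
        show "integrable (law n) (\<lambda>z. (real z) ^ 4 * of_bool ((real z)\<^sup>2 \<le> c n) / c n + (real z)\<^sup>2 * of_bool (1 * c n < (real z)\<^sup>2))"
          using i1 i2 by (intro Bochner_Integration.integrable_add integrable_divide)
        show "min \<bar>(real z)\<^sup>2\<bar> (((real z)\<^sup>2)\<^sup>2 / c n)
            \<le> (real z) ^ 4 * of_bool ((real z)\<^sup>2 \<le> c n) / c n + (real z)\<^sup>2 * of_bool (1 * c n < (real z)\<^sup>2)" for z
          by (cases "(real z)\<^sup>2 \<le> c n") auto
      qed
      also have "\<dots> = ?b n"
        using i1 i2 by (subst Bochner_Integration.integral_add) auto
      finally show ?case .
    qed
  qed
qed auto

end

section \<open>The central limit theorem for runs\<close>

lemma norm_iexp_minus_quadratic_le: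
  shows "norm (iexp x - 1 - \<i> * x + x\<^sup>2 / 2) \<le> \<bar>x\<bar> ^ 3"
    and "norm (iexp x - 1 - \<i> * x + x\<^sup>2 / 2) \<le> x\<^sup>2"
proof -
  have eq: "iexp x - (\<Sum>k\<le>2. (\<i> * x) ^ k / fact k) = iexp x - 1 - \<i> * x + x\<^sup>2 / 2"
    by (simp add: numeral_2_eq_2 power2_eq_square algebra_simps)
  have "norm (iexp x - 1 - \<i> * x + x\<^sup>2 / 2) \<le> \<bar>x\<bar> ^ Suc 2 / fact (Suc 2)"
    using iexp_approx1[of x 2] unfolding eq .
  also have "\<dots> \<le> \<bar>x\<bar> ^ 3 / 1"
    by (intro frac_le) auto
  finally show "norm (iexp x - 1 - \<i> * x + x\<^sup>2 / 2) \<le> \<bar>x\<bar> ^ 3" by simp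
  show "norm (iexp x - 1 - \<i> * x + x\<^sup>2 / 2) \<le> x\<^sup>2"
    using iexp_approx2[of x 2] unfolding eq by (simp add: fact_2)
qed

context run_clt
begin

text \<open>
  By Jensen's inequality \<open>E[Z\<^sup>2] \<ge> (E[Z])\<^sup>2\<close>, so a value of \<open>(\<eta> \<sigma>)\<^sup>2\<close> other than \<open>1\<close> exceeds \<open>1\<close>
  and the limit variance is positive.
\<close>

lemma one_le_variance_factor: "1 \<le> (\<eta> * \<sigma>)\<^sup>2"
proof -
  have "(1 / \<eta>)\<^sup>2 \<le> \<sigma>\<^sup>2"
  proof (rule tendsto_le[OF trivial_limit_sequentially run_second_moment tendsto_power[OF run_mean]])
    show "\<forall>\<^sub>F n in sequentially. (LINT z|law n. real z)\<^sup>2 \<le> (LINT z|law n. (real z)\<^sup>2)"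
      using regular_law
    proof eventually_elim
      case (elim n)
      then interpret Z: prob_space "law n" by blast
      have "integrable (law n) real"
        by (rule integrable_law[where C = 1]) (use elim real_le_square in auto)
      then have "Z.variance real = (LINT z|law n. (real z)\<^sup>2) - (LINT z|law n. real z)\<^sup>2"
        by (rule Z.variance_eq) (use elim in simp)
      then show ?case using Z.variance_positive[of real] by simp
    qed
  qed
  then have "\<eta>\<^sup>2 * (1 / \<eta>)\<^sup>2 \<le> \<eta>\<^sup>2 * \<sigma>\<^sup>2"
    by (intro mult_left_mono) auto
  then show ?thesis using eta_pos by (simp add: power_mult_distrib power_divide)
qed

text \<open>
  The variable \<open>1 - \<eta>\<^sub>n Z\<close> has mean \<open>0\<close> and second moment \<open>\<eta>\<^sub>n\<^sup>2 E[Z\<^sup>2] - 1\<close>, so a second order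
  expansion of the exponential identifies the limit; the remainder is handled as in Lindeberg's
  theorem.
\<close>

lemma char_centred_total:
  "(\<lambda>n. LINT \<omega>|M. iexp (t * ((total (\<lambda>_. 1) n \<omega> - eta_n n * total real n \<omega>) / sqrt (c n))))
    \<longlonglongrightarrow> of_real (exp (- (t\<^sup>2 * (\<nu> * \<eta> * ((\<eta> * \<sigma>)\<^sup>2 - 1)) / 2)))"
proof -
  let ?\<xi> = "\<lambda>n z. 1 - eta_n n * real z"
  let ?g = "\<lambda>n z. t / sqrt (c n) * ?\<xi> n z"
  \<comment> \<open>eventually the centring constant is below \<eta> + 1, and 1 is at most the run length\<close>
  define \<kappa> where "\<kappa> = \<eta> + 2"
  have \<kappa>: "0 < \<kappa>" using eta_pos by (simp add: \<kappa>_def)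
  have \<xi>: "\<bar>?\<xi> n z\<bar> \<le> \<kappa> * real z" if "0 < eta_n n \<and> eta_n n < \<eta> + 1" "1 \<le> z" for n z
  proof -
    have "\<bar>?\<xi> n z\<bar> \<le> 1 + eta_n n * real z" using that by (simp add: abs_if)
    also have "\<dots> \<le> real z + (\<eta> + 1) * real z" using that by (intro add_mono mult_right_mono) auto
    finally show ?thesis by (simp add: \<kappa>_def algebra_simps)
  qed
  let ?w = "- of_real (t\<^sup>2 * ((\<eta> * \<sigma>)\<^sup>2 - 1) / 2) :: complex"
  have "(\<lambda>n. block_char (?g n) (v n) (n - 3)) \<longlonglongrightarrow> exp ((\<nu> * \<eta>) *\<^sub>R ?w)"
  proof (rule char_total_tendsto)
    show "\<forall>\<^sub>F n in sequentially. additivity_bound (?g n) ((\<bar>t\<bar> * \<kappa>)\<^sup>2 / c n)"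
      using c_pos eta_n_bounds
    proof eventually_elim
      case (elim n)
      have "additivity_bound (?g n) ((\<bar>t\<bar> / sqrt (c n) * \<kappa>)\<^sup>2)"
      proof (rule additivity_bound_linear)
        fix z :: nat assume "1 \<le> z"
        have "\<bar>?g n z\<bar> = \<bar>t\<bar> / sqrt (c n) * \<bar>?\<xi> n z\<bar>" using elim by (simp add: abs_mult)
        also have "\<dots> \<le> \<bar>t\<bar> / sqrt (c n) * (\<kappa> * real z)"
          using \<xi>[OF elim(2) \<open>1 \<le> z\<close>] elim by (intro mult_left_mono) auto
        finally show "\<bar>?g n z\<bar> \<le> \<bar>t\<bar> / sqrt (c n) * \<kappa> * real z" by simp
      qed
      then show ?case using elim by (simp add: power_mult_distrib power_divide)
    qed
    let ?R = "\<lambda>n z. iexp (?g n z) - 1 - \<i> * (?g n z) + (?g n z)\<^sup>2 / 2"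
    have expand: "\<forall>\<^sub>F n in sequentially. c n *\<^sub>R ((LINT z|law n. iexp (?g n z)) - 1)
        = c n *\<^sub>R (LINT z|law n. ?R n z) - of_real (t\<^sup>2 * ((eta_n n)\<^sup>2 * (LINT z|law n. (real z)\<^sup>2) - 1) / 2)"
      using regular_law c_pos run_mean_pos
    proof eventually_elim
      case (elim n)
      then interpret Z: prob_space "law n" by blast
      have int_z: "integrable (law n) real"
        by (rule integrable_law[where C = 1]) (use elim real_le_square in auto)
      have int_z2: "integrable (law n) (\<lambda>z. (real z)\<^sup>2)" using elim by blast
      have int_e: "integrable (law n) (\<lambda>z. iexp (?g n z))"
        by (rule Z.integrable_const_bound[where B = 1]) auto
      have int_x: "integrable (law n) (?g n)" using int_z by simp
      have mean_x: "(LINT z|law n. ?g n z) = 0"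
        using int_z elim(3) by (simp add: Z.prob_space eta_n_def)
      have sq: "(?g n z)\<^sup>2 = t\<^sup>2 / c n * (1 - 2 * eta_n n * real z + (eta_n n)\<^sup>2 * (real z)\<^sup>2)" for z
        using elim(2) by (simp add: power_mult_distrib power_divide power2_diff)
      have int_x2: "integrable (law n) (\<lambda>z. (?g n z)\<^sup>2)"
        unfolding sq using int_z int_z2 by simp
      have mean_x2: "(LINT z|law n. (?g n z)\<^sup>2) = t\<^sup>2 / c n * ((eta_n n)\<^sup>2 * (LINT z|law n. (real z)\<^sup>2) - 1)"
        unfolding sq using int_z int_z2 elim(3) by (simp add: Z.prob_space eta_n_def)
      have "(LINT z|law n. ?R n z) = (LINT z|law n. iexp (?g n z)) - 1 - \<i> * of_real (LINT z|law n. ?g n z)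
          + of_real (LINT z|law n. (?g n z)\<^sup>2) / 2"
      proof -
        have "(LINT z|law n. ?R n z) = (LINT z|law n. (iexp (?g n z) - 1 - \<i> * of_real (?g n z)) + of_real ((?g n z)\<^sup>2) / 2)"
          by simp
        also have "\<dots> = (LINT z|law n. iexp (?g n z) - 1 - \<i> * of_real (?g n z)) + (LINT z|law n. of_real ((?g n z)\<^sup>2) / 2)"
          by (intro Bochner_Integration.integral_add Bochner_Integration.integrable_diff integrable_mult_right integrable_of_real integrable_divide
              int_e int_x int_x2 Z.integrable_const)
        also have "(LINT z|law n. iexp (?g n z) - 1 - \<i> * of_real (?g n z))
            = (LINT z|law n. iexp (?g n z) - 1) - (LINT z|law n. \<i> * of_real (?g n z))"
          by (intro Bochner_Integration.integral_diff Bochner_Integration.integrable_diff integrable_mult_right integrable_of_real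
              int_e int_x Z.integrable_const)
        also have "(LINT z|law n. iexp (?g n z) - 1) = (LINT z|law n. iexp (?g n z)) - 1"
          using int_e by (subst Bochner_Integration.integral_diff) (auto simp: Z.prob_space)
        finally show ?thesis by (simp only: integral_mult_right_zero integral_divide_zero integral_complex_of_real)
      qed
      then have R: "(LINT z|law n. ?R n z) = (LINT z|law n. iexp (?g n z)) - 1
          + of_real (t\<^sup>2 / c n * ((eta_n n)\<^sup>2 * (LINT z|law n. (real z)\<^sup>2) - 1)) / 2"
        unfolding mean_x mean_x2 by simp
      show ?case unfolding R scaleR_add_right using elim(2) by (simp add: scaleR_conv_of_real)
    qed
    have remainder: "(\<lambda>n. c n *\<^sub>R (LINT z|law n. ?R n z)) \<longlonglongrightarrow> 0"
    proof (rule LIMSEQ_I)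
      fix \<delta> :: real assume "0 < \<delta>"
      define A where "A = (\<bar>t\<bar> * \<kappa>)\<^sup>2"
      define B where "B = \<bar>t\<bar> * \<kappa>"
      define D where "D = A * B * (\<sigma>\<^sup>2 + 1) + 1"
      \<comment> \<open>\<rho> keeps the part of the remainder with run length at most \<rho> sqrt (c n) below \<delta> / 2\<close>
      define \<rho> where "\<rho> = \<delta> / (2 * D)"
      have AB: "0 \<le> A" "0 \<le> B" using \<kappa> by (auto simp: A_def B_def)
      have den: "0 < D" unfolding D_def using AB by (intro add_nonneg_pos mult_nonneg_nonneg) auto
      have \<rho>: "0 < \<rho>" "A * B * \<rho> * (\<sigma>\<^sup>2 + 1) \<le> \<delta> / 2"
      proof -
        show "0 < \<rho>" using \<open>0 < \<delta>\<close> den by (simp add: \<rho>_def)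
        have "A * B * \<rho> * (\<sigma>\<^sup>2 + 1) \<le> \<rho> * D"
          using \<open>0 < \<rho>\<close> by (simp add: D_def algebra_simps)
        also have "\<dots> = \<delta> / 2" using den by (simp add: \<rho>_def)
        finally show "A * B * \<rho> * (\<sigma>\<^sup>2 + 1) \<le> \<delta> / 2" .
      qed
      let ?tail = "\<lambda>n. LINT z|law n. (real z)\<^sup>2 * of_bool (\<rho>\<^sup>2 * c n < (real z)\<^sup>2)"
      have "(\<lambda>n. A * ?tail n) \<longlonglongrightarrow> A * 0" using \<rho> by (intro tendsto_mult_left lindeberg) simp
      then have tail: "\<forall>\<^sub>F n in sequentially. A * ?tail n < \<delta> / 2"
        by (rule order_tendstoD) (use \<open>0 < \<delta>\<close> in simp)
      have second: "\<forall>\<^sub>F n in sequentially. (LINT z|law n. (real z)\<^sup>2) < \<sigma>\<^sup>2 + 1"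
        by (rule order_tendstoD[OF run_second_moment]) simp
      let ?bd = "\<lambda>n z. A * B * \<rho> * (real z)\<^sup>2 + A * ((real z)\<^sup>2 * of_bool (\<rho>\<^sup>2 * c n < (real z)\<^sup>2))"
      have "\<forall>\<^sub>F n in sequentially. norm (c n *\<^sub>R (LINT z|law n. ?R n z) - 0) < \<delta>"
        using tail second regular_law c_pos eta_n_bounds
      proof eventually_elim
        case (elim n)
        then interpret Z: prob_space "law n" by blast
        have bound: "c n * norm (?R n z) \<le> ?bd n z"
          if "1 \<le> z" for z
        proof -
          have "\<bar>?g n z\<bar> = \<bar>t\<bar> / sqrt (c n) * \<bar>?\<xi> n z\<bar>" using elim by (simp add: abs_mult)
          also have "\<dots> \<le> \<bar>t\<bar> / sqrt (c n) * (\<kappa> * real z)"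
            using \<xi>[OF elim(5) that] elim by (intro mult_left_mono) auto
          finally have x: "\<bar>?g n z\<bar> \<le> B * real z / sqrt (c n)" by (simp add: B_def)
          then have "\<bar>?g n z\<bar>\<^sup>2 \<le> (B * real z / sqrt (c n))\<^sup>2" by (rule power_mono) simp
          then have x2: "c n * (?g n z)\<^sup>2 \<le> A * (real z)\<^sup>2"
            using elim by (simp add: power_divide power_mult_distrib A_def B_def field_simps)
          show ?thesis
          proof (cases "\<rho>\<^sup>2 * c n < (real z)\<^sup>2")
            case True
            have "c n * norm (?R n z) \<le> c n * (?g n z)\<^sup>2"
              using elim by (intro mult_left_mono norm_iexp_minus_quadratic_le) auto
            moreover have "0 \<le> A * B * \<rho> * (real z)\<^sup>2" using AB \<rho> by simp
            ultimately show ?thesis using x2 True by simp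
          next
            case False
            then have "sqrt ((real z)\<^sup>2) \<le> sqrt (\<rho>\<^sup>2 * c n)" by (intro real_sqrt_le_mono) simp
            then have "real z \<le> \<rho> * sqrt (c n)" using \<rho> by (simp add: real_sqrt_mult)
            then have "B * real z / sqrt (c n) \<le> B * \<rho>"
              using elim AB by (simp add: divide_le_eq mult.assoc mult_left_mono)
            then have x1: "\<bar>?g n z\<bar> \<le> B * \<rho>" using x by linarith
            have "c n * norm (?R n z) \<le> c n * \<bar>?g n z\<bar> ^ 3"
              using elim by (intro mult_left_mono norm_iexp_minus_quadratic_le) auto
            also have "\<dots> = (c n * (?g n z)\<^sup>2) * \<bar>?g n z\<bar>"
              by (simp add: power3_eq_cube power2_eq_square abs_mult_self_eq flip: abs_mult)
            also have "\<dots> \<le> (A * (real z)\<^sup>2) * (B * \<rho>)"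
              by (rule mult_mono[OF x2 x1]) (use AB in auto)
            finally show ?thesis using False by (simp add: ac_simps)
          qed
        qed
        have int_tail: "integrable (law n) (\<lambda>z. (real z)\<^sup>2 * of_bool (\<rho>\<^sup>2 * c n < (real z)\<^sup>2))"
          by (rule integrable_law[where C = 1]) (use elim in auto)
        have int_bound: "integrable (law n) (\<lambda>z. ?bd n z)"
          using int_tail elim(3) by (intro Bochner_Integration.integrable_add integrable_mult_right) auto
        have AE_bound: "AE z in law n. c n * norm (?R n z) \<le> ?bd n z"
          using elim(3)[THEN conjunct2, THEN conjunct1]
          by (rule AE_mp) (intro AE_I2 impI bound)
        have int_R: "integrable (law n) (\<lambda>z. c n * norm (?R n z))"
        proof (rule Bochner_Integration.integrable_bound[OF int_bound])
          show "AE z in law n. norm (c n * norm (?R n z)) \<le> norm (?bd n z)"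
            using AE_bound by (rule AE_mp) (use elim in \<open>intro AE_I2 impI, simp\<close>)
        qed simp
        have "norm (c n *\<^sub>R (LINT z|law n. ?R n z)) = c n * norm (LINT z|law n. ?R n z)"
          using elim by simp
        also have "\<dots> \<le> c n * (LINT z|law n. norm (?R n z))"
          using elim by (intro mult_left_mono integral_norm_bound) auto
        also have "\<dots> = (LINT z|law n. c n * norm (?R n z))" by (rule integral_mult_right_zero[symmetric])
        also have "\<dots> \<le> (LINT z|law n. ?bd n z)"
          by (rule integral_mono_AE[OF int_R int_bound AE_bound])
        also have "\<dots> = A * B * \<rho> * (LINT z|law n. (real z)\<^sup>2) + A * ?tail n"
          using int_tail elim(3) by simp
        also have "\<dots> < \<delta>"
        proof -
          have "A * B * \<rho> * (LINT z|law n. (real z)\<^sup>2) \<le> A * B * \<rho> * (\<sigma>\<^sup>2 + 1)"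
            using elim AB \<rho> by (intro mult_left_mono) auto
          then show ?thesis using \<rho>(2) elim(1) by linarith
        qed
        finally show ?case by simp
      qed
      then show "\<exists>no. \<forall>n\<ge>no. norm (c n *\<^sub>R (LINT z|law n. ?R n z) - 0) < \<delta>"
        by (simp add: eventually_sequentially)
    qed
    have "(\<lambda>n. c n *\<^sub>R (LINT z|law n. ?R n z) - of_real (t\<^sup>2 * ((eta_n n)\<^sup>2 * (LINT z|law n. (real z)\<^sup>2) - 1) / 2))
        \<longlonglongrightarrow> 0 - of_real (t\<^sup>2 * (\<eta>\<^sup>2 * \<sigma>\<^sup>2 - 1) / 2)"
      by (intro tendsto_intros remainder eta_n_tendsto run_second_moment) simp
    then show "(\<lambda>n. c n *\<^sub>R ((LINT z|law n. iexp (?g n z)) - 1)) \<longlonglongrightarrow> ?w"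
      by (subst tendsto_cong[OF expand]) (simp add: power_mult_distrib)
  qed
  moreover have "block_char (?g n) (v n) (n - 3)
      = (LINT \<omega>|M. iexp (t * ((total (\<lambda>_. 1) n \<omega> - eta_n n * total real n \<omega>) / sqrt (c n))))" for n
    unfolding block_char_def run_sum_scale run_sum_diff by simp
  moreover have "exp ((\<nu> * \<eta>) *\<^sub>R ?w) = of_real (exp (- (t\<^sup>2 * (\<nu> * \<eta> * ((\<eta> * \<sigma>)\<^sup>2 - 1)) / 2)))"
  proof -
    have "(\<nu> * \<eta>) *\<^sub>R ?w = of_real (- (t\<^sup>2 * (\<nu> * \<eta> * ((\<eta> * \<sigma>)\<^sup>2 - 1)) / 2))"
      by (simp add: scaleR_conv_of_real algebra_simps)
    then show ?thesis by (simp only: exp_of_real)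
  qed
  ultimately show ?thesis by simp
qed

end

section \<open>Studentization\<close>

lemma (in prob_space) weak_conv_m_eventually_cong:
  assumes "weak_conv_m (\<lambda>n. distr M borel (F n)) N" and "\<forall>\<^sub>F n in sequentially. F n = G n"
  shows "weak_conv_m (\<lambda>n. distr M borel (G n)) N"
  unfolding weak_conv_m_def weak_conv_def
proof (intro allI impI)
  fix x assume "isCont (cdf N) x"
  then have "(\<lambda>n. cdf (distr M borel (F n)) x) \<longlonglongrightarrow> cdf N x"
    using assms(1) unfolding weak_conv_m_def weak_conv_def by blast
  moreover have "\<forall>\<^sub>F n in sequentially. cdf (distr M borel (F n)) x = cdf (distr M borel (G n)) x"
    using assms(2) by eventually_elim simp
  ultimately show "(\<lambda>n. cdf (distr M borel (G n)) x) \<longlonglongrightarrow> cdf N x"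
    by (rule Lim_transform_eventually)
qed

text \<open>
  Here \<open>a\<close>, \<open>b\<close> and \<open>d\<close> are the number of runs, their total length and the sum of their squared
  lengths, all divided by \<open>c\<close>, and \<open>h\<close> is the centring constant. The identity persists for \<open>b = 0\<close>,
  where division by \<open>0\<close> makes both sides vanish.
\<close>

lemma studentized_ratio_eq:
  fixes a b d :: real
  assumes "0 < c" "0 \<le> d / a"
  shows "sqrt (c * b / (a / b * ((a / b * sqrt (d / a))\<^sup>2 - 1))) * (a / b - \<eta>)
    = sqrt (b / (a / b * ((a / b)\<^sup>2 * (d / a) - 1))) / b * ((a * c - h * (b * c)) / sqrt c + sqrt c * (h - \<eta>) * b)"
proof (cases "b = 0")
  case False
  have "(a * c - h * (b * c)) / sqrt c = sqrt c * (a - h * b)"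
  proof -
    have "(a * c - h * (b * c)) / sqrt c = (c / sqrt c) * (a - h * b)"
      by (simp add: diff_divide_distrib algebra_simps)
    then show ?thesis using assms(1) by (simp add: real_div_sqrt)
  qed
  then have centre: "(a * c - h * (b * c)) / sqrt c + sqrt c * (h - \<eta>) * b = sqrt c * b * (a / b - \<eta>)"
    using False by (simp add: field_simps)
  have square: "(a / b * sqrt (d / a))\<^sup>2 = (a / b)\<^sup>2 * (d / a)"
    using assms(2) by (simp only: power_mult_distrib real_sqrt_pow2)
  have root: "sqrt (c * b / x) = sqrt c * sqrt (b / x)" for x
    by (simp add: real_sqrt_mult[symmetric])
  show ?thesis unfolding square root centre using False by (simp only: mult.assoc) simp
qed simp

context run_clt
begin

text \<open>
  The square root equals \<open>sqrt c\<^sub>n\<close> times a function of the three normalized totals that is continuous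
  at their limits \<open>\<nu> \<eta>\<close>, \<open>\<nu>\<close> and \<open>\<nu> \<eta> \<sigma>\<^sup>2\<close>, because \<open>(\<eta> \<sigma>)\<^sup>2 > 1\<close>.
\<close>

proposition studentized_run_ratio:
  assumes nondegenerate: "(\<eta> * \<sigma>)\<^sup>2 \<noteq> 1"
    and centring: "(\<lambda>n. sqrt (c n) * (eta_n n - \<eta>)) \<longlonglongrightarrow> 0"
    and fourth: "(\<lambda>n. (LINT z|law n. (real z) ^ 4 * of_bool ((real z)\<^sup>2 \<le> c n)) / c n) \<longlonglongrightarrow> 0"
  defines "ratio \<equiv> \<lambda>n \<omega>. total (\<lambda>_. 1) n \<omega> / total real n \<omega>"
    and "spread \<equiv> \<lambda>n \<omega>. sqrt (total (\<lambda>z. (real z)\<^sup>2) n \<omega> / total (\<lambda>_. 1) n \<omega>)"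
  shows "weak_conv_m (\<lambda>n. distr M borel (\<lambda>\<omega>.
      sqrt (total real n \<omega> / (ratio n \<omega> * ((ratio n \<omega> * spread n \<omega>)\<^sup>2 - 1))) * (ratio n \<omega> - \<eta>)))
    std_normal_distribution"
proof -
  have gap: "0 < (\<eta> * \<sigma>)\<^sup>2 - 1" using one_le_variance_factor nondegenerate by simp
  define s where "s = sqrt (\<nu> * \<eta> * ((\<eta> * \<sigma>)\<^sup>2 - 1))"
  have s: "0 < s" "s\<^sup>2 = \<nu> * \<eta> * ((\<eta> * \<sigma>)\<^sup>2 - 1)"
    using nu_pos eta_pos gap by (simp_all add: s_def)
  let ?a = "\<lambda>n \<omega>. total (\<lambda>_. 1) n \<omega> / c n"
  let ?b = "\<lambda>n \<omega>. total real n \<omega> / c n"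
  let ?d = "\<lambda>n \<omega>. total (\<lambda>z. (real z)\<^sup>2) n \<omega> / c n"
  let ?u = "\<lambda>e f. e * (e\<^sup>2 * f - 1) :: real"
  let ?h = "\<lambda>b u. sqrt (b / u) / b"
  let ?H = "\<lambda>n \<omega>. ?h (?b n \<omega>) (?u (?a n \<omega> / ?b n \<omega>) (?d n \<omega> / ?a n \<omega>))"
  let ?G = "\<lambda>n \<omega>. (total (\<lambda>_. 1) n \<omega> - eta_n n * total real n \<omega>) / sqrt (c n)"
  let ?R = "\<lambda>n \<omega>. sqrt (c n) * (eta_n n - \<eta>) * ?b n \<omega>"
  have e_lim: "tends_in_prob (\<lambda>n \<omega>. ?a n \<omega> / ?b n \<omega>) (\<nu> * \<eta> / \<nu>)"
    by (rule tends_in_prob_continuous2[where h = "\<lambda>x y. x / y" and X = ?a and Y = ?b])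
      (use nu_pos in \<open>auto simp: case_prod_unfold intro!: continuous_intros count_weak_law total_weak_law\<close>)
  have f_lim: "tends_in_prob (\<lambda>n \<omega>. ?d n \<omega> / ?a n \<omega>) (\<nu> * \<eta> * \<sigma>\<^sup>2 / (\<nu> * \<eta>))"
    by (rule tends_in_prob_continuous2[where h = "\<lambda>x y. x / y" and X = ?d and Y = ?a])
      (use nu_pos eta_pos in \<open>auto simp: case_prod_unfold intro!: continuous_intros count_weak_law square_weak_law fourth\<close>)
  have "tends_in_prob (\<lambda>n \<omega>. ?u (?a n \<omega> / ?b n \<omega>) (?d n \<omega> / ?a n \<omega>)) (?u (\<nu> * \<eta> / \<nu>) (\<nu> * \<eta> * \<sigma>\<^sup>2 / (\<nu> * \<eta>)))"
    by (rule tends_in_prob_continuous2[where h = ?u and X = "\<lambda>n \<omega>. ?a n \<omega> / ?b n \<omega>" and Y = "\<lambda>n \<omega>. ?d n \<omega> / ?a n \<omega>", OF _ _ _ _ e_lim f_lim])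
      (auto simp: case_prod_unfold intro!: continuous_intros)
  moreover have "?u (\<nu> * \<eta> / \<nu>) (\<nu> * \<eta> * \<sigma>\<^sup>2 / (\<nu> * \<eta>)) = \<eta> * ((\<eta> * \<sigma>)\<^sup>2 - 1)"
    using nu_pos eta_pos by (simp add: power_mult_distrib)
  ultimately have u_lim: "tends_in_prob (\<lambda>n \<omega>. ?u (?a n \<omega> / ?b n \<omega>) (?d n \<omega> / ?a n \<omega>)) (\<eta> * ((\<eta> * \<sigma>)\<^sup>2 - 1))"
    by simp
  have "tends_in_prob ?H (?h \<nu> (\<eta> * ((\<eta> * \<sigma>)\<^sup>2 - 1)))"
    by (rule tends_in_prob_continuous2[where h = ?h and X = ?b and Y = "\<lambda>n \<omega>. ?u (?a n \<omega> / ?b n \<omega>) (?d n \<omega> / ?a n \<omega>)", OF _ _ _ _ total_weak_law u_lim])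
      (use nu_pos eta_pos gap in \<open>auto simp: case_prod_unfold intro!: continuous_intros\<close>)
  moreover have "?h \<nu> (\<eta> * ((\<eta> * \<sigma>)\<^sup>2 - 1)) = 1 / s"
  proof -
    have "sqrt (\<nu> / (\<eta> * ((\<eta> * \<sigma>)\<^sup>2 - 1))) = \<nu> / s"
      using nu_pos eta_pos gap s
      by (intro real_sqrt_unique) (simp_all add: power_divide power2_eq_square[of \<nu>])
    then show ?thesis using nu_pos by simp
  qed
  ultimately have H_lim: "tends_in_prob ?H (1 / s)" by simp
  have "tends_in_prob ?R (0 * \<nu>)"
    by (rule tends_in_prob_mult[OF _ _ tends_in_prob_const[OF centring] total_weak_law]) auto
  then have R_lim: "tends_in_prob ?R 0" by simp
  have "weak_conv_m (\<lambda>n. distr M borel (\<lambda>\<omega>. ?H n \<omega> * (?G n \<omega> + ?R n \<omega>))) std_normal_distribution"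
  proof (rule studentized_normal_limit[OF _ _ _ _ s(1) H_lim R_lim])
    show "(\<lambda>n. LINT \<omega>|M. iexp (t * ?G n \<omega>)) \<longlonglongrightarrow> of_real (exp (- (s * t)\<^sup>2 / 2))" for t
      using char_centred_total[of t] by (simp add: power_mult_distrib s(2) ac_simps)
  qed measurable
  then show ?thesis
  proof (rule weak_conv_m_eventually_cong)
    show "\<forall>\<^sub>F n in sequentially. (\<lambda>\<omega>. ?H n \<omega> * (?G n \<omega> + ?R n \<omega>))
        = (\<lambda>\<omega>. sqrt (total real n \<omega> / (ratio n \<omega> * ((ratio n \<omega> * spread n \<omega>)\<^sup>2 - 1))) * (ratio n \<omega> - \<eta>))"
      using c_pos
    proof eventually_elim
      case (elim n)
      show ?case
      proof
        fix \<omega>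
        have nonneg: "0 \<le> ?d n \<omega> / ?a n \<omega>"
          using elim by (intro divide_nonneg_nonneg) (auto simp: run_sum_def intro!: sum_nonneg)
        have r: "ratio n \<omega> = ?a n \<omega> / ?b n \<omega>" "spread n \<omega> = sqrt (?d n \<omega> / ?a n \<omega>)"
          using elim by (simp_all add: ratio_def spread_def)
        show "?H n \<omega> * (?G n \<omega> + ?R n \<omega>)
            = sqrt (total real n \<omega> / (ratio n \<omega> * ((ratio n \<omega> * spread n \<omega>)\<^sup>2 - 1))) * (ratio n \<omega> - \<eta>)"
          unfolding r
          using studentized_ratio_eq[OF elim nonneg, of "?b n \<omega>" \<eta> "eta_n n"] elim by simp
      qed
    qed
  qed
qed

end

theorem corollary4p2:
  fixes M :: "'a measure"
    and X :: "nat \<Rightarrow> 'a \<Rightarrow> real"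
    and u :: "real \<Rightarrow> nat \<Rightarrow> real"
    and \<eta> \<nu> \<sigma> :: real
    and c v :: "nat \<Rightarrow> real"
    and k r :: "nat \<Rightarrow> nat"
  assumes "prob_space M"
    and "\<And>i. i \<ge> 1 \<Longrightarrow> X i \<in> borel_measurable M"
    and "stationary M X"
    and "\<And>\<mu>. \<mu> > 0 \<Longrightarrow> D3_condition M X (u \<mu>)"
    and "\<And>\<mu> n. \<mu> > 0 \<Longrightarrow> n \<ge> 1 \<Longrightarrow>
           (\<lambda>j. \<P>(\<omega> in M. \<forall>m\<in>{2..j}. upcrossing X (u \<mu> n) (2 * m - 1) \<omega>)) \<longlonglongrightarrow> 0"
    and "has_upcrossings_index M X u \<eta>" and "\<eta> > 0"
    and "(\<lambda>n. LINT z|run_law M X (v n). real z) \<longlonglongrightarrow> 1 / \<eta>"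
    and "\<nu> > 0"
    and "\<And>n. n \<ge> 1 \<Longrightarrow> k n > 0"
    and "filterlim c at_top sequentially" and "filterlim k at_top sequentially"
    and "(\<lambda>n. c n / real (k n)) \<longlonglongrightarrow> 0"
    and "\<And>n. r n = n div k n"
    and "\<And>n. v n = u \<nu> (nat \<lfloor>real n / c n\<rfloor>)"
    and "(\<lambda>n. real n * \<P>(\<omega> in M. upcrossing X (v n) 1 \<omega>) - c n * \<nu>) \<longlonglongrightarrow> 0"
    and "\<exists>l :: nat \<Rightarrow> nat. (\<forall>n\<ge>1. l n \<ge> 2) \<and>
           (\<lambda>n. real (k n) * (mixing_coeff M X (v n) n (l n - 2) +
              \<P>(\<omega> in M. upcrossing_process X (v n) n {0..real (l n) / real n} \<omega> > 0))) \<longlonglongrightarrow> 0"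
    and "(\<lambda>n. LINT \<omega>|M. (run_total X (v n) (min (n - 3) (r n)) \<omega>)\<^sup>2
              * of_bool (run_count X (v n) (min (n - 3) (r n)) \<omega> > 1))
           \<in> o(\<lambda>n. c n / real (k n))"
    and "\<And>\<epsilon>. \<epsilon> > 0 \<Longrightarrow> \<forall>\<^sub>F n in sequentially. \<forall>j\<in>{1..r n}.
           \<bar>LINT \<omega>|given_run M X (v n) j. (real (run_length X (v n) j \<omega>))\<^sup>2
              * of_bool (run_count X (v n) (min (n - 3) (r n)) \<omega> > 1)\<bar> < \<epsilon>"
    and "\<forall>\<^sub>F n in sequentially. integrable (run_law M X (v n)) (\<lambda>z. (real z)\<^sup>2)"
    and "(\<lambda>n. LINT z|run_law M X (v n). (real z)\<^sup>2) \<longlonglongrightarrow> \<sigma>\<^sup>2"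
    and "\<And>\<epsilon>. \<epsilon> > 0 \<Longrightarrow>
           (\<lambda>n. LINT z|run_law M X (v n). (real z)\<^sup>2 * of_bool ((real z)\<^sup>2 > \<epsilon> * c n)) \<longlonglongrightarrow> 0"
    and "(\<lambda>n. sqrt (c n) *
            ((LINT \<omega>|M. run_count X (v n) (n - 3) \<omega>) / (LINT \<omega>|M. run_total X (v n) (n - 3) \<omega>)
             - \<eta>)) \<longlonglongrightarrow> 0"
    and "(\<lambda>n. (LINT z|run_law M X (v n). (real z) ^ 4 * of_bool ((real z)\<^sup>2 \<le> c n)) / c n) \<longlonglongrightarrow> 0"
    and nondegenerate: "(\<eta> * \<sigma>)\<^sup>2 \<noteq> 1"
  shows "weak_conv_m
    (\<lambda>n. distr M borel (\<lambda>\<omega>.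
       sqrt (run_total X (v n) (n - 3) \<omega> /
             (eta_hat X (v n) n \<omega> * ((eta_hat X (v n) n \<omega> * sigma_hat X (v n) n \<omega>)\<^sup>2 - 1)))
       * (eta_hat X (v n) n \<omega> - \<eta>)))
    std_normal_distribution"
proof -
  note prob = assms(1) and meas = assms(2) and stat = assms(3) and ends = assms(5) and eta = assms(7)
    and mean = assms(8) and nu = assms(9) and c_top = assms(11) and k_top = assms(12) and r = assms(14)
    and v = assms(15) and levels = assms(16) and gaps = assms(17) and multiple = assms(18)
    and square = assms(20) and second = assms(21) and lindeberg = assms(22) and centring = assms(23)
    and fourth = assms(24) and nondegenerate = assms(25)
  interpret prob_space M by (rule prob)
  interpret stationary_sequence M X
    by unfold_locales (use meas stat in auto)
  obtain l where l: "\<And>n. 1 \<le> n \<Longrightarrow> 2 \<le> l n"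
    and separation: "(\<lambda>n. real (k n) * (mixing_coeff M X (v n) n (l n - 2) +
              \<P>(\<omega> in M. upcrossing_process X (v n) n {0..real (l n) / real n} \<omega> > 0))) \<longlonglongrightarrow> 0"
    using gaps by blast
  have q: "crossing_prob (v n) = \<P>(\<omega> in M. upcrossing X (v n) 1 \<omega>)" for n
    by (simp add: crossing_prob_def in_config)
  interpret crossing_asymptotics M X v c k r l \<nu>
    by unfold_locales (use nu c_top k_top r levels l separation in \<open>auto simp: q\<close>)
  have totals: "run_total X w m \<omega> = run_sum real (config w \<omega>) 0 m"
    "run_count X w m \<omega> = run_sum (\<lambda>_. 1) (config w \<omega>) 0 m"
    "(\<Sum>i=1..m. (real (run_length X w i \<omega>))\<^sup>2 * of_bool (run_start X w i \<omega>)) = run_sum (\<lambda>z. (real z)\<^sup>2) (config w \<omega>) 0 m"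
    for w m \<omega>
    using sum_runs_config[of real w \<omega> m] sum_runs_config[of "\<lambda>_. 1" w \<omega> m] sum_runs_config[of "\<lambda>z. (real z)\<^sup>2" w \<omega> m]
    by (simp_all add: run_total_def run_count_def)
  have runs_end: "\<forall>\<^sub>F n in sequentially.
      (\<lambda>j. \<P>(\<omega> in M. \<forall>m\<in>{2..j}. upcrossing X (v n) (2 * m - 1) \<omega>)) \<longlonglongrightarrow> 0"
    using order_tendstoD(2)[OF c_over_n, of 1, simplified] c_pos eventually_gt_at_top[of 0]
  proof eventually_elim
    case (elim n)
    then have "1 \<le> real n / c n" by (simp add: field_simps)
    \<comment> \<open>the level v n is taken from the family at a positive index, where run probabilities vanish in the limit\<close>
    then have "1 \<le> nat \<lfloor>real n / c n\<rfloor>" by (simp add: le_nat_floor)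
    then show ?case unfolding v by (intro ends nu)
  qed
  have "(\<lambda>n. (LINT \<omega>|M. (run_total X (v n) (min (n - 3) (r n)) \<omega>)\<^sup>2
              * of_bool (run_count X (v n) (min (n - 3) (r n)) \<omega> > 1)) / (c n / real (k n))) \<longlonglongrightarrow> 0"
    by (rule smalloD_tendsto[OF multiple])
  moreover have "\<forall>\<^sub>F n in sequentially. (LINT \<omega>|M. (run_total X (v n) (min (n - 3) (r n)) \<omega>)\<^sup>2
              * of_bool (run_count X (v n) (min (n - 3) (r n)) \<omega> > 1)) / (c n / real (k n))
      = real (k n) / c n * (LINT \<omega>|M. (run_sum real (config (v n) \<omega>) 0 (r n))\<^sup>2
          * of_bool (run_sum (\<lambda>_. 1) (config (v n) \<omega>) 0 (r n) > 1))"
    using k_large eventually_ge_at_top[of 6]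
  proof eventually_elim
    case (elim n)
    have "r n \<le> n div 2" unfolding r by (rule div_le_mono2) (use elim in auto)
    also have "\<dots> \<le> n - 3" using elim by linarith
    finally have "min (n - 3) (r n) = r n" by simp
    then show ?case by (simp add: totals)
  qed
  ultimately have multiple': "(\<lambda>n. real (k n) / c n * (LINT \<omega>|M. (run_sum real (config (v n) \<omega>) 0 (r n))\<^sup>2
          * of_bool (run_sum (\<lambda>_. 1) (config (v n) \<omega>) 0 (r n) > 1))) \<longlonglongrightarrow> 0"
    by (rule Lim_transform_eventually)
  interpret run_clt M X v c k r l \<nu> \<eta> \<sigma>
    by unfold_locales (use eta runs_end mean square multiple' second lindeberg in auto)
  have "(\<lambda>n. sqrt (c n) * (eta_n n - \<eta>)) \<longlonglongrightarrow> 0"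
  proof (rule Lim_transform_eventually[OF centring])
    show "\<forall>\<^sub>F n in sequentially. sqrt (c n) *
            ((LINT \<omega>|M. run_count X (v n) (n - 3) \<omega>) / (LINT \<omega>|M. run_total X (v n) (n - 3) \<omega>) - \<eta>)
        = sqrt (c n) * (eta_n n - \<eta>)"
      using eta_n_ratio by eventually_elim (simp add: totals)
  qed
  from studentized_run_ratio[OF nondegenerate this fourth]
  show ?thesis
    unfolding eta_hat_def sigma_hat_def totals .
qed

end
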